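(* Let $m+1\ge 3$ and let $(\Sigma_t)_{t\in[0,1]}$ be a bending (isometric deformation) of a compact hypersurface $\Sigma_0$ in $\mathbf{R}^{m+1}$. For $\epsilon>0$ small, let $\Sigma_t^\epsilon$ be the parallel hypersurface at distance $\epsilon$ from $\Sigma_t$. Then the area of $\Sigma_t^\epsilon$ is independent of $t$.
   Context: A smooth compact oriented hypersurface (without boundary) is understood. A bending, or isometric deformation, is a smooth one-parameter family of immersions $\phi_t:\Sigma\to\mathbf{R}^{m+1}$, $t\in[0,1]$, $\Sigma_t=\phi_t(\Sigma)$, such that the induced metric on $\Sigma$ does not depend on $t$. With $n_t$ the oriented unit normal of $\phi_t$ (depending smoothly on $t$), the parallel hypersurface $\Sigma_t^\epsilon$ is the immersed hypersurface $x\mapsto \phi_t(x)+\epsilon\, n_t(x)$, $x\in\Sigma$, where $\epsilon$ is small enough for these maps to be immersions for all $t$; "area" means its $m$-dimensional volume. *)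

theory Defs
  imports "HOL-Analysis.Analysis"
begin

text \<open>
  Infinite differentiability on sets that need not be open: derivatives are taken within the
  set, so on a product of the closed time interval with an open set the time derivatives at the
  end points are one-sided.  It is only used on sets (open sets, and such products) on which
  derivatives within the set are unique.
\<close>

primrec Ck_on :: "nat \<Rightarrow> 'b::real_normed_vector set \<Rightarrow> ('b \<Rightarrow> 'c::real_normed_vector) \<Rightarrow> bool" where
  "Ck_on 0 S f \<longleftrightarrow> continuous_on S f"
| "Ck_on (Suc k) S f \<longleftrightarrow>
     (\<exists>f'. (\<forall>x\<in>S. (f has_derivative f' x) (at x within S)) \<and> (\<forall>v. Ck_on k S (\<lambda>x. f' x v)))"

definition smooth_on :: "'b::real_normed_vector set \<Rightarrow> ('b \<Rightarrow> 'c::real_normed_vector) \<Rightarrow> bool" where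
  "smooth_on S f \<longleftrightarrow> (\<forall>k. Ck_on k S f)"

text \<open>A chart is its domain together with its coordinate map; the values of the coordinate map
  outside the domain are irrelevant.\<close>

type_synonym ('a, 'm) chart = "'a set \<times> ('a \<Rightarrow> real ^ 'm)"

definition dom_of :: "('a, 'm) chart \<Rightarrow> 'a set" where
  "dom_of c = fst c"

definition coord :: "('a, 'm) chart \<Rightarrow> 'a \<Rightarrow> real ^ 'm" where
  "coord c = snd c"

definition codom_of :: "('a, 'm) chart \<Rightarrow> (real ^ 'm) set" where
  "codom_of c = coord c ` dom_of c"

definition param :: "('a, 'm) chart \<Rightarrow> real ^ 'm \<Rightarrow> 'a" where
  "param c = inv_into (dom_of c) (coord c)"

text \<open>
  An oriented smooth atlas on the space \<open>M\<close> (without boundary, as chart images are open in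
  \<open>real ^ 'm\<close>).  It need not be maximal: it determines the smooth structure and the orientation.
  Second countability is not listed because only compact \<open>M\<close> are considered.
\<close>

definition oriented_smooth_atlas ::
    "'a::topological_space set \<Rightarrow> ('a, 'm::finite) chart set \<Rightarrow> bool" where
  "oriented_smooth_atlas M A \<longleftrightarrow>
     (\<Union>c\<in>A. dom_of c) = M \<and>
     (\<forall>c\<in>A. openin (top_of_set M) (dom_of c) \<and> open (codom_of c) \<and>
            homeomorphism (dom_of c) (codom_of c) (coord c) (param c)) \<and>
     (\<forall>c\<in>A. \<forall>d\<in>A.
        smooth_on (coord c ` (dom_of c \<inter> dom_of d)) (coord d \<circ> param c) \<and>
        (\<forall>u \<in> coord c ` (dom_of c \<inter> dom_of d).
           det (matrix (frechet_derivative (coord d \<circ> param c) (at u))) > 0))"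

definition differential ::
    "('a, 'm::finite) chart \<Rightarrow> ('a \<Rightarrow> 'v::real_normed_vector) \<Rightarrow> real ^ 'm \<Rightarrow> real ^ 'm \<Rightarrow> 'v" where
  "differential c f u = frechet_derivative (f \<circ> param c) (at u)"

definition immersion ::
    "('a, 'm::finite) chart set \<Rightarrow> ('a \<Rightarrow> 'v::real_normed_vector) \<Rightarrow> bool" where
  "immersion A f \<longleftrightarrow>
     (\<forall>c\<in>A. smooth_on (codom_of c) (f \<circ> param c) \<and>
            (\<forall>u\<in>codom_of c. inj (differential c f u)))"

definition smooth_family ::
    "('a, 'm::finite) chart set \<Rightarrow> (real \<Rightarrow> 'a \<Rightarrow> 'v::real_normed_vector) \<Rightarrow> bool" where
  "smooth_family A \<phi> \<longleftrightarrow>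
     (\<forall>c\<in>A. smooth_on ({0..1} \<times> codom_of c) (\<lambda>(t, u). \<phi> t (param c u)))"

definition induced_metric ::
    "('a, 'm::finite) chart \<Rightarrow> ('a \<Rightarrow> 'v::real_inner) \<Rightarrow> real ^ 'm \<Rightarrow> real ^ 'm \<Rightarrow> real ^ 'm \<Rightarrow> real" where
  "induced_metric c f u v w = differential c f u v \<bullet> differential c f u w"

definition bending ::
    "('a, 'm::finite) chart set \<Rightarrow> (real \<Rightarrow> 'a \<Rightarrow> 'v::real_inner) \<Rightarrow> bool" where
  "bending A \<phi> \<longleftrightarrow>
     smooth_family A \<phi> \<and>
     (\<forall>t\<in>{0..1}. immersion A (\<phi> t)) \<and>
     (\<forall>s\<in>{0..1}. \<forall>t\<in>{0..1}. \<forall>c\<in>A. \<forall>u\<in>codom_of c.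
        induced_metric c (\<phi> s) u = induced_metric c (\<phi> t) u)"

text \<open>
  Euclidean space of dimension \<open>CARD('m) + 1\<close> is \<open>real ^ 'm option\<close>.  The matrix below has the
  normal as its column \<open>None\<close> and the coordinate tangent vectors as its columns \<open>Some k\<close>; its
  determinant is positive when the normal followed by an oriented tangent basis is an oriented
  basis of the ambient space.
\<close>

definition oriented_unit_normal ::
    "('a, 'm::finite) chart set \<Rightarrow> (real \<Rightarrow> 'a \<Rightarrow> real ^ 'm option) \<Rightarrow>
      (real \<Rightarrow> 'a \<Rightarrow> real ^ 'm option) \<Rightarrow> bool" where
  "oriented_unit_normal A \<phi> n \<longleftrightarrow>
     smooth_family A n \<and>
     (\<forall>t\<in>{0..1}. \<forall>c\<in>A. \<forall>u\<in>codom_of c.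
        norm (n t (param c u)) = 1 \<and>
        (\<forall>v. n t (param c u) \<bullet> differential c (\<phi> t) u v = 0) \<and>
        det (\<chi> i j. (case j of None \<Rightarrow> n t (param c u) $ i
                            | Some k \<Rightarrow> differential c (\<phi> t) u (axis k 1) $ i)) > 0)"

definition parallel_hypersurface ::
    "(real \<Rightarrow> 'a \<Rightarrow> 'v::real_vector) \<Rightarrow> (real \<Rightarrow> 'a \<Rightarrow> 'v) \<Rightarrow> real \<Rightarrow> real \<Rightarrow> 'a \<Rightarrow> 'v" where
  "parallel_hypersurface \<phi> n \<epsilon> t x = \<phi> t x + \<epsilon> *\<^sub>R n t x"

definition area_density ::
    "('a, 'm::finite) chart \<Rightarrow> ('a \<Rightarrow> 'v::real_inner) \<Rightarrow> real ^ 'm \<Rightarrow> real" where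
  "area_density c f u = sqrt (det (\<chi> i j. induced_metric c f u (axis i 1) (axis j 1)))"

text \<open>
  The Riemannian volume of \<open>M\<close> for the metric induced by \<open>f\<close>.  A finite cover by charts is made
  disjoint by removing from each chart domain the earlier ones, and the volumes of the pieces are
  added up; by the change of variables formula the result does not depend on the cover.
\<close>

definition chart_cover :: "'a set \<Rightarrow> ('a, 'm) chart set \<Rightarrow> ('a, 'm) chart list \<Rightarrow> bool" where
  "chart_cover M A cs \<longleftrightarrow> set cs \<subseteq> A \<and> M = (\<Union>c\<in>set cs. dom_of c)"

definition area ::
    "'a set \<Rightarrow> ('a, 'm::finite) chart set \<Rightarrow> ('a \<Rightarrow> 'v::real_inner) \<Rightarrow> ennreal" where
  "area M A f =
     (let cs = (SOME cs. chart_cover M A cs)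
      in \<Sum>i<length cs.
           \<integral>\<^sup>+u \<in> coord (cs ! i) ` (dom_of (cs ! i) - (\<Union>j<i. dom_of (cs ! j))).
             ennreal (area_density (cs ! i) f u) \<partial>lborel)"

lemma chart_cover_exists:
  assumes "compact M" and "oriented_smooth_atlas M A"
  shows "\<exists>cs. chart_cover M A cs"
proof -
  have op: "\<forall>X \<in> dom_of ` A. openin (top_of_set M) X" and cov: "(\<Union>c\<in>A. dom_of c) = M"
    using assms(2) by (auto simp: oriented_smooth_atlas_def)
  obtain D where D: "D \<subseteq> dom_of ` A" "finite D" "M \<subseteq> \<Union>D"
    using assms(1) op cov unfolding compact_eq_openin_cover by (metis order_refl)
  obtain C where C: "C \<subseteq> A" "finite C" "D = dom_of ` C"
    using finite_subset_image[OF D(2) D(1)] by auto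
  obtain cs where "set cs = C"
    using finite_list[OF C(2)] by auto
  then have "chart_cover M A cs"
    using C D cov by (auto simp: chart_cover_def)
  then show ?thesis ..
qed

end

theory Submission
  imports Defs
begin

text \<open>
  Write \<open>D\<close> for the determinant of the unit normal \<open>N\<close> followed by the coordinate derivatives of
  \<open>\<phi> + \<epsilon> N\<close>.  Since these derivatives are orthogonal to \<open>N\<close>, the area density of the parallel
  hypersurface is \<open>\<bar>D\<bar>\<close>, and up to the fixed area density of the metric \<open>D\<close> is \<open>det (1 - \<epsilon> W)\<close> for
  the shape operator \<open>W\<close>.  By the Gauss equation the \<open>2 \<times> 2\<close> minors of the second fundamental form
  do not depend on time, and this forces the time derivative of \<open>D\<close> to be linear in \<open>\<epsilon>\<close>.  The
  linear term is the time derivative of the mean curvature, which equals, because an infinitesimal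
  isometric deformation is skew while the second fundamental form is symmetric, the divergence of the
  velocity of the normal, a tangential vector field.  As immersed parallel hypersurfaces have
  \<open>D \<noteq> 0\<close>, the sign of \<open>D\<close> is locally constant, and the divergence theorem shows that the area has
  derivative zero.
\<close>

section \<open>Determinants as alternating forms\<close>

text \<open>Coordinate frames are used without normalisation, so neither an inverse metric nor the
  shape operator is ever differentiated. Multiplied by the determinant \<open>vdet q\<close> of the
  original frame, \<open>D\<close> becomes det(b + eps h), where b is the Gram matrix of the frame
  and h is, up to sign, the second fundamental form; a bending fixes b, so only h moves. Likewise
  the divergence is that of a vector density, the velocity components times \<open>vdet q\<close>,
  so plain partial derivatives suffice and no connection appears.

  Two obstacles shape the rest. The area cuts charts into pieces with irregular boundary, on which
  nothing can be integrated by parts. A partition of unity replaces the pieces by boxes without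
  boundary terms, but the derivatives of the partition functions then live in different charts and
  cancel only after being carried back to common pieces; hence the detour through densities.
  Moreover constancy is claimed for every eps > 0 whose parallel maps are immersions, not only for
  small eps, so \<open>D\<close> may be negative and its sign has to be carried along.\<close>

definition vdet :: "('k::finite \<Rightarrow> real ^ 'k) \<Rightarrow> real" where
  "vdet q = det (\<chi> i. q i)"

text \<open>Rows are given by a function, so that replacing a row is the update
  \<open>q(k := v)\<close> and multilinearity can be stated one row at a time.\<close>

lemma vdet_upd: "vdet (q(k := v)) = det (\<chi> i. if i = k then v else q i)"
  unfolding vdet_def by (rule arg_cong[where f=det]) (simp add: vec_eq_iff)

lemma vdet_add: "vdet (q(k := a + b)) = vdet (q(k := a)) + vdet (q(k := b))"
  unfolding vdet_upd by (rule det_row_add)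

lemma vdet_scale: "vdet (q(k := c *\<^sub>R a)) = c * vdet (q(k := a))"
  unfolding vdet_upd scalar_mult_eq_scaleR[symmetric] by (rule det_row_mul)

lemma vdet_zero: "vdet (q(k := 0)) = 0"
  unfolding vdet_upd by (rule det_row_0)

lemma linear_vdet: "linear (\<lambda>v. vdet (q(k := v)))"
  by (rule linearI) (simp_all add: vdet_add vdet_scale)

lemma vdet_uminus: "vdet (q(k := - a)) = - vdet (q(k := a))"
  using linear_neg[OF linear_vdet] .

lemma vdet_sum: "vdet (q(k := (\<Sum>i\<in>S. f i))) = (\<Sum>i\<in>S. vdet (q(k := f i)))"
  using linear_sum[OF linear_vdet] .

lemma vdet_eq_rows: "i \<noteq> j \<Longrightarrow> q i = q j \<Longrightarrow> vdet q = 0"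
  unfolding vdet_def by (rule det_identical_rows[of i j]) (auto simp: row_def)

lemma vdet_swap:
  assumes "i \<noteq> j"
  shows "vdet (q(i := v, j := w)) = - vdet (q(i := w, j := v))"
proof -
  have *: "vdet (q(i := a, j := b)) = vdet ((q(j := b))(i := a))" for a b
    using assms by (simp add: fun_upd_twist)
  have "0 = vdet (q(i := v + w, j := v + w))"
    using assms by (intro vdet_eq_rows[of i j, symmetric]) auto
  also have "\<dots> = vdet (q(i := v + w, j := v)) + vdet (q(i := v + w, j := w))"
    by (rule vdet_add)
  also have "\<dots> = vdet (q(i := v, j := v)) + vdet (q(i := w, j := v)) +
      (vdet (q(i := v, j := w)) + vdet (q(i := w, j := w)))"
    by (simp only: * vdet_add)
  finally show ?thesis
    using assms vdet_eq_rows[of i j "q(i := v, j := v)"] vdet_eq_rows[of i j "q(i := w, j := w)"]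
    by simp
qed

text \<open>The multiples of the other rows repeat rows already present. This turns a replaced row
  into a coefficient, so that sums of such determinants become traces.\<close>

lemma vdet_cramer: "vdet (q(k := (\<Sum>i\<in>UNIV. x i *\<^sub>R q i))) = x k * vdet q"
proof -
  have "row i (\<chi> i. q i) = q i" for i
    by (simp add: row_def vec_lambda_eta)
  then show ?thesis
    using cramer_lemma_transpose[of k "\<chi> i. x i" "\<chi> i. q i"]
    unfolding vdet_upd by (simp add: scalar_mult_eq_scaleR vdet_def cong: if_cong)
qed

lemma vdet_gram: "vdet p * vdet q = vdet (\<lambda>i. \<chi> j. p i \<bullet> q j)"
proof -
  have "vdet p * vdet q = det ((\<chi> i. p i) ** transpose (\<chi> i. q i))"
    by (simp add: det_mul det_transpose vdet_def)
  also have "(\<chi> i. p i) ** transpose (\<chi> i. q i) = (\<chi> i. \<chi> j. p i \<bullet> q j)"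
    by (simp add: vec_eq_iff matrix_matrix_mult_def transpose_def inner_vec_def)
  finally show ?thesis by (simp add: vdet_def)
qed

lemma vdet_eq_0I:
  assumes "v \<noteq> 0" "\<And>i. q i \<bullet> v = 0"
  shows "vdet q = 0"
proof (rule ccontr)
  assume "vdet q \<noteq> 0"
  then have "invertible (\<chi> i. q i)"
    by (simp add: invertible_det_nz vdet_def)
  moreover have "(\<chi> i. q i) *v v = 0"
    using assms(2) by (simp add: vec_eq_iff matrix_vector_mult_def inner_vec_def)
  ultimately show False
    using assms(1) by (metis invertible_def matrix_left_invertible_ker)
qed

lemma vdet_expansion:
  assumes "vdet q \<noteq> 0"
  obtains x where "v = (\<Sum>i\<in>UNIV. x i *\<^sub>R q i)"
proof -
  have "invertible (transpose (\<chi> i. q i))"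
    using assms by (simp add: invertible_det_nz vdet_def)
  then obtain B where "transpose (\<chi> i. q i) ** B = mat 1"
    by (auto simp: invertible_def)
  then have "transpose (\<chi> i. q i) *v (B *v v) = v"
    by (simp add: matrix_vector_mul_assoc)
  then have "v = (\<Sum>i\<in>UNIV. (B *v v) $ i *\<^sub>R q i)"
    by (simp add: vec_eq_iff matrix_vector_mult_def transpose_def mult.commute)
  then show ?thesis by (rule that)
qed

lemma vdet_0_dependent:
  assumes "vdet q = 0"
  obtains x where "x \<noteq> 0" "(\<Sum>i\<in>UNIV. x $ i *\<^sub>R q i) = 0"
proof -
  have "\<not> invertible (transpose (\<chi> i. q i))"
    using assms by (simp add: invertible_det_nz vdet_def)
  then obtain x where "transpose (\<chi> i. q i) *v x = 0" "x \<noteq> 0"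
    by (metis invertible_left_inverse matrix_left_invertible_ker)
  then show ?thesis
    by (intro that[of x]) (auto simp: vec_eq_iff matrix_vector_mult_def transpose_def mult.commute)
qed

text \<open>The product rule in each term of the Leibniz sum; the replaced row contributes the
  single factor \<open>a' i v $ p i\<close>, which is split off from the product over all
  rows.\<close>

lemma has_derivative_vdet:
  assumes "\<And>i. ((\<lambda>z. a z i) has_derivative a' i) (at z within S)"
  shows "((\<lambda>z. vdet (a z)) has_derivative (\<lambda>v. \<Sum>i\<in>UNIV. vdet ((a z)(i := a' i v)))) (at z within S)"
proof -
  have c: "((\<lambda>z. a z i $ j) has_derivative (\<lambda>v. a' i v $ j)) (at z within S)" for i j
    by (rule bounded_linear.has_derivative[OF bounded_linear_vec_nth assms])
  have "((\<lambda>z. vdet (a z)) has_derivative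
      (\<lambda>v. \<Sum>p | p permutes UNIV. of_int (sign p) *
        (\<Sum>i\<in>UNIV. a' i v $ p i * (\<Prod>j\<in>UNIV - {i}. a z j $ p j)))) (at z within S)"
    unfolding vdet_def det_def vec_lambda_beta
    by (intro has_derivative_sum has_derivative_mult_right has_derivative_prod c)
  moreover have "(\<Sum>p | p permutes UNIV. of_int (sign p) *
        (\<Sum>i\<in>UNIV. a' i v $ p i * (\<Prod>j\<in>UNIV - {i}. a z j $ p j))) =
      (\<Sum>i\<in>UNIV. vdet ((a z)(i := a' i v)))" for v
  proof -
    have "vdet ((a z)(i := a' i v)) = (\<Sum>p | p permutes UNIV. of_int (sign p) *
        (a' i v $ p i * (\<Prod>j\<in>UNIV - {i}. a z j $ p j)))" for i
      unfolding vdet_def det_def vec_lambda_beta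
    proof (intro sum.cong refl arg_cong2[where f="(*)"])
      fix p
      have "(\<Prod>j\<in>UNIV. ((a z)(i := a' i v)) j $ p j) =
          ((a z)(i := a' i v)) i $ p i * (\<Prod>j\<in>UNIV - {i}. ((a z)(i := a' i v)) j $ p j)"
        by (rule prod.remove) auto
      then show "(\<Prod>j\<in>UNIV. ((a z)(i := a' i v)) j $ p j) =
          a' i v $ p i * (\<Prod>j\<in>UNIV - {i}. a z j $ p j)"
        by simp
    qed
    then show ?thesis
      by (simp add: sum_distrib_left) (rule sum.swap)
  qed
  ultimately show ?thesis by simp
qed

lemma has_real_derivative_vdet:
  assumes "\<And>i. ((\<lambda>t. a t i) has_vector_derivative a' i) (at t within S)"
  shows "((\<lambda>t. vdet (a t)) has_real_derivative (\<Sum>i\<in>UNIV. vdet ((a t)(i := a' i)))) (at t within S)"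
proof -
  have "((\<lambda>t. vdet (a t)) has_derivative (\<lambda>v. \<Sum>i\<in>UNIV. vdet ((a t)(i := v *\<^sub>R a' i)))) (at t within S)"
    using assms unfolding has_vector_derivative_def by (rule has_derivative_vdet)
  then show ?thesis
    unfolding has_field_derivative_def
    by (rule has_derivative_eq_rhs) (simp add: fun_eq_iff vdet_scale sum_distrib_left mult.commute)
qed

lemma continuous_on_vdet:
  assumes "\<And>i. continuous_on S (\<lambda>z. a z i)"
  shows "continuous_on S (\<lambda>z. vdet (a z))"
  unfolding vdet_def det_def vec_lambda_beta by (intro continuous_intros assms)

lemma vdet_expand2:
  assumes "i \<noteq> j"
  shows "vdet (m(i := v, j := w)) =
    (\<Sum>k\<in>UNIV. \<Sum>l\<in>UNIV. v $ k * w $ l * vdet (m(i := axis k 1, j := axis l 1)))"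
proof -
  have *: "vdet (m(i := a, j := b)) = vdet ((m(j := b))(i := a))" for a b
    using assms by (simp add: fun_upd_twist)
  have e: "v = (\<Sum>k\<in>UNIV. v $ k *\<^sub>R axis k 1)" for v :: "real ^ 'a"
    using basis_expansion[of v] by (simp add: scalar_mult_eq_scaleR)
  have "vdet (m(i := v, j := w)) = (\<Sum>l\<in>UNIV. w $ l * vdet (m(i := v, j := axis l 1)))"
    by (subst e[of w]) (simp only: vdet_sum vdet_scale)
  also have "\<dots> = (\<Sum>l\<in>UNIV. \<Sum>k\<in>UNIV. v $ k * w $ l * vdet (m(i := axis k 1, j := axis l 1)))"
    by (subst e[of v]) (simp add: * vdet_sum vdet_scale sum_distrib_left mult_ac)
  finally show ?thesis by (subst sum.swap)
qed

section \<open>Variations subject to the linearised Gauss equation\<close>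

lemma sum_symmetric_antisymmetric:
  fixes f g :: "'k::finite \<Rightarrow> 'k \<Rightarrow> real"
  assumes "\<And>k l. f k l = f l k" "\<And>k l. g k l = - g l k"
  shows "(\<Sum>k\<in>UNIV. \<Sum>l\<in>UNIV. f k l * g k l) = 0"
proof -
  have "(\<Sum>k\<in>UNIV. \<Sum>l\<in>UNIV. f k l * g k l) = (\<Sum>l\<in>UNIV. \<Sum>k\<in>UNIV. f k l * g k l)"
    by (rule sum.swap)
  also have "\<dots> = (\<Sum>l\<in>UNIV. \<Sum>k\<in>UNIV. - (f l k * g l k))"
    by (intro sum.cong refl) (use assms in \<open>metis mult_minus_right\<close>)
  also have "\<dots> = - (\<Sum>k\<in>UNIV. \<Sum>l\<in>UNIV. f k l * g k l)"
    by (simp add: sum_negf)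
  finally show ?thesis by simp
qed

text \<open>The terms of (i, j) and (j, i) are added. Expanding both rows in the standard basis
  gives the coefficients \<open>h' i $ k * h j $ l + h i $ k * h' j $ l\<close>, symmetric in
  \<open>k\<close> and \<open>l\<close> by hypothesis, against determinants antisymmetric in them.
  The other rows \<open>m\<close> stay arbitrary, since they will depend on eps.\<close>

lemma gauss_second_variation:
  fixes h h' m :: "'k::finite \<Rightarrow> real ^ 'k"
  assumes gauss: "\<And>i j k l. h i $ k * h' j $ l + h' i $ k * h j $ l = h i $ l * h' j $ k + h' i $ l * h j $ k"
  shows "(\<Sum>i\<in>UNIV. \<Sum>j\<in>UNIV - {i}. vdet (m(i := h' i, j := h j))) = 0"
proof -
  \<comment> \<open>The default 0 on the diagonal makes the sum over distinct indices a full double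
    sum, to which antisymmetry applies.\<close>
  define T where "T i j = (if i = j then 0 else vdet (m(i := h' i, j := h j)))" for i j
  have "T i j + T j i = 0" for i j
  proof (cases "i = j")
    case False
    let ?E = "\<lambda>k l. vdet (m(i := axis k 1, j := axis l 1))"
    have "T j i = vdet (m(i := h i, j := h' j))"
      using False by (simp add: T_def fun_upd_twist)
    then have "T i j + T j i = (\<Sum>k\<in>UNIV. \<Sum>l\<in>UNIV. (h' i $ k * h j $ l + h i $ k * h' j $ l) * ?E k l)"
      using False by (simp add: T_def vdet_expand2 sum.distrib distrib_right)
    also have "\<dots> = 0"
      using False by (intro sum_symmetric_antisymmetric vdet_swap) (use gauss in \<open>simp add: algebra_simps\<close>)
    finally show ?thesis .
  qed (simp add: T_def)
  then have "T i j = - T j i" for i j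
    by (simp add: eq_neg_iff_add_eq_0)
  then have "(\<Sum>i\<in>UNIV. \<Sum>j\<in>UNIV. 1 * T i j) = 0"
    by (intro sum_symmetric_antisymmetric refl)
  moreover have "(\<Sum>j\<in>UNIV - {i}. vdet (m(i := h' i, j := h j))) = (\<Sum>j\<in>UNIV. T i j)" for i
  proof -
    have "(\<Sum>j\<in>UNIV. T i j) = T i i + (\<Sum>j\<in>UNIV - {i}. T i j)"
      by (rule sum.remove) auto
    also have "\<dots> = (\<Sum>j\<in>UNIV - {i}. vdet (m(i := h' i, j := h j)))"
      by (auto simp: T_def intro!: sum.cong)
    finally show ?thesis by simp
  qed
  ultimately show ?thesis by simp
qed

text \<open>By the linearised Gauss equation the left-hand side has vanishing \<open>\<epsilon>\<close>-derivative.\<close>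

lemma gauss_first_variation:
  fixes b h h' :: "'k::finite \<Rightarrow> real ^ 'k"
  assumes gauss: "\<And>i j k l. h i $ k * h' j $ l + h' i $ k * h j $ l = h i $ l * h' j $ k + h' i $ l * h j $ k"
  shows "(\<Sum>i\<in>UNIV. vdet ((\<lambda>k. b k + \<epsilon> *\<^sub>R h k)(i := h' i))) = (\<Sum>i\<in>UNIV. vdet (b(i := h' i)))"
proof -
  define m where "m s k = b k + s *\<^sub>R h k" for s k
  define p where "p s = (\<Sum>i\<in>UNIV. vdet ((m s)(i := h' i)))" for s
  have "(p has_real_derivative 0) (at s)" for s
  proof -
    \<comment> \<open>Row \<open>i\<close> does not move with \<open>s\<close>, so the term
      \<open>j = i\<close> of the derivative has a zero row.\<close>
    have "((\<lambda>s. vdet ((m s)(i := h' i))) has_real_derivative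
        (\<Sum>j\<in>UNIV. vdet ((m s)(i := h' i, j := (if j = i then 0 else h j))))) (at s)" for i
      by (rule has_real_derivative_vdet)
        (auto simp: m_def fun_upd_def intro!: derivative_eq_intros)
    moreover have "(\<Sum>j\<in>UNIV. vdet ((m s)(i := h' i, j := (if j = i then 0 else h j)))) =
        (\<Sum>j\<in>UNIV - {i}. vdet ((m s)(i := h' i, j := h j)))" for i
    proof -
      let ?f = "\<lambda>j. vdet ((m s)(i := h' i, j := (if j = i then 0 else h j)))"
      have "(\<Sum>j\<in>UNIV. ?f j) = ?f i + (\<Sum>j\<in>UNIV - {i}. ?f j)"
        by (rule sum.remove) auto
      also have "?f i = 0"
        using vdet_zero[of "m s" i] by simp
      also have "(\<Sum>j\<in>UNIV - {i}. ?f j) = (\<Sum>j\<in>UNIV - {i}. vdet ((m s)(i := h' i, j := h j)))"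
        by (rule sum.cong) auto
      finally show ?thesis by (simp add: fun_upd_def)
    qed
    ultimately have "(p has_real_derivative
        (\<Sum>i\<in>UNIV. \<Sum>j\<in>UNIV - {i}. vdet ((m s)(i := h' i, j := h j)))) (at s)"
      unfolding p_def by (intro DERIV_sum) simp
    then show ?thesis by (simp add: gauss_second_variation[OF gauss])
  qed
  then have "p \<epsilon> = p 0"
    by (intro DERIV_isconst_all) blast
  then show ?thesis by (simp add: p_def m_def[abs_def])
qed

section \<open>Self-adjoint and skew-adjoint matrices\<close>

lemma matrix_mult_minus:
  fixes A B :: "real ^ 'k ^ 'k"
  shows "A ** (- B) = - (A ** B)" "(- A) ** B = - (A ** B)"
  by (simp_all add: vec_eq_iff matrix_matrix_mult_def sum_negf)

text \<open>With respect to the form \<open>b\<close>, \<open>C\<close> is self-adjoint and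
  \<open>A\<close> is skew-adjoint, so \<open>transpose C ** transpose A\<close> is conjugate by
  \<open>b\<close> to \<open>- (C ** A)\<close>. Its trace is also the trace of
  \<open>A ** C\<close>, hence the trace equals its own negative.\<close>

lemma trace_symmetric_antisymmetric:
  fixes C A b :: "real ^ 'k ^ 'k"
  assumes b: "transpose b = b" "invertible b"
    and C: "transpose (C ** b) = C ** b" and A: "transpose (A ** b) = - (A ** b)"
  shows "trace (C ** A) = 0"
proof -
  have C': "b ** transpose C = C ** b" and A': "b ** transpose A = - (A ** b)"
    using C A b by (simp_all add: matrix_transpose_mul)
  obtain b' where b': "b ** b' = mat 1" "b' ** b = mat 1"
    using b by (auto simp: invertible_def)
  have "b ** (transpose C ** transpose A) = (C ** b) ** transpose A"
    by (simp add: C'[symmetric] matrix_mul_assoc)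
  also have "\<dots> = C ** (b ** transpose A)"
    by (simp add: matrix_mul_assoc)
  also have "\<dots> = - (C ** A ** b)"
    by (simp add: A' matrix_mul_assoc matrix_mult_minus)
  finally have "b' ** (b ** (transpose C ** transpose A)) = b' ** (- (C ** A ** b))"
    by simp
  then have "transpose C ** transpose A = b' ** (- (C ** A ** b))"
    by (simp add: matrix_mul_assoc b')
  then have "trace (transpose C ** transpose A) = trace ((- (C ** A ** b)) ** b')"
    by (metis trace_mul_sym)
  also have "(- (C ** A ** b)) ** b' = - (C ** A ** (b ** b'))"
    by (simp add: matrix_mult_minus matrix_mul_assoc)
  also have "trace \<dots> = - trace (C ** A)"
    by (simp add: b' trace_def sum_negf)
  also have "trace (transpose C ** transpose A) = trace (A ** C)"
    unfolding matrix_transpose_mul[symmetric] by (simp add: trace_def transpose_def)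
  also have "\<dots> = trace (C ** A)"
    by (rule trace_mul_sym)
  finally show ?thesis by simp
qed

text \<open>In the frame \<open>q\<close>, the variation \<open>q'\<close> has a matrix
  \<open>A\<close> skew for the Gram matrix and \<open>w\<close> has a self-adjoint matrix
  \<open>C\<close>. The replaced row is a row of -CA times the Gram matrix; Cramer's rule leaves its
  diagonal entry, and the sum is a multiple of the trace of CA.\<close>

lemma vdet_rotation:
  fixes q q' w :: "'k::finite \<Rightarrow> real ^ 'k"
  assumes q: "vdet q \<noteq> 0"
    and skew: "\<And>i j. q' i \<bullet> q j + q i \<bullet> q' j = 0"
    and sym: "\<And>i j. w i \<bullet> q j = w j \<bullet> q i"
  shows "(\<Sum>i\<in>UNIV. vdet ((\<lambda>k. \<chi> j. q k \<bullet> q j)(i := (\<chi> j. w i \<bullet> q' j)))) = 0"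
proof -
  have "\<forall>i. \<exists>x. w i = (\<Sum>k\<in>UNIV. x k *\<^sub>R q k)"
    using vdet_expansion[OF q] by metis
  then obtain C where C: "\<And>i. w i = (\<Sum>k\<in>UNIV. C i k *\<^sub>R q k)" by metis
  have "\<forall>i. \<exists>x. q' i = (\<Sum>k\<in>UNIV. x k *\<^sub>R q k)"
    using vdet_expansion[OF q] by metis
  then obtain A where A: "\<And>i. q' i = (\<Sum>k\<in>UNIV. A i k *\<^sub>R q k)" by metis
  let ?b = "\<chi> i j. q i \<bullet> q j" and ?C = "\<chi> i j. C i j" and ?A = "\<chi> i j. A i j"
  have Cb: "?C ** ?b = (\<chi> i j. w i \<bullet> q j)" and Ab: "?A ** ?b = (\<chi> i j. q' i \<bullet> q j)"
    by (simp_all add: vec_eq_iff matrix_matrix_mult_def C A inner_sum_left)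
  have "trace (?C ** ?A) = 0"
  proof (rule trace_symmetric_antisymmetric)
    show "transpose ?b = ?b" by (simp add: transpose_def inner_commute)
    have "det ?b = vdet q * vdet q" by (simp add: vdet_gram) (simp add: vdet_def)
    then show "invertible ?b" using q by (simp add: invertible_det_nz)
    show "transpose (?C ** ?b) = ?C ** ?b"
      unfolding Cb using sym by (simp add: transpose_def vec_eq_iff)
    show "transpose (?A ** ?b) = - (?A ** ?b)"
      unfolding Ab using skew
      by (simp add: transpose_def vec_eq_iff) (metis add.commute add_eq_0_iff inner_commute)
  qed
  then have tr: "(\<Sum>i\<in>UNIV. \<Sum>k\<in>UNIV. C i k * A k i) = 0"
    by (simp add: trace_def matrix_matrix_mult_def)
  have row: "(\<chi> j. w i \<bullet> q' j) = (\<Sum>l\<in>UNIV. (\<Sum>k\<in>UNIV. - (C i k * A k l)) *\<^sub>R (\<chi> j. q l \<bullet> q j))" for i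
  proof -
    have "w i \<bullet> q' j = (\<Sum>k\<in>UNIV. C i k * (q k \<bullet> q' j))" for j
      by (simp add: C inner_sum_left)
    moreover have "q k \<bullet> q' j = (\<Sum>l\<in>UNIV. - A k l * (q l \<bullet> q j))" for k j
    proof -
      have "q k \<bullet> q' j = - (q' k \<bullet> q j)"
        using skew[of k j] by simp
      then show ?thesis
        by (simp add: A inner_sum_left sum_negf)
    qed
    ultimately have "w i \<bullet> q' j = (\<Sum>k\<in>UNIV. \<Sum>l\<in>UNIV. - (C i k * A k l) * (q l \<bullet> q j))" for j
      by (simp add: sum_distrib_left mult.assoc)
    also have "(\<Sum>k\<in>UNIV. \<Sum>l\<in>UNIV. - (C i k * A k l) * (q l \<bullet> q j)) =
        (\<Sum>l\<in>UNIV. (\<Sum>k\<in>UNIV. - (C i k * A k l)) * (q l \<bullet> q j))" for j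
      by (subst sum.swap) (simp add: sum_distrib_right)
    finally show ?thesis by (simp add: vec_eq_iff)
  qed
  have "vdet ((\<lambda>k. \<chi> j. q k \<bullet> q j)(i := (\<chi> j. w i \<bullet> q' j))) =
      (\<Sum>k\<in>UNIV. - (C i k * A k i)) * vdet (\<lambda>k. \<chi> j. q k \<bullet> q j)" for i
    unfolding row by (rule vdet_cramer)
  then show ?thesis
    by (simp add: sum_distrib_right[symmetric] sum_negf tr)
qed

text \<open>Here \<open>q\<close> stands for the frame formed by the unit normal and the coordinate tangent vectors, \<open>w\<close>
  for the derivatives of the normal, and \<open>w i \<bullet> q j\<close> is minus the second fundamental form.\<close>

lemma isometric_variation_vdet:
  fixes q w :: "real \<Rightarrow> 'k::finite \<Rightarrow> real ^ 'k"
  assumes dq: "\<And>i. ((\<lambda>t. q t i) has_vector_derivative q' i) (at t)"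
    and dw: "\<And>i. ((\<lambda>t. w t i) has_vector_derivative w' i) (at t)"
    and q: "vdet (q t) \<noteq> 0"
    and skew: "\<And>i j. q' i \<bullet> q t j + q t i \<bullet> q' j = 0"
    and sym: "\<And>i j. w t i \<bullet> q t j = w t j \<bullet> q t i"
    and h': "\<And>i j. h' i j = w' i \<bullet> q t j + w t i \<bullet> q' j"
    and gauss: "\<And>i j k l. (w t i \<bullet> q t k) * h' j l + h' i k * (w t j \<bullet> q t l) =
      (w t i \<bullet> q t l) * h' j k + h' i l * (w t j \<bullet> q t k)"
  shows "((\<lambda>t. vdet (\<lambda>k. q t k + \<epsilon> *\<^sub>R w t k)) has_real_derivative
    \<epsilon> * (\<Sum>i\<in>UNIV. vdet ((q t)(i := w' i)))) (at t)"
proof -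
  let ?b = "\<lambda>k. \<chi> j. q t k \<bullet> q t j" and ?h = "\<lambda>k. \<chi> j. w t k \<bullet> q t j" and ?h' = "\<lambda>k. \<chi> j. h' k j"
  define D where "D t = vdet (\<lambda>k. q t k + \<epsilon> *\<^sub>R w t k)" for t
  define D' where "D' = (\<Sum>i\<in>UNIV. vdet ((\<lambda>k. q t k + \<epsilon> *\<^sub>R w t k)(i := q' i + \<epsilon> *\<^sub>R w' i)))"
  have D: "(D has_real_derivative D') (at t)"
    unfolding D_def D'_def
    by (intro has_real_derivative_vdet has_vector_derivative_add
        bounded_linear.has_vector_derivative[OF bounded_linear_scaleR_right] dq dw)
  \<comment> \<open>The volume of the frame is stationary: this is the rotation lemma with
    \<open>w = q\<close>, where \<open>C\<close> is the identity.\<close>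
  have "(\<Sum>i\<in>UNIV. vdet ((q t)(i := q' i))) * vdet (q t) =
      (\<Sum>i\<in>UNIV. vdet (?b(i := (\<chi> j. q' i \<bullet> q t j))))"
    by (simp add: sum_distrib_right vdet_gram) (rule sum.cong, auto intro!: arg_cong[where f=vdet])
  also have "\<dots> = - (\<Sum>i\<in>UNIV. vdet (?b(i := (\<chi> j. q t i \<bullet> q' j))))"
  proof -
    have "(\<chi> j. q' i \<bullet> q t j) = - (\<chi> j. q t i \<bullet> q' j)" for i
      using skew by (simp add: vec_eq_iff) (metis add_eq_0_iff2)
    then show ?thesis by (simp only: vdet_uminus sum_negf)
  qed
  also have "\<dots> = 0"
    by (subst vdet_rotation[OF q skew, of "q t"]) (simp_all add: inner_commute)
  finally have tr: "(\<Sum>i\<in>UNIV. vdet ((q t)(i := q' i))) = 0"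
    using q by simp
  have Q: "((\<lambda>t. vdet (q t)) has_real_derivative 0) (at t)"
    using has_real_derivative_vdet[of q, OF dq] by (simp add: tr)
  \<comment> \<open>The product is differentiated in two ways: by the product rule, where
    \<open>Q\<close> leaves only \<open>D'\<close>, and as the Gram determinant
    \<open>b + \<epsilon> h\<close>, where \<open>skew\<close> makes \<open>b\<close> stationary and
    only \<open>h'\<close> survives.\<close>
  have "((\<lambda>t. D t * vdet (q t)) has_real_derivative D' * vdet (q t)) (at t)"
    by (auto intro!: derivative_eq_intros D Q)
  moreover have "((\<lambda>t. D t * vdet (q t)) has_real_derivative
      (\<Sum>i\<in>UNIV. vdet ((\<lambda>k. ?b k + \<epsilon> *\<^sub>R ?h k)(i := \<epsilon> *\<^sub>R ?h' i)))) (at t)"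
  proof -
    have eq: "D t * vdet (q t) = vdet (\<lambda>i. \<chi> j. q t i \<bullet> q t j + \<epsilon> * (w t i \<bullet> q t j))" for t
      by (simp add: D_def vdet_gram inner_add_left)
    have "((\<lambda>t. D t * vdet (q t)) has_real_derivative
      (\<Sum>i\<in>UNIV. vdet ((\<lambda>i. \<chi> j. q t i \<bullet> q t j + \<epsilon> * (w t i \<bullet> q t j))(i :=
         (\<chi> j. (q t i \<bullet> q' j + q' i \<bullet> q t j) + \<epsilon> * (w t i \<bullet> q' j + w' i \<bullet> q t j)))))) (at t)"
      unfolding eq
    proof (rule has_real_derivative_vdet)
      fix i
      have *: "((\<lambda>t. q t i \<bullet> q t j + \<epsilon> * (w t i \<bullet> q t j)) has_real_derivative
         (q t i \<bullet> q' j + q' i \<bullet> q t j) + \<epsilon> * (w t i \<bullet> q' j + w' i \<bullet> q t j)) (at t)" for j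
        by (intro DERIV_add DERIV_cmult)
          (auto simp: has_real_derivative_iff_has_vector_derivative
            intro!: bounded_bilinear.has_vector_derivative[OF bounded_bilinear_inner] dq dw)
      show "((\<lambda>x. \<chi> j. q x i \<bullet> q x j + \<epsilon> * (w x i \<bullet> q x j)) has_vector_derivative
         (\<chi> j. (q t i \<bullet> q' j + q' i \<bullet> q t j) + \<epsilon> * (w t i \<bullet> q' j + w' i \<bullet> q t j))) (at t)"
        unfolding has_vector_derivative_def
        by (subst has_derivative_componentwise_within)
           (use * in \<open>auto simp: Basis_vec_def inner_axis has_field_derivative_def mult.commute[of _ "_ + _"]\<close>)
    qed
    also have "(\<lambda>i. \<chi> j. q t i \<bullet> q t j + \<epsilon> * (w t i \<bullet> q t j)) = (\<lambda>k. ?b k + \<epsilon> *\<^sub>R ?h k)"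
      by (simp add: fun_eq_iff vec_eq_iff)
    also have "(\<lambda>i. \<chi> j. (q t i \<bullet> q' j + q' i \<bullet> q t j) + \<epsilon> * (w t i \<bullet> q' j + w' i \<bullet> q t j)) = (\<lambda>i. \<epsilon> *\<^sub>R ?h' i)"
      using skew by (simp add: fun_eq_iff vec_eq_iff h' add.commute)
    finally show ?thesis by (simp add: fun_upd_def)
  qed
  ultimately have "D' * vdet (q t) = (\<Sum>i\<in>UNIV. vdet ((\<lambda>k. ?b k + \<epsilon> *\<^sub>R ?h k)(i := \<epsilon> *\<^sub>R ?h' i)))"
    by (rule DERIV_unique)
  also have "\<dots> = \<epsilon> * (\<Sum>i\<in>UNIV. vdet ((\<lambda>k. ?b k + \<epsilon> *\<^sub>R ?h k)(i := ?h' i)))"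
    by (simp only: vdet_scale sum_distrib_left)
  also have "(\<Sum>i\<in>UNIV. vdet ((\<lambda>k. ?b k + \<epsilon> *\<^sub>R ?h k)(i := ?h' i))) = (\<Sum>i\<in>UNIV. vdet (?b(i := ?h' i)))"
    by (rule gauss_first_variation) (simp, rule gauss)
  \<comment> \<open>The derivative of \<open>w i \<bullet> q j\<close> has two parts; the one in
    which the frame moves is removed by the rotation lemma.\<close>
  also have "\<dots> = (\<Sum>i\<in>UNIV. vdet (?b(i := (\<chi> j. w' i \<bullet> q t j)))) + (\<Sum>i\<in>UNIV. vdet (?b(i := (\<chi> j. w t i \<bullet> q' j))))"
  proof -
    have "?h' i = (\<chi> j. w' i \<bullet> q t j) + (\<chi> j. w t i \<bullet> q' j)" for i
      by (simp add: vec_eq_iff h')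
    then show ?thesis by (simp only: vdet_add sum.distrib)
  qed
  also have "(\<Sum>i\<in>UNIV. vdet (?b(i := (\<chi> j. w t i \<bullet> q' j)))) = 0"
    by (rule vdet_rotation[OF q skew sym])
  also have "(\<Sum>i\<in>UNIV. vdet (?b(i := (\<chi> j. w' i \<bullet> q t j)))) = (\<Sum>i\<in>UNIV. vdet ((q t)(i := w' i))) * vdet (q t)"
    by (simp add: sum_distrib_right vdet_gram) (rule sum.cong, auto intro!: arg_cong[where f=vdet])
  finally have "D' = \<epsilon> * (\<Sum>i\<in>UNIV. vdet ((q t)(i := w' i)))"
    using q by simp
  then show ?thesis using D by (simp add: D_def[abs_def])
qed

section \<open>Change of variables for arbitrary finite index types\<close>

text \<open>\<open>A\<close> on the block of indices \<open>range r\<close>, the identity elsewhere.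
  Along a bijection this renames rows and columns; along \<open>Some\<close> it adds a row and a
  column for the normal.\<close>

definition extend_matrix :: "('m \<Rightarrow> 'k) \<Rightarrow> real ^ 'm ^ 'm \<Rightarrow> real ^ 'k ^ 'k" where
  "extend_matrix r A = (\<chi> i j. if i \<in> range r \<and> j \<in> range r then A $ inv r i $ inv r j else of_bool (i = j))"

lemma extend_matrix_nth [simp]:
  assumes "inj r"
  shows "extend_matrix r A $ r i $ r j = A $ i $ j"
    and "i' \<notin> range r \<Longrightarrow> extend_matrix r A $ i' $ j' = of_bool (i' = j')"
    and "j' \<notin> range r \<Longrightarrow> extend_matrix r A $ i' $ j' = of_bool (i' = j')"
  using assms by (simp_all add: extend_matrix_def)

lemma extend_matrix_mult:
  fixes r :: "'m::finite \<Rightarrow> 'k::finite"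
  assumes r: "inj r"
  shows "extend_matrix r (A ** B) = extend_matrix r A ** extend_matrix r B"
proof -
  have split: "(\<Sum>k\<in>UNIV. f k) = (\<Sum>k\<in>UNIV. f (r k)) + (\<Sum>k\<in>- range r. f k)" for f :: "'k \<Rightarrow> real"
  proof -
    have "(\<Sum>k\<in>UNIV. f k) = (\<Sum>k\<in>range r. f k) + (\<Sum>k\<in>- range r. f k)"
      by (subst sum.union_disjoint[symmetric]) auto
    then show ?thesis
      using r by (simp add: sum.reindex)
  qed
  have "extend_matrix r (A ** B) $ i $ j = (extend_matrix r A ** extend_matrix r B) $ i $ j" for i j
  proof (cases "i \<in> range r")
    case True
    then obtain i' where i: "i = r i'" by blast
    have ni: "k \<noteq> i" if "k \<notin> range r" for k
      using that True by blast
    show ?thesis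
    proof (cases "j \<in> range r")
      case True
      then show ?thesis
        using r ni by (auto simp: i matrix_matrix_mult_def split intro!: sum.neutral)
    next
      case False
      then have "r k \<noteq> j" for k by blast
      with False show ?thesis
        using r ni by (auto simp: i matrix_matrix_mult_def split intro!: sum.neutral)
    qed
  next
    case False
    then have "(\<Sum>k\<in>UNIV. of_bool (i = k) * extend_matrix r B $ k $ j) = extend_matrix r B $ i $ j"
      by (simp add: of_bool_def if_distrib if_distribR cong: if_cong)
    then show ?thesis
      using False r by (simp add: matrix_matrix_mult_def)
  qed
  then show ?thesis by (simp add: vec_eq_iff)
qed

lemma det_transvection:
  fixes m n :: "'n::finite" and c :: real
  assumes "m \<noteq> n"
  shows "det (\<chi> i j. if i = m \<and> j = n then c else of_bool (i = j)) = 1"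
proof -
  have "(\<chi> i j. if i = m \<and> j = n then c else of_bool (i = j)) =
      (\<chi> k. if k = m then row m (mat 1) + c *s row n (mat 1) else row k (mat 1))"
    using assms by (auto simp: vec_eq_iff row_def mat_def)
  then show ?thesis
    using det_row_operation[OF assms, where c = c and A = "mat 1 :: real ^ 'n ^ 'n"] by simp
qed

text \<open>Extension is multiplicative, so elementary matrices suffice, and each extends to one of
  the same kind: a zero row stays zero, a diagonal matrix gains entries 1, swaps and transvections
  move to the images of their indices.\<close>

lemma det_extend_matrix:
  fixes r :: "'m::finite \<Rightarrow> 'k::finite"
  assumes r: "inj r"
  shows "det (extend_matrix r A) = det A"
proof (induction A rule: induct_matrix_elementary[case_names mult zero_row diagonal swap1 idplus])
  case (mult A B)
  then show ?case by (simp add: extend_matrix_mult[OF r] det_mul)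
next
  case (zero_row A i)
  have "row (r i) (extend_matrix r A) $ j = 0" for j
    using zero_row r by (cases "j \<in> range r") (auto simp: row_def vec_eq_iff)
  then have "row (r i) (extend_matrix r A) = 0"
    by (simp add: vec_eq_iff)
  then show ?case
    using zero_row by (simp add: det_zero_row(2))
next
  case (diagonal A)
  have "extend_matrix r A $ i $ j = 0" if "i \<noteq> j" for i j
    using that r diagonal by (cases "i \<in> range r"; cases "j \<in> range r") (auto simp: inj_eq)
  then have "det (extend_matrix r A) = (\<Prod>i\<in>UNIV. extend_matrix r A $ i $ i)"
    by (rule det_diagonal)
  also have "\<dots> = (\<Prod>i\<in>range r. extend_matrix r A $ i $ i)"
    by (rule prod.mono_neutral_right) (auto simp: r)
  also have "\<dots> = (\<Prod>i\<in>UNIV. A $ i $ i)"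
    using r by (simp add: prod.reindex)
  finally show ?case
    using diagonal by (simp add: det_diagonal)
next
  case (swap1 m n)
  let ?S = "(\<chi> i j. mat 1 $ i $ Transposition.transpose m n j) :: real ^ 'm ^ 'm"
  have "extend_matrix r ?S $ i $ j = mat 1 $ i $ Transposition.transpose (r m) (r n) j" for i j
  proof (cases "j \<in> range r")
    case True
    then obtain j' where j: "j = r j'" by blast
    have "Transposition.transpose (r m) (r n) j = r (Transposition.transpose m n j')"
      unfolding j using r by (simp add: Transposition.transpose_def inj_eq)
    then show ?thesis
      using r j by (cases "i \<in> range r") (auto simp: mat_def inj_eq)
  next
    case False
    then have "Transposition.transpose (r m) (r n) j = j"
      by (auto simp: Transposition.transpose_def)
    then show ?thesis
      using False r by (simp add: mat_def)
  qed
  then have "extend_matrix r ?S = (\<chi> i j. mat 1 $ i $ Transposition.transpose (r m) (r n) j)"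
    by (simp add: vec_eq_iff)
  then have "det (extend_matrix r ?S) = of_int (sign (Transposition.transpose (r m) (r n)))"
    using det_permute_columns[of "Transposition.transpose (r m) (r n)" "mat 1"]
    by (simp add: permutes_swap_id)
  also have "\<dots> = of_int (sign (Transposition.transpose m n))"
    using swap1 r by (simp add: sign_swap_id inj_eq)
  also have "\<dots> = det ?S"
    using det_permute_columns[of "Transposition.transpose m n" "mat 1 :: real ^ 'm ^ 'm"]
    by (simp add: permutes_swap_id)
  finally show ?case .
next
  case (idplus m n c)

  have "extend_matrix r (\<chi> i j. if i = m \<and> j = n then c else of_bool (i = j)) $ i $ j =
      (\<chi> i j. if i = r m \<and> j = r n then c else of_bool (i = j)) $ i $ j" for i j
    using r idplus by (cases "i \<in> range r"; cases "j \<in> range r") (auto simp: inj_eq)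
  then have "extend_matrix r (\<chi> i j. if i = m \<and> j = n then c else of_bool (i = j)) =
      (\<chi> i j. if i = r m \<and> j = r n then c else of_bool (i = j))"
    by (simp add: vec_eq_iff)
  then show ?case
    using idplus r by (simp add: det_transvection inj_eq)
qed

text \<open>The library's change of variables formula is stated for well-ordered index types; \<open>'n index\<close>
  is a well-ordered copy of the finite type \<open>'n\<close>.\<close>

typedef 'n index = "{..<CARD('n::finite)}"
  by (auto intro!: exI[of _ 0])

instantiation index :: (finite) linorder
begin
definition "x \<le> y \<longleftrightarrow> Rep_index (x :: 'a index) \<le> Rep_index y"
definition "x < y \<longleftrightarrow> Rep_index (x :: 'a index) < Rep_index y"
instance
  by standard (auto simp: less_eq_index_def less_index_def Rep_index_inject)
end

instance index :: (finite) wellorder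
proof
  fix P :: "'a index \<Rightarrow> bool" and a
  assume "\<And>x. (\<And>y. y < x \<Longrightarrow> P y) \<Longrightarrow> P x"
  then show "P a"
    by (induction "Rep_index a" arbitrary: a rule: less_induct) (metis less_index_def)
qed

instance index :: (finite) finite
proof
  have "finite (Rep_index ` (UNIV :: 'a index set))"
    by (rule finite_subset[of _ "{..<CARD('a)}"]) (use Rep_index in auto)
  then show "finite (UNIV :: 'a index set)"
    by (rule finite_imageD) (auto simp: inj_on_def Rep_index_inject)
qed

lemma index_bij: "\<exists>r :: 'n::finite index \<Rightarrow> 'n. bij r"
proof -
  have "CARD('n index) = CARD('n)"
    unfolding type_definition.card[OF type_definition_index] by simp
  then obtain r :: "'n index \<Rightarrow> 'n" where "bij_betw r UNIV UNIV"
    using finite_same_card_bij[of "UNIV :: 'n index set" "UNIV :: 'n set"] by auto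
  then show ?thesis by blast
qed

section \<open>Invariance of the integral under permutations of coordinates\<close>

definition reindex :: "('k::finite \<Rightarrow> 'm::finite) \<Rightarrow> real ^ 'm \<Rightarrow> real ^ 'k" where
  "reindex r x = (\<chi> i. x $ r i)"

lemma reindex_nth [simp]: "reindex r x $ i = x $ r i"
  by (simp add: reindex_def)

lemma linear_reindex: "linear (reindex r)"
  by (rule linearI) (simp_all add: vec_eq_iff)

lemma reindex_inv:
  assumes "bij r"
  shows "reindex r (reindex (inv r) x) = x" "reindex (inv r) (reindex r y) = y"
  using assms by (simp_all add: vec_eq_iff bij_is_inj bij_is_surj surj_f_inv_f)

lemma image_reindex_cbox:
  assumes "bij r"
  shows "reindex r ` cbox a b = cbox (reindex r a) (reindex r b)"
proof (intro equalityI subsetI)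
  fix y assume "y \<in> cbox (reindex r a) (reindex r b)"
  then have "a $ i \<le> y $ inv r i \<and> y $ inv r i \<le> b $ i" for i
    using assms by (simp add: mem_box_cart) (metis bij_inv_eq_iff)
  then have "reindex (inv r) y \<in> cbox a b"
    by (simp add: mem_box_cart)
  moreover have "y = reindex r (reindex (inv r) y)"
    using reindex_inv[OF assms] by simp
  ultimately show "y \<in> reindex r ` cbox a b" by blast
qed (auto simp: mem_box_cart)

lemma content_reindex_cbox:
  fixes r :: "'k::finite \<Rightarrow> 'm::finite"
  assumes "bij r"
  shows "measure lborel (cbox (reindex r a) (reindex r b)) = measure lborel (cbox a b)"
proof -
  have "(\<Prod>i\<in>UNIV. b $ r i - a $ r i) = (\<Prod>i\<in>UNIV. b $ i - a $ i)"
    using assms by (intro prod.reindex_bij_betw)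
  moreover have "cbox (reindex r a) (reindex r b) = {} \<longleftrightarrow> cbox a b = {}"
    using image_reindex_cbox[OF assms, of a b] by (metis image_is_empty)
  ultimately show ?thesis
    by (simp add: content_cbox_if_cart)
qed

lemma norm_reindex:
  assumes "bij r"
  shows "norm (reindex r x) = norm x"
  unfolding norm_vec_def L2_set_def reindex_nth
  by (subst sum.reindex_bij_betw[OF assms, of "\<lambda>i. (norm (x $ i))\<^sup>2"]) (rule refl)

lemma has_integral_reindex_cbox:
  fixes f :: "real ^ 'm \<Rightarrow> real" and r :: "'k::finite \<Rightarrow> 'm::finite"
  assumes r: "bij r" and f: "(f has_integral y) (cbox a b)"
  shows "((\<lambda>x. f (reindex (inv r) x)) has_integral y) (cbox (reindex r a) (reindex r b))"
proof -
  have r': "bij (inv r)" using r by (rule bij_imp_bij_inv)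
  have "((\<lambda>x. f (reindex (inv r) x)) has_integral (1 / 1) *\<^sub>R y) (reindex r ` cbox a b)"
  proof (rule has_integral_twiddle[OF _ _ _ _ _ _ _ f])
    show "continuous (at x) (reindex (inv r))" for x :: "real ^ 'k"
      by (rule linear_continuous_at[OF linear_conv_bounded_linear[THEN iffD1, OF linear_reindex]])
    show "measure lborel (reindex (inv r) ` cbox u v) = 1 * measure lborel (cbox u v)" for u v :: "real ^ 'k"
      by (simp add: image_reindex_cbox[OF r'] content_reindex_cbox[OF r'])
    show "\<exists>w z. reindex (inv r) ` cbox u v = cbox w z" for u v :: "real ^ 'k"
      using image_reindex_cbox[OF r'] by blast
    show "\<exists>w z. reindex r ` cbox u v = cbox w z" for u v :: "real ^ 'm"
      using image_reindex_cbox[OF r] by blast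
  qed (simp_all add: reindex_inv[OF r])
  then show ?thesis by (simp add: image_reindex_cbox[OF r])
qed

text \<open>The integral over an arbitrary set is controlled by boxes containing a large ball. The
  permutation preserves norms and boxes, so the same radius \<open>B\<close> works on both
  sides.\<close>

lemma has_integral_reindex:
  fixes f :: "real ^ 'm \<Rightarrow> real" and r :: "'k::finite \<Rightarrow> 'm::finite"
  assumes r: "bij r" and f: "(f has_integral y) S"
  shows "((\<lambda>x. f (reindex (inv r) x)) has_integral y) (reindex r ` S)"
  unfolding has_integral'[of _ y]
proof (intro allI impI)
  fix e :: real assume "e > 0"
  then obtain B where B: "B > 0" "\<And>a b. ball 0 B \<subseteq> cbox a b \<Longrightarrow>
      \<exists>z. ((\<lambda>x. if x \<in> S then f x else 0) has_integral z) (cbox a b) \<and> norm (z - y) < e"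
    using f unfolding has_integral'[of f] by meson
  have r': "bij (inv r)" using r by (rule bij_imp_bij_inv)
  show "\<exists>B>0. \<forall>a b. ball 0 B \<subseteq> cbox a b \<longrightarrow> (\<exists>z. ((\<lambda>x. if x \<in> reindex r ` S then
      f (reindex (inv r) x) else 0) has_integral z) (cbox a b) \<and> norm (z - y) < e)"
  proof (rule exI[of _ B], rule conjI, rule B(1), intro allI impI)
    fix a b :: "real ^ 'k"
    let ?a = "reindex (inv r) a" and ?b = "reindex (inv r) b"
    assume ab: "ball 0 B \<subseteq> cbox a b"
    have "ball 0 B \<subseteq> cbox ?a ?b"
    proof
      fix x :: "real ^ 'm" assume "x \<in> ball 0 B"
      then have "reindex r x \<in> ball 0 B" by (simp add: norm_reindex[OF r])
      then have "reindex (inv r) (reindex r x) \<in> reindex (inv r) ` cbox a b"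
        using ab by blast
      then show "x \<in> cbox ?a ?b"
        by (simp add: reindex_inv[OF r] image_reindex_cbox[OF r'])
    qed
    then obtain z where z: "((\<lambda>x. if x \<in> S then f x else 0) has_integral z) (cbox ?a ?b)" "norm (z - y) < e"
      using B(2) by blast
    have "((\<lambda>x. if reindex (inv r) x \<in> S then f (reindex (inv r) x) else 0) has_integral z) (cbox a b)"
      using has_integral_reindex_cbox[OF r z(1)] by (simp add: reindex_inv[OF r])
    moreover have "reindex (inv r) x \<in> S \<longleftrightarrow> x \<in> reindex r ` S" for x
      using reindex_inv[OF r] by (metis image_iff)
    ultimately show "\<exists>z. ((\<lambda>x. if x \<in> reindex r ` S then f (reindex (inv r) x) else 0) has_integral z) (cbox a b) \<and> norm (z - y) < e"
      using z(2) by auto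
  qed
qed

lemma has_integral_reindex_iff:
  fixes f :: "real ^ 'm \<Rightarrow> real" and r :: "'k::finite \<Rightarrow> 'm::finite"
  assumes r: "bij r"
  shows "((\<lambda>x. f (reindex (inv r) x)) has_integral y) (reindex r ` S) \<longleftrightarrow> (f has_integral y) S"
proof
  assume "((\<lambda>x. f (reindex (inv r) x)) has_integral y) (reindex r ` S)"
  from has_integral_reindex[OF bij_imp_bij_inv[OF r] this] show "(f has_integral y) S"
    by (simp add: image_comp o_def inv_inv_eq[OF r] reindex_inv[OF r])
qed (rule has_integral_reindex[OF r])

lemma absolutely_integrable_reindex:
  fixes f :: "real ^ 'm \<Rightarrow> real" and r :: "'k::finite \<Rightarrow> 'm::finite"
  assumes r: "bij r"
  shows "(\<lambda>x. f (reindex (inv r) x)) absolutely_integrable_on reindex r ` S \<longleftrightarrow> f absolutely_integrable_on S"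
  unfolding absolutely_integrable_on_def integrable_on_def has_integral_reindex_iff[OF r]
  using has_integral_reindex_iff[OF r, of "\<lambda>x. norm (f x)"] by simp

lemma integral_reindex:
  fixes f :: "real ^ 'm \<Rightarrow> real" and r :: "'k::finite \<Rightarrow> 'm::finite"
  assumes r: "bij r"
  shows "integral (reindex r ` S) (\<lambda>x. f (reindex (inv r) x)) = integral S f"
  unfolding integral_def integrable_on_def has_integral_reindex_iff[OF r] ..

text \<open>Conjugation by the coordinate permutation \<open>?T\<close> moves the problem to the
  index type \<open>'m index\<close>; it changes neither the integrals nor the determinant of the
  derivative.\<close>

lemma has_absolute_integral_change_of_variables_finite:
  fixes f :: "real ^ 'm::finite \<Rightarrow> real" and g :: "real ^ 'm \<Rightarrow> real ^ 'm"
  assumes S: "S \<in> sets borel"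
    and der_g: "\<And>x. x \<in> S \<Longrightarrow> (g has_derivative g' x) (at x within S)"
    and inj: "inj_on g S"
  shows "(\<lambda>x. \<bar>det (matrix (g' x))\<bar> * f (g x)) absolutely_integrable_on S \<and>
      integral S (\<lambda>x. \<bar>det (matrix (g' x))\<bar> * f (g x)) = b \<longleftrightarrow>
    f absolutely_integrable_on (g ` S) \<and> integral (g ` S) f = b"
proof -
  obtain r :: "'m index \<Rightarrow> 'm" where r: "bij r"
    using index_bij by blast
  let ?T = "reindex r" and ?T' = "reindex (inv r)"
  note T [simp] = reindex_inv[OF r]
  have lin: "linear ?T" "linear ?T'" by (rule linear_reindex)+
  define G where "G = ?T \<circ> g \<circ> ?T'"
  define G' where "G' x = ?T \<circ> g' (?T' x) \<circ> ?T'" for x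
  \<comment> \<open>One-dimensional vectors, because the formula applied below takes vector-valued
    integrands.\<close>
  define F where "F x = (vec (f (?T' x)) :: real ^ 1)" for x
  have S': "?T ` S \<in> sets lebesgue"
  proof -
    have "?T ` S = ?T' -` S \<inter> space borel"
      by (auto simp: image_iff) (metis T(1))
    moreover have "?T' \<in> borel_measurable borel"
      by (intro borel_measurable_continuous_onI linear_continuous_on
          linear_conv_bounded_linear[THEN iffD1] lin)
    ultimately show ?thesis
      using S by (metis measurable_sets sets_completionI_sets sets_lborel)
  qed
  have det: "det (matrix (G' (?T x))) = det (matrix (g' x))" if "x \<in> S" for x
  proof -
    have "linear (g' x)" using der_g[OF that] by (rule has_derivative_linear)
    have "extend_matrix r (matrix (G' (?T x))) $ i $ j = matrix (g' x) $ i $ j" for i j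
    proof -
      have "range r = UNIV" using r by (rule bij_is_surj)
      have "?T' (axis (inv r j) 1) = axis j (1::real)"
        using r by (simp add: vec_eq_iff axis_def) (metis bij_inv_eq_iff)
      then show ?thesis
        using r by (simp add: extend_matrix_def \<open>range r = UNIV\<close> matrix_def G'_def bij_is_surj surj_f_inv_f)
    qed
    then have "extend_matrix r (matrix (G' (?T x))) = matrix (g' x)"
      by (simp add: vec_eq_iff)
    then show ?thesis
      using det_extend_matrix[OF bij_is_inj[OF r]] by metis
  qed
  have dG: "(G has_derivative G' x) (at x within ?T ` S)" if "x \<in> ?T ` S" for x
  proof -
    have x: "?T' x \<in> S" "?T' ` ?T ` S = S" using that by (auto simp: image_image)
    have "(?T' has_derivative ?T') (at x within ?T ` S)"
      by (rule linear_imp_has_derivative[OF lin(2)])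
    moreover have "(g has_derivative g' (?T' x)) (at (?T' x) within ?T' ` ?T ` S)"
      unfolding x by (rule der_g[OF x(1)])
    ultimately have "(g \<circ> ?T' has_derivative g' (?T' x) \<circ> ?T') (at x within ?T ` S)"
      by (rule diff_chain_within)
    then show ?thesis
      unfolding G_def G'_def comp_assoc
      by (rule diff_chain_within) (rule linear_imp_has_derivative[OF lin(1)])
  qed
  have injG: "inj_on G (?T ` S)"
    using inj unfolding G_def inj_on_def by (auto, metis T(2))
  have GS: "G ` ?T ` S = ?T ` g ` S"
    by (auto simp: G_def image_image)
  have eq: "\<bar>det (matrix (G' x))\<bar> *\<^sub>R F (G x) = vec (\<bar>det (matrix (g' (?T' x)))\<bar> * f (g (?T' x)))"
    if "x \<in> ?T ` S" for x
    using that det by (auto simp: F_def G_def vec_eq_iff)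
  have "(\<lambda>x. \<bar>det (matrix (G' x))\<bar> *\<^sub>R F (G x)) absolutely_integrable_on ?T ` S \<and>
      integral (?T ` S) (\<lambda>x. \<bar>det (matrix (G' x))\<bar> *\<^sub>R F (G x)) = vec b \<longleftrightarrow>
    F absolutely_integrable_on (G ` ?T ` S) \<and> integral (G ` ?T ` S) F = vec b"
    by (rule has_absolute_integral_change_of_variables[OF S' dG injG])
  also have "integral (?T ` S) (\<lambda>x. \<bar>det (matrix (G' x))\<bar> *\<^sub>R F (G x)) =
      integral (?T ` S) (\<lambda>x. vec (\<bar>det (matrix (g' (?T' x)))\<bar> * f (g (?T' x))))"
    by (rule integral_cong) (rule eq)
  also have "(\<lambda>x. \<bar>det (matrix (G' x))\<bar> *\<^sub>R F (G x)) absolutely_integrable_on ?T ` S \<longleftrightarrow>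
      (\<lambda>x. vec (\<bar>det (matrix (g' (?T' x)))\<bar> * f (g (?T' x))) :: real ^ 1) absolutely_integrable_on ?T ` S"
    by (rule set_integrable_cong) (auto simp: eq)
  finally show ?thesis
    unfolding GS F_def absolutely_integrable_on_1_iff integral_on_1_eq
    using absolutely_integrable_reindex[OF r, of S "\<lambda>x. \<bar>det (matrix (g' x))\<bar> * f (g x)"]
      absolutely_integrable_reindex[OF r, of "g ` S" f]
      integral_reindex[OF r, of S "\<lambda>x. \<bar>det (matrix (g' x))\<bar> * f (g x)"]
      integral_reindex[OF r, of "g ` S" f]
    by (simp add: vec_eq_iff)
qed

section \<open>Directional derivatives of smooth functions\<close>

lemma Ck_on_SucI:
  assumes "\<And>x. x \<in> S \<Longrightarrow> (f has_derivative f' x) (at x within S)" "\<And>v. Ck_on k S (\<lambda>x. f' x v)"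
  shows "Ck_on (Suc k) S f"
  using assms by auto

lemma Ck_on_subset: "Ck_on k S f \<Longrightarrow> T \<subseteq> S \<Longrightarrow> Ck_on k T f"
proof (induction k arbitrary: f)
  case 0
  then show ?case by (auto intro: continuous_on_subset)
next
  case (Suc k)
  obtain f' where f': "\<And>x. x \<in> S \<Longrightarrow> (f has_derivative f' x) (at x within S)" "\<And>v. Ck_on k S (\<lambda>x. f' x v)"
    using Suc.prems(1) unfolding Ck_on.simps by blast
  show ?case
    by (intro Ck_on_SucI[of _ _ f'] has_derivative_subset[OF f'(1) Suc.prems(2)] Suc.IH[OF f'(2) Suc.prems(2)])
      (use Suc.prems(2) in blast)
qed

lemma Ck_on_cong:
  assumes "Ck_on k S f" "\<And>x. x \<in> S \<Longrightarrow> f x = g x"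
  shows "Ck_on k S g"
  using assms
proof (induction k arbitrary: f g)
  case 0
  then show ?case by (auto intro: continuous_on_eq)
next
  case (Suc k)
  obtain f' where f': "\<And>x. x \<in> S \<Longrightarrow> (f has_derivative f' x) (at x within S)" "\<And>v. Ck_on k S (\<lambda>x. f' x v)"
    using Suc.prems(1) unfolding Ck_on.simps by blast
  have "(g has_derivative f' x) (at x within S)" if "x \<in> S" for x
    by (rule has_derivative_transform[OF that _ f'(1)[OF that]]) (simp add: Suc.prems(2))
  with f'(2) show ?case
    by (intro Ck_on_SucI[of _ _ f'])
qed

lemma Ck_on_add:
  assumes "Ck_on k S f" "Ck_on k S g"
  shows "Ck_on k S (\<lambda>x. f x + g x)"
  using assms
proof (induction k arbitrary: f g)
  case 0
  then show ?case by (auto intro: continuous_on_add)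
next
  case (Suc k)
  obtain f' where f': "\<And>x. x \<in> S \<Longrightarrow> (f has_derivative f' x) (at x within S)" "\<And>v. Ck_on k S (\<lambda>x. f' x v)"
    using Suc.prems(1) unfolding Ck_on.simps by blast
  obtain g' where g': "\<And>x. x \<in> S \<Longrightarrow> (g has_derivative g' x) (at x within S)" "\<And>v. Ck_on k S (\<lambda>x. g' x v)"
    using Suc.prems(2) unfolding Ck_on.simps by blast
  show ?case
    by (intro Ck_on_SucI[of _ _ "\<lambda>x v. f' x v + g' x v"] has_derivative_add f' g' Suc.IH)
qed

lemma Ck_on_scaleR:
  assumes "Ck_on k S f"
  shows "Ck_on k S (\<lambda>x. c *\<^sub>R f x)"
  using assms
proof (induction k arbitrary: f)
  case 0
  then show ?case by (auto intro!: continuous_intros)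
next
  case (Suc k)
  obtain f' where f': "\<And>x. x \<in> S \<Longrightarrow> (f has_derivative f' x) (at x within S)" "\<And>v. Ck_on k S (\<lambda>x. f' x v)"
    using Suc.prems unfolding Ck_on.simps by blast
  show ?case
    by (intro Ck_on_SucI[of _ _ "\<lambda>x v. c *\<^sub>R f' x v"] has_derivative_scaleR_right f' Suc.IH)
qed

lemma Ck_on_slice:
  assumes "Ck_on k (T \<times> U) f" "t \<in> T"
  shows "Ck_on k U (\<lambda>u. f (t, u))"
  using assms
proof (induction k arbitrary: f)
  case 0
  then show ?case
    by (auto intro!: continuous_on_compose2[of "T \<times> U" f U "Pair t"] continuous_intros)
next
  case (Suc k)
  obtain f' where f': "\<And>x. x \<in> T \<times> U \<Longrightarrow> (f has_derivative f' x) (at x within T \<times> U)"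
      "\<And>v. Ck_on k (T \<times> U) (\<lambda>x. f' x v)"
    using Suc.prems(1) unfolding Ck_on.simps by blast
  have "((\<lambda>u. f (t, u)) has_derivative (\<lambda>v. f' (t, u) (0, v))) (at u within U)" if "u \<in> U" for u
  proof -
    have "((\<lambda>u. (t, u)) has_derivative (\<lambda>v. (0, v))) (at u within U)"
      by (auto intro!: derivative_eq_intros)
    moreover have "(f has_derivative f' (t, u)) (at (t, u) within (\<lambda>u. (t, u)) ` U)"
      by (rule has_derivative_subset[OF f'(1)]) (use that Suc.prems in auto)
    ultimately show ?thesis
      by (rule diff_chain_within[unfolded o_def])
  qed
  then show ?case
    by (intro Ck_on_SucI[of _ _ "\<lambda>u v. f' (t, u) (0, v)"] Suc.IH f' Suc.prems)
qed

lemma smooth_on_subset: "smooth_on S f \<Longrightarrow> T \<subseteq> S \<Longrightarrow> smooth_on T f"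
  by (auto simp: smooth_on_def intro: Ck_on_subset)

lemma smooth_on_imp_continuous_on: "smooth_on S f \<Longrightarrow> continuous_on S f"
  unfolding smooth_on_def by (metis Ck_on.simps(1))

section \<open>Directional derivatives and their symmetry\<close>

definition pd :: "'b::real_normed_vector \<Rightarrow> ('b \<Rightarrow> 'c::real_normed_vector) \<Rightarrow> 'b \<Rightarrow> 'c" where
  "pd v f z = frechet_derivative f (at z) v"

lemma has_derivative_pd: "(f has_derivative f') (at z) \<Longrightarrow> pd v f z = f' v"
  unfolding pd_def by (metis frechet_derivative_at)

lemma smooth_on_has_derivative:
  assumes "open S" "smooth_on S f" "z \<in> S"
  shows "(f has_derivative (\<lambda>v. pd v f z)) (at z)"
proof -
  have "Ck_on (Suc 0) S f" using assms by (simp add: smooth_on_def)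
  then obtain f' where "(f has_derivative f') (at z)"
    using assms by (auto simp: at_within_open[of _ S])
  then have "f differentiable at z" by (auto simp: differentiable_def)
  then show ?thesis
    unfolding pd_def frechet_derivative_works by simp
qed

lemma smooth_on_pd:
  assumes S: "open S" "smooth_on S f"
  shows "smooth_on S (pd v f)"
  unfolding smooth_on_def
proof
  fix k
  have ck: "Ck_on (Suc k) S f" using S by (simp add: smooth_on_def)
  obtain f' where f': "\<And>x. x \<in> S \<Longrightarrow> (f has_derivative f' x) (at x within S)" "\<And>v. Ck_on k S (\<lambda>x. f' x v)"
    using ck unfolding Ck_on.simps by blast
  have "f' x v = pd v f x" if "x \<in> S" for x
    using f'(1)[OF that] that S(1) by (simp add: at_within_open[of _ S] has_derivative_pd)
  then show "Ck_on k S (pd v f)"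
    using f'(2) Ck_on_cong by blast
qed

lemma continuous_on_pd: "open S \<Longrightarrow> smooth_on S f \<Longrightarrow> continuous_on S (pd v f)"
  by (intro smooth_on_imp_continuous_on smooth_on_pd)

lemma pd_cong:
  assumes "open S" "z \<in> S" "\<And>x. x \<in> S \<Longrightarrow> f x = g x"
  shows "pd v f z = pd v g z"
proof -
  have "(f has_derivative D) (at z) \<longleftrightarrow> (g has_derivative D) (at z)" for D
    using assms by (metis has_derivative_transform_within_open)
  then show ?thesis by (simp add: pd_def frechet_derivative_def)
qed

lemma has_vector_derivative_along_line:
  assumes "(f has_derivative f') (at (z + s *\<^sub>R v))"
  shows "((\<lambda>s. f (z + s *\<^sub>R v)) has_vector_derivative f' v) (at s within T)"
proof -
  have "((\<lambda>s. z + s *\<^sub>R v) has_vector_derivative v) (at s within T)"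
    by (auto intro!: derivative_eq_intros simp: has_vector_derivative_def)
  then show ?thesis
    using vector_derivative_diff_chain_within has_derivative_at_withinI[OF assms]
    by (fastforce simp: o_def)
qed

lemma has_vector_derivative_pd_line:
  assumes "open S" "smooth_on S f" "z + s *\<^sub>R v \<in> S"
  shows "((\<lambda>s. f (z + s *\<^sub>R v)) has_vector_derivative pd v f (z + s *\<^sub>R v)) (at s within T)"
  by (rule has_vector_derivative_along_line[OF smooth_on_has_derivative[OF assms]])

text \<open>Differentiate \<open>f (z + \<tau> w) - f z = \<integral>\<^sub>0\<^sup>\<tau> \<partial>\<^sub>w f (z + t w) dt\<close> first in the direction \<open>v\<close>, under the
  integral, and then in \<open>\<tau>\<close>.\<close>

lemma pd_commute:
  fixes f :: "'b::real_normed_vector \<Rightarrow> 'c::banach"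
  assumes S: "open S" "smooth_on S f" "z \<in> S"
  shows "pd v (pd w f) z = pd w (pd v f) z"
proof -
  have "continuous (at (0, 0)) (\<lambda>p. z + fst p *\<^sub>R v + snd p *\<^sub>R w)"
    by (intro continuous_intros)
  then have "\<forall>\<^sub>F p in at (0, 0). z + fst p *\<^sub>R v + snd p *\<^sub>R w \<in> S"
    using S unfolding continuous_at by (auto dest!: topological_tendstoD)
  then obtain d where d: "d > 0" "\<And>p. p \<noteq> (0, 0) \<Longrightarrow> dist p (0, 0) < d \<Longrightarrow> z + fst p *\<^sub>R v + snd p *\<^sub>R w \<in> S"
    unfolding eventually_at by auto
  \<comment> \<open>The distance of \<open>(s, t)\<close> from the origin is at most |s| + |t|, so
    each parameter gets half of \<open>d\<close>.\<close>
  define e where "e = d / 2"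
  have e: "e > 0" using d by (simp add: e_def)
  have inS: "z + s *\<^sub>R v + t *\<^sub>R w \<in> S" if "\<bar>s\<bar> < e" "\<bar>t\<bar> < e" for s t
  proof (cases "(s, t) = (0, 0)")
    case False
    have "dist (s, t) (0, 0) \<le> \<bar>s\<bar> + \<bar>t\<bar>"
      using norm_Pair_le[of s t] by (simp add: zero_prod_def[symmetric])
    then show ?thesis using d(2)[OF False] that by (simp add: e_def)
  qed (use S in auto)
  define h where "h = e / 2"
  have h: "0 < h" "h < e" using e by (auto simp: h_def)
  have S2: "smooth_on S (pd v f)" "smooth_on S (pd w f)" "smooth_on S (pd v (pd w f))"
    using S by (auto intro: smooth_on_pd)
  have cont: "continuous_on T (\<lambda>p. g (z + a p *\<^sub>R v + b p *\<^sub>R w))"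
    if "smooth_on S g" "continuous_on T a" "continuous_on T b" "\<And>p. p \<in> T \<Longrightarrow> \<bar>a p\<bar> < e \<and> \<bar>b p\<bar> < e"
    for g :: "'b \<Rightarrow> 'c" and a b and T :: "'x::topological_space set"
    by (rule continuous_on_compose2[OF smooth_on_imp_continuous_on[OF that(1)]])
       (use that inS in \<open>auto intro!: continuous_intros\<close>)
  have eq: "f (z + s *\<^sub>R v + \<tau> *\<^sub>R w) - f (z + s *\<^sub>R v) = integral {0..\<tau>} (\<lambda>t. pd w f (z + s *\<^sub>R v + t *\<^sub>R w))"
    if "\<bar>s\<bar> < e" "\<tau> \<in> {0..h}" for s \<tau>
  proof -
    have "((\<lambda>t. pd w f (z + s *\<^sub>R v + t *\<^sub>R w)) has_integral
        f (z + s *\<^sub>R v + \<tau> *\<^sub>R w) - f (z + s *\<^sub>R v + 0 *\<^sub>R w)) {0..\<tau>}"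
      by (rule fundamental_theorem_of_calculus)
        (use that h in \<open>auto intro!: has_vector_derivative_pd_line[OF S(1,2)] inS\<close>)
    then show ?thesis by (simp add: integral_unique)
  qed
  have pdv: "pd v f (z + \<tau> *\<^sub>R w) - pd v f z = integral {0..\<tau>} (\<lambda>t. pd v (pd w f) (z + t *\<^sub>R w))"
    if \<tau>: "\<tau> \<in> {0..h}" for \<tau>
  proof -
    let ?U = "{-e<..<e}"
    have "((\<lambda>s. integral (cbox 0 \<tau>) (\<lambda>t. pd w f (z + s *\<^sub>R v + t *\<^sub>R w))) has_vector_derivative
        integral (cbox 0 \<tau>) (\<lambda>t. pd v (pd w f) (z + 0 *\<^sub>R v + t *\<^sub>R w))) (at 0 within ?U)"
    proof (rule leibniz_rule_vector_derivative)
      fix s t assume st: "s \<in> ?U" "t \<in> cbox 0 \<tau>"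
      have "((\<lambda>s. pd w f ((z + t *\<^sub>R w) + s *\<^sub>R v)) has_vector_derivative pd v (pd w f) (z + s *\<^sub>R v + t *\<^sub>R w)) (at s within ?U)"
        using has_vector_derivative_pd_line[OF S(1) S2(2), of "z + t *\<^sub>R w" s v ?U] inS[of s t] st \<tau> h
        by (simp add: algebra_simps abs_less_iff)
      then show "((\<lambda>s. pd w f (z + s *\<^sub>R v + t *\<^sub>R w)) has_vector_derivative pd v (pd w f) (z + s *\<^sub>R v + t *\<^sub>R w)) (at s within ?U)"
        by (simp add: algebra_simps)
    next
      show "(\<lambda>t. pd w f (z + s *\<^sub>R v + t *\<^sub>R w)) integrable_on cbox 0 \<tau>" if "s \<in> ?U" for s
        by (intro integrable_continuous cont S2 continuous_intros) (use that \<tau> h in auto)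
      show "continuous_on (?U \<times> cbox 0 \<tau>) (\<lambda>(s, t). pd v (pd w f) (z + s *\<^sub>R v + t *\<^sub>R w))"
        unfolding split_beta by (intro cont S2 continuous_intros) (use \<tau> h in auto)
    qed (use e in auto)
    then have D: "((\<lambda>s. integral {0..\<tau>} (\<lambda>t. pd w f (z + s *\<^sub>R v + t *\<^sub>R w))) has_vector_derivative
        integral {0..\<tau>} (\<lambda>t. pd v (pd w f) (z + t *\<^sub>R w))) (at 0 within ?U)"
      by simp
    have "((\<lambda>s. f (z + s *\<^sub>R v + \<tau> *\<^sub>R w) - f (z + s *\<^sub>R v)) has_vector_derivative
        integral {0..\<tau>} (\<lambda>t. pd v (pd w f) (z + t *\<^sub>R w))) (at 0 within ?U)"
      by (rule has_vector_derivative_transform[OF _ eq[OF _ \<tau>] D]) (use e in auto)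
    moreover have "((\<lambda>s. f ((z + \<tau> *\<^sub>R w) + s *\<^sub>R v) - f (z + s *\<^sub>R v)) has_vector_derivative
        pd v f (z + \<tau> *\<^sub>R w) - pd v f z) (at 0 within ?U)"
      using has_vector_derivative_pd_line[OF S(1,2), of "z + \<tau> *\<^sub>R w" 0 v ?U]
        has_vector_derivative_pd_line[OF S(1,2), of z 0 v ?U] inS[of 0 \<tau>] inS[of 0 0] \<tau> h e
      by (intro has_vector_derivative_diff) auto
    ultimately show ?thesis
      using e by (auto simp: algebra_simps at_within_open[of 0 ?U] dest: vector_derivative_unique_at)
  qed
  have "((\<lambda>\<tau>. integral {0..\<tau>} (\<lambda>t. pd v (pd w f) (z + t *\<^sub>R w))) has_vector_derivative
      pd v (pd w f) (z + 0 *\<^sub>R w)) (at 0 within {0..h})"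
    by (rule integral_has_vector_derivative)
      (use cont[OF S2(3), of "{0..h}" "\<lambda>_. 0" "\<lambda>t. t"] h in auto)
  then have D: "((\<lambda>\<tau>. integral {0..\<tau>} (\<lambda>t. pd v (pd w f) (z + t *\<^sub>R w))) has_vector_derivative
      pd v (pd w f) z) (at 0 within {0..h})"
    by simp
  have "((\<lambda>\<tau>. pd v f (z + \<tau> *\<^sub>R w) - pd v f z) has_vector_derivative pd v (pd w f) z) (at 0 within {0..h})"
    by (rule has_vector_derivative_transform[OF _ pdv D]) (use h in auto)
  moreover have "((\<lambda>\<tau>. pd v f (z + \<tau> *\<^sub>R w) - pd v f z) has_vector_derivative pd w (pd v f) z - 0) (at 0 within {0..h})"
    using has_vector_derivative_pd_line[OF S(1) S2(1), of z 0 w "{0..h}"] S(3)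
    by (intro has_vector_derivative_diff has_vector_derivative_const) simp
  ultimately show ?thesis
    using h by (auto intro: vector_derivative_unique_within_closed_interval[of 0 h 0])
qed

text \<open>Integration by parts: \<open>\<integral> G (x + s v) dx\<close> does not depend on \<open>s\<close>.\<close>

lemma integral_derivative_compact_support:
  fixes F :: "'a::euclidean_space \<Rightarrow> real"
  assumes U: "open U" "cbox a b \<subseteq> U"
    and F: "\<And>x. x \<in> U \<Longrightarrow> (F has_derivative F' x) (at x)" "continuous_on U (\<lambda>x. F' x v)"
    and K: "closed K" "K \<subseteq> box a b" "\<And>x. x \<in> U - K \<Longrightarrow> F x = 0"
  shows "integral (cbox a b) (\<lambda>x. F' x v) = 0"
proof (cases "box a b = {}")
  case True
  then show ?thesis
    by (intro integral_null) (simp add: content_eq_0_interior)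
next
  case False
  \<comment> \<open>Extension by zero. It is differentiable everywhere, because \<open>F\<close>
    vanishes off a closed set inside the open box, and \<open>g\<close> is its derivative in the
    direction \<open>v\<close>.\<close>
  define G where "G x = (if x \<in> U then F x else 0)" for x
  define g where "g x = (if x \<in> box a b then F' x v else 0)" for x
  have boxU: "box a b \<subseteq> U" using U box_subset_cbox by blast
  have G0: "G x = 0" if "x \<notin> K" for x
    using K that by (auto simp: G_def)
  have F'0: "F' x v = 0" if "x \<in> U - K" for x
  proof -
    have "(F has_derivative (\<lambda>v. 0)) (at x)"
      by (rule has_derivative_transform_within_open[of "\<lambda>_. 0" _ _ _ "U - K"])
        (use U K that in \<open>auto intro: open_Diff\<close>)
    then have "F' x = (\<lambda>v. 0)"
      using F(1) that has_derivative_unique by blast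
    then show ?thesis by simp
  qed
  have DG: "\<exists>D. (G has_derivative D) (at x) \<and> D v = g x" for x
  proof (cases "x \<in> box a b")
    case True
    then have "x \<in> U" using boxU by blast
    then have "(G has_derivative F' x) (at x)"
      using has_derivative_transform_within_open[OF F(1) U(1), of x G] by (simp add: G_def)
    then show ?thesis
      using True by (intro exI[of _ "F' x"]) (simp add: g_def)
  next
    case False
    then have "x \<in> - K" using K(2) by blast
    have "((\<lambda>_. 0) has_derivative (\<lambda>v. 0)) (at x)" by (rule has_derivative_const)
    then have "(G has_derivative (\<lambda>v. 0)) (at x)"
      by (rule has_derivative_transform_within_open[of _ _ _ _ "- K"])
        (use \<open>x \<in> - K\<close> K(1) in \<open>simp_all add: G0 open_Compl\<close>)
    then show ?thesis
      using False by (intro exI[of _ "\<lambda>_. 0"]) (simp add: g_def)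
  qed
  have dG: "((\<lambda>s. G (x + s *\<^sub>R v)) has_vector_derivative g (x + s *\<^sub>R v)) (at s within T)" for x s T
    using DG[of "x + s *\<^sub>R v"] has_vector_derivative_along_line by metis
  have cG: "continuous_on UNIV G"
    unfolding continuous_on_eq_continuous_at[OF open_UNIV] using DG has_derivative_continuous by blast
  have cg: "continuous_on UNIV g"
  proof -
    have "continuous_on (box a b) g"
      by (rule continuous_on_eq[OF continuous_on_subset[OF F(2) boxU]]) (simp add: g_def)
    moreover have "continuous_on (- K) g"
      by (rule continuous_on_eq[of _ "\<lambda>_. 0"]) (use F'0 boxU in \<open>auto simp: g_def\<close>)
    ultimately have "continuous_on (box a b \<union> - K) g"
      using K by (intro continuous_on_open_Un) auto
    moreover have "box a b \<union> - K = UNIV"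
      using K by blast
    ultimately show ?thesis by simp
  qed
  \<comment> \<open>Every coordinate of \<open>v\<close> is bounded by \<open>norm v\<close>, so
    \<open>?B\<close> contains all translates of the box by \<open>s *\<^sub>R v\<close> with |s|
    \<le> 1.\<close>
  define n where "n = norm v *\<^sub>R (One :: 'a)"
  let ?B = "cbox (a - n) (b + n)"
  have sub: "cbox (a - s *\<^sub>R v) (b - s *\<^sub>R v) \<subseteq> ?B" if "\<bar>s\<bar> \<le> 1" for s
  proof
    fix x assume x: "x \<in> cbox (a - s *\<^sub>R v) (b - s *\<^sub>R v)"
    have "\<bar>s * (v \<bullet> i)\<bar> \<le> n \<bullet> i" if "i \<in> Basis" for i
    proof -
      have "\<bar>s * (v \<bullet> i)\<bar> \<le> 1 * norm v"
        unfolding abs_mult using \<open>\<bar>s\<bar> \<le> 1\<close> Basis_le_norm[OF that] by (intro mult_mono) auto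
      then show ?thesis using that by (simp add: n_def)
    qed
    then show "x \<in> ?B"
      using x unfolding mem_box by (auto simp: inner_diff_left inner_add_left abs_le_iff) force+
  qed
  have shift: "integral ?B (\<lambda>x. G (x + s *\<^sub>R v)) = integral (cbox a b) G" if "\<bar>s\<bar> \<le> 1" for s
  proof -
    have "(G has_integral integral (cbox a b) G) (cbox a b)"
      using cG by (intro integrable_integral integrable_continuous) (auto intro: continuous_on_subset)
    from has_integral_affinity'[OF this, of 1 "s *\<^sub>R v"]
    have "((\<lambda>x. G (x + s *\<^sub>R v)) has_integral integral (cbox a b) G) (cbox (a - s *\<^sub>R v) (b - s *\<^sub>R v))"
      by simp
    moreover have "G (x + s *\<^sub>R v) = 0" if "x \<notin> cbox (a - s *\<^sub>R v) (b - s *\<^sub>R v)" for x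
    proof (rule G0)
      have "x + s *\<^sub>R v \<notin> cbox a b"
        using that by (auto simp: mem_box inner_diff_left inner_add_left algebra_simps)
      then show "x + s *\<^sub>R v \<notin> K" using K box_subset_cbox by blast
    qed
    ultimately have "((\<lambda>x. G (x + s *\<^sub>R v)) has_integral integral (cbox a b) G) ?B"
      using sub[OF that] by (rule has_integral_on_superset)
    then show ?thesis by (rule integral_unique)
  qed
  have "((\<lambda>s. integral ?B (\<lambda>x. G (x + s *\<^sub>R v))) has_vector_derivative
      integral ?B (\<lambda>x. g (x + 0 *\<^sub>R v))) (at 0 within {-1..1})"
  proof (rule leibniz_rule_vector_derivative)
    show "(\<lambda>x. G (x + s *\<^sub>R v)) integrable_on ?B" for s
      by (intro integrable_continuous continuous_on_compose2[OF cG] continuous_intros) auto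
    show "continuous_on ({-1..1} \<times> ?B) (\<lambda>(s, x). g (x + s *\<^sub>R v))"
      unfolding split_beta by (intro continuous_on_compose2[OF cg] continuous_intros) auto
  qed (auto intro: dG)
  then have D: "((\<lambda>s. integral ?B (\<lambda>x. G (x + s *\<^sub>R v))) has_vector_derivative integral ?B g) (at 0 within {-1..1})"
    by simp
  have "((\<lambda>s. integral (cbox a b) G) has_vector_derivative integral ?B g) (at 0 within {-1..1})"
    by (rule has_vector_derivative_transform[OF _ _ D]) (auto simp: shift)
  moreover have "((\<lambda>s::real. integral (cbox a b) G) has_vector_derivative 0) (at 0 within {-1..1})"
    by (rule has_vector_derivative_const)
  ultimately have "integral ?B g = 0"
    by (auto intro: vector_derivative_unique_within_closed_interval[of "-1" 1 0])
  moreover have "(g has_integral integral (cbox a b) g) ?B"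
  proof (rule has_integral_on_superset)
    show "(g has_integral integral (cbox a b) g) (cbox a b)"
      by (intro integrable_integral integrable_continuous continuous_on_subset[OF cg]) auto
    show "cbox a b \<subseteq> ?B" using sub[of 0] by simp
  qed (use box_subset_cbox in \<open>auto simp: g_def\<close>)
  moreover have "integral (cbox a b) g = integral (cbox a b) (\<lambda>x. F' x v)"
    by (rule integral_cong) (use F'0 K U in \<open>auto simp: g_def\<close>)
  ultimately show ?thesis by (simp add: integral_unique)
qed

section \<open>Bendings in a chart\<close>

lemma sum_UNIV_option: "(\<Sum>i\<in>UNIV. f i) = f None + (\<Sum>k\<in>UNIV. f (Some k))"
  for f :: "'m::finite option \<Rightarrow> 'b::comm_monoid_add"
  by (simp add: UNIV_option_conv sum.reindex)

lemma pd_inner: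
  fixes f g :: "'b::real_normed_vector \<Rightarrow> 'c::real_inner"
  assumes "f differentiable at z" "g differentiable at z"
  shows "pd v (\<lambda>z. f z \<bullet> g z) z = pd v f z \<bullet> g z + f z \<bullet> pd v g z"
proof -
  have "((\<lambda>z. f z \<bullet> g z) has_derivative (\<lambda>v. f z \<bullet> pd v g z + pd v f z \<bullet> g z)) (at z)"
    using assms unfolding pd_def frechet_derivative_works by (rule has_derivative_inner)
  then show ?thesis by (simp add: has_derivative_pd)
qed

lemma pd_diff:
  assumes "f differentiable at z" "g differentiable at z"
  shows "pd v (\<lambda>z. f z - g z) z = pd v f z - pd v g z"
proof -
  have "((\<lambda>z. f z - g z) has_derivative (\<lambda>v. pd v f z - pd v g z)) (at z)"
    using assms unfolding pd_def frechet_derivative_works by (rule has_derivative_diff)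
  then show ?thesis by (simp add: has_derivative_pd)
qed

lemma pd_const: "pd v (\<lambda>z. c) z = 0"
  by (rule has_derivative_pd[OF has_derivative_const])

text \<open>Frames with the same Gram matrix are related by a linear isometry. It takes
  \<open>v\<close> to \<open>v'\<close> and \<open>w\<close> to \<open>w'\<close>, since a vector is
  determined by its inner products with a frame. The frames will be those of one point at two
  times.\<close>

lemma inner_determined_by_gram:
  fixes p q :: "'k::finite \<Rightarrow> real ^ 'k"
  assumes gram: "\<And>i j. p i \<bullet> p j = q i \<bullet> q j" and p: "vdet p \<noteq> 0" and q: "vdet q \<noteq> 0"
    and v: "\<And>i. v \<bullet> p i = v' \<bullet> q i" and w: "\<And>i. w \<bullet> p i = w' \<bullet> q i"
  shows "v \<bullet> w = v' \<bullet> w'"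
proof -
  have *: "y = (\<Sum>i\<in>UNIV. c i *\<^sub>R q i)" if c: "x = (\<Sum>i\<in>UNIV. c i *\<^sub>R p i)" and xy: "\<And>i. x \<bullet> p i = y \<bullet> q i" for x y c
  proof -
    let ?d = "y - (\<Sum>i\<in>UNIV. c i *\<^sub>R q i)"
    have "q j \<bullet> ?d = 0" for j
      using xy[of j] by (simp add: c inner_diff_right inner_sum_left inner_sum_right gram inner_commute)
    then have "?d = 0"
      using vdet_eq_0I q by blast
    then show ?thesis by simp
  qed
  obtain x where x: "v = (\<Sum>i\<in>UNIV. x i *\<^sub>R p i)" using vdet_expansion[OF p] by blast
  obtain y where y: "w = (\<Sum>i\<in>UNIV. y i *\<^sub>R p i)" using vdet_expansion[OF p] by blast
  show ?thesis
    unfolding *[OF x v] *[OF y w] unfolding x y by (simp add: inner_sum_left inner_sum_right gram)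
qed

text \<open>Time is restricted to the open interval, where the derivatives are two-sided; the end points are
  reached by continuity in the end.\<close>

locale local_bending =
  fixes U :: "(real ^ 'm::finite) set" and P N :: "real \<times> (real ^ 'm) \<Rightarrow> real ^ 'm option"
  assumes open_U: "open U"
    and smooth_P: "smooth_on ({0<..<1} \<times> U) P"
    and smooth_N: "smooth_on ({0<..<1} \<times> U) N"
    and norm_N: "\<And>z. z \<in> {0<..<1} \<times> U \<Longrightarrow> norm (N z) = 1"
    and N_normal: "\<And>z v. z \<in> {0<..<1} \<times> U \<Longrightarrow> N z \<bullet> pd (0, v) P z = 0"
    and nondeg: "\<And>z. z \<in> {0<..<1} \<times> U \<Longrightarrow>
      vdet (\<lambda>i. case i of None \<Rightarrow> N z | Some k \<Rightarrow> pd (0, axis k 1) P z) \<noteq> 0"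
    and isometric: "\<And>s t u v w. s \<in> {0<..<1} \<Longrightarrow> t \<in> {0<..<1} \<Longrightarrow> u \<in> U \<Longrightarrow>
      pd (0, v) P (s, u) \<bullet> pd (0, w) P (s, u) = pd (0, v) P (t, u) \<bullet> pd (0, w) P (t, u)"
begin

abbreviation S where "S \<equiv> {0<..<1::real} \<times> U"
abbreviation e :: "'m \<Rightarrow> real \<times> (real ^ 'm)" where "e k \<equiv> (0, axis k 1)"
abbreviation \<tau> :: "real \<times> (real ^ 'm)" where "\<tau> \<equiv> (1, 0)"

definition q where "q z i = (case i of None \<Rightarrow> N z | Some k \<Rightarrow> pd (e k) P z)"
text \<open>The entry 0 at \<open>None\<close> reflects that a parallel hypersurface keeps its
  normal: \<open>q z i + \<epsilon> *\<^sub>R w z i\<close> is that normal followed by the tangents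
  of the parallel hypersurface.\<close>

definition w where "w z i = (case i of None \<Rightarrow> 0 | Some k \<Rightarrow> pd (e k) N z)"

lemma q_simps [simp]: "q z None = N z" "q z (Some k) = pd (e k) P z"
  by (simp_all add: q_def)

lemma w_simps [simp]: "w z None = 0" "w z (Some k) = pd (e k) N z"
  by (simp_all add: w_def)

lemma open_S: "open S"
  by (intro open_Times open_U open_greaterThanLessThan)

lemma smooth_imp_diff: "smooth_on S f \<Longrightarrow> z \<in> S \<Longrightarrow> f differentiable at z"
  using smooth_on_has_derivative[OF open_S] by (auto simp: differentiable_def)

lemma smooth_q: "smooth_on S (\<lambda>z. q z i)"
  by (cases i) (auto intro: smooth_N smooth_on_pd open_S smooth_P)

lemma smooth_zero: "smooth_on S (\<lambda>z. 0 :: 'c::real_normed_vector)"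
proof -
  have "Ck_on k S (\<lambda>z. 0 :: 'c)" for k
    by (induction k) (auto intro!: exI[of _ "\<lambda>_ _. 0"])
  then show ?thesis by (simp add: smooth_on_def)
qed

lemma smooth_w: "smooth_on S (\<lambda>z. w z i)"
  by (cases i) (auto intro: smooth_N smooth_on_pd open_S smooth_zero)

lemma smooth_X: "smooth_on S (pd (e i) (pd (e k) P))"
  by (intro smooth_on_pd open_S smooth_P)

lemma diff_q: "z \<in> S \<Longrightarrow> (\<lambda>z. q z i) differentiable at z"
  and diff_w: "z \<in> S \<Longrightarrow> (\<lambda>z. w z i) differentiable at z"
  and diff_X: "z \<in> S \<Longrightarrow> pd (e a) (pd (e b) P) differentiable at z"
  by (rule smooth_imp_diff[OF smooth_q] smooth_imp_diff[OF smooth_w] smooth_imp_diff[OF smooth_X];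
      assumption)+

lemma diff_inner: "f differentiable at z \<Longrightarrow> g differentiable at z \<Longrightarrow> (\<lambda>z. f z \<bullet> g z) differentiable at z"
  for f g :: "real \<times> (real ^ 'm) \<Rightarrow> real ^ 'm option"
  unfolding differentiable_def by (blast intro: has_derivative_inner)

lemma pd_q_inner: "z \<in> S \<Longrightarrow> pd v (\<lambda>z. q z i \<bullet> q z j) z =
    pd v (\<lambda>z. q z i) z \<bullet> q z j + q z i \<bullet> pd v (\<lambda>z. q z j) z"
  by (intro pd_inner diff_q)

text \<open>Two times are compared directly, instead of asking for a zero time derivative. This form
  passes through algebra and spatial derivatives without interchanging derivatives, and permits
  arguments about the two frames at once.\<close>

definition time_indep :: "(real \<times> (real ^ 'm) \<Rightarrow> real) \<Rightarrow> bool" where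
  "time_indep f \<longleftrightarrow> (\<forall>s\<in>{0<..<1}. \<forall>t\<in>{0<..<1}. \<forall>u\<in>U. f (s, u) = f (t, u))"

lemma time_indep_D: "time_indep f \<Longrightarrow> s \<in> {0<..<1} \<Longrightarrow> t \<in> {0<..<1} \<Longrightarrow> u \<in> U \<Longrightarrow> f (s, u) = f (t, u)"
  unfolding time_indep_def by blast

lemma time_indep_compose: "time_indep f \<Longrightarrow> time_indep g \<Longrightarrow> time_indep (\<lambda>z. h (f z) (g z))"
  unfolding time_indep_def by (intro ballI arg_cong2[where f = h]) blast+

lemmas time_indep_add = time_indep_compose[where h = "(+)"] and time_indep_diff = time_indep_compose[where h = "(-)"]

lemma time_indep_cong: "time_indep f \<Longrightarrow> (\<And>z. z \<in> S \<Longrightarrow> f z = g z) \<Longrightarrow> time_indep g"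
  unfolding time_indep_def by (metis mem_Sigma_iff)

text \<open>A spatial derivative is computed inside a single time slice, and the slices at two times
  are the same function on \<open>U\<close>.\<close>

lemma time_indep_pd:
  assumes f: "time_indep f" "\<And>z. z \<in> S \<Longrightarrow> f differentiable at z"
  shows "time_indep (pd (0, v) f)"
  unfolding time_indep_def
proof (intro ballI)
  fix s t :: real and u assume st: "s \<in> {0<..<1}" "t \<in> {0<..<1}" and u: "u \<in> U"
  have d: "((\<lambda>u. f (r, u)) has_derivative (\<lambda>v. pd (0, v) f (r, u))) (at u)" if "r \<in> {0<..<1}" for r
  proof -
    have "((\<lambda>u. (r, u)) has_derivative (\<lambda>v. (0, v))) (at u)"
      by (auto intro!: derivative_eq_intros)
    moreover have "(f has_derivative (\<lambda>v. pd v f (r, u))) (at (r, u))"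
      using f(2)[of "(r, u)"] that u unfolding pd_def frechet_derivative_works by auto
    ultimately show ?thesis
      by (rule diff_chain_at[unfolded o_def])
  qed
  have "((\<lambda>u. f (s, u)) has_derivative (\<lambda>v. pd (0, v) f (t, u))) (at u)"
    by (rule has_derivative_transform_within_open[OF d[OF st(2)] open_U u])
      (use f(1) st in \<open>unfold time_indep_def, blast\<close>)
  then have "(\<lambda>v. pd (0, v) f (s, u)) = (\<lambda>v. pd (0, v) f (t, u))"
    using d[OF st(1)] has_derivative_unique by blast
  then show "pd (0, v) f (s, u) = pd (0, v) f (t, u)"
    by (rule fun_cong)
qed

lemma has_vector_derivative_time:
  assumes "f differentiable at (t, u)"
  shows "((\<lambda>t. f (t, u)) has_vector_derivative pd \<tau> f (t, u)) (at t)"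
  using has_vector_derivative_along_line[of f "\<lambda>v. pd v f (t, u)" "(0, u)" t \<tau> UNIV] assms
  unfolding pd_def frechet_derivative_works by simp

lemma time_indep_imp_pd_zero:
  assumes "time_indep f" "f differentiable at z" "z \<in> S"
  shows "pd \<tau> f z = 0"
proof -
  obtain t u where z: "z = (t, u)" "t \<in> {0<..<1}" "u \<in> U"
    using assms(3) by blast
  have "((\<lambda>s. f (s, u)) has_vector_derivative 0) (at t)"
  proof (rule has_vector_derivative_transform_within_open[OF has_vector_derivative_const, of "{0<..<1}"])
    show "f (t, u) = f (s, u)" if "s \<in> {0<..<1}" for s
      using assms(1) z that unfolding time_indep_def by blast
  qed (use z in auto)
  moreover have "((\<lambda>s. f (s, u)) has_vector_derivative pd \<tau> f z) (at t)"
    using has_vector_derivative_time assms(2) z by blast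
  ultimately show ?thesis
    using vector_derivative_unique_at by blast
qed

lemma pd_eq_0:
  assumes "\<And>z. z \<in> S \<Longrightarrow> f z = c" "z \<in> S"
  shows "pd v f z = 0"
  using pd_cong[OF open_S assms(2), of f "\<lambda>_. c" v] assms(1) by (simp add: pd_const)

section \<open>Second fundamental form, Christoffel symbols and Gauss equation\<close>

lemma N_N: "z \<in> S \<Longrightarrow> N z \<bullet> N z = 1"
  using norm_N by (simp add: power2_norm_eq_inner[symmetric])

lemma pd_N_normal: "z \<in> S \<Longrightarrow> pd v N z \<bullet> N z = 0"
  using pd_eq_0[of "\<lambda>z. N z \<bullet> N z" 1 z v] pd_inner[of N z N v] N_N smooth_imp_diff[OF smooth_N]
  by (simp add: inner_commute)

lemma X_commute: "z \<in> S \<Longrightarrow> pd (e i) (pd (e k) P) z = pd (e k) (pd (e i) P) z"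
  by (rule pd_commute[OF open_S smooth_P])

text \<open>The normal is orthogonal to the tangents; differentiate that relation. Up to sign this
  is the second fundamental form, whose symmetry becomes that of second derivatives.\<close>

lemma w_q: "z \<in> S \<Longrightarrow> w z (Some i) \<bullet> q z (Some k) = - (N z \<bullet> pd (e i) (pd (e k) P) z)"
  using pd_eq_0[of "\<lambda>z. N z \<bullet> pd (e k) P z" 0 z "e i"]
    pd_q_inner[of z "e i" None "Some k"] N_normal
  by simp

lemma w_q_sym: "z \<in> S \<Longrightarrow> w z i \<bullet> q z j = w z j \<bullet> q z i"
  by (cases i; cases j) (simp_all add: w_q[simplified] X_commute pd_N_normal)

text \<open>Entries involving the normal are constants 0 or 1, so the isometry condition extends to
  the whole frame.\<close>

lemma time_indep_gram: "time_indep (\<lambda>z. q z i \<bullet> q z j)"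
proof -
  have "time_indep (\<lambda>z. pd (e k) P z \<bullet> pd (e l) P z)" for k l
    unfolding time_indep_def using isometric by blast
  moreover have "time_indep (\<lambda>z. q z i \<bullet> q z j)" if "i = None \<or> j = None"
    by (rule time_indep_cong[of "\<lambda>_. of_bool (i = j)"])
      (use that in \<open>auto simp: time_indep_def N_N N_normal inner_commute split: option.splits\<close>, (cases i; cases j; simp add: N_normal inner_commute)+)
  ultimately show ?thesis
    by (cases i; cases j) auto
qed

lemma q_skew:
  assumes "z \<in> S"
  shows "pd \<tau> (\<lambda>z. q z i) z \<bullet> q z j + q z i \<bullet> pd \<tau> (\<lambda>z. q z j) z = 0"
  using time_indep_imp_pd_zero[OF time_indep_gram[of i j] diff_inner[OF diff_q[OF assms] diff_q[OF assms]] assms]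
    pd_q_inner[OF assms, of \<tau> i j] by simp

text \<open>Koszul's formula: the Christoffel symbols of the first kind are a combination of first
  derivatives of the metric.\<close>

lemma time_indep_christoffel: "time_indep (\<lambda>z. pd (e i) (pd (e k) P) z \<bullet> q z (Some l))"
proof -
  let ?g = "\<lambda>k l z. q z (Some k) \<bullet> q z (Some l)"
  have pdg: "time_indep (pd (e i) (?g k l))" for i k l
    by (intro time_indep_pd time_indep_gram diff_inner diff_q)
  have g: "pd (e i) (?g k l) z = pd (e i) (pd (e k) P) z \<bullet> pd (e l) P z + pd (e k) P z \<bullet> pd (e i) (pd (e l) P) z"
    if "z \<in> S" for i k l z
    using pd_q_inner[OF that, of "e i" "Some k" "Some l"] by simp
  have "time_indep (\<lambda>z. pd (e i) (?g k l) z + pd (e k) (?g i l) z - pd (e l) (?g i k) z)"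
    by (intro time_indep_add time_indep_diff pdg)
  then have "time_indep (\<lambda>z. (pd (e i) (?g k l) z + pd (e k) (?g i l) z - pd (e l) (?g i k) z) / 2)"
    using time_indep_compose[where h = "\<lambda>x y. x / 2"] by blast
  then show ?thesis
  proof (rule time_indep_cong)
    fix z assume z: "z \<in> S"
    show "(pd (e i) (?g k l) z + pd (e k) (?g i l) z - pd (e l) (?g i k) z) / 2 =
        pd (e i) (pd (e k) P) z \<bullet> q z (Some l)"
      unfolding g[OF z] using X_commute[OF z] by (simp add: inner_commute)
  qed
qed

text \<open>Differentiating the Christoffel symbols and antisymmetrising in \<open>i\<close> and
  \<open>j\<close> cancels the third derivatives of \<open>P\<close>; only products of second
  derivatives remain.\<close>

lemma time_indep_riemann:
  "time_indep (\<lambda>z. pd (e i) (pd (e k) P) z \<bullet> pd (e j) (pd (e l) P) z -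
    pd (e j) (pd (e k) P) z \<bullet> pd (e i) (pd (e l) P) z)"
proof -
  let ?G = "\<lambda>i k l z. pd (e i) (pd (e k) P) z \<bullet> q z (Some l)"
  have pdG: "time_indep (pd (e j) (?G i k l))" for i j k l
    by (intro time_indep_pd time_indep_christoffel diff_inner diff_q diff_X)
  have G: "pd (e j) (?G i k l) z = pd (e j) (pd (e i) (pd (e k) P)) z \<bullet> pd (e l) P z +
      pd (e i) (pd (e k) P) z \<bullet> pd (e j) (pd (e l) P) z"
    if "z \<in> S" for i j k l z
    using pd_inner[OF diff_X[OF that, of i k] diff_q[OF that, of "Some l"], of "e j"] by simp
  have "time_indep (\<lambda>z. pd (e j) (?G i k l) z - pd (e i) (?G j k l) z)"
    by (intro time_indep_diff pdG)
  then show ?thesis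
  proof (rule time_indep_cong)
    fix z assume z: "z \<in> S"
    have "pd (e j) (pd (e i) (pd (e k) P)) z = pd (e i) (pd (e j) (pd (e k) P)) z"
      by (intro pd_commute[OF open_S _ z] smooth_on_pd open_S smooth_P)
    then show "pd (e j) (?G i k l) z - pd (e i) (?G j k l) z =
        pd (e i) (pd (e k) P) z \<bullet> pd (e j) (pd (e l) P) z -
        pd (e j) (pd (e k) P) z \<bullet> pd (e i) (pd (e l) P) z"
      unfolding G[OF z] by simp
  qed
qed

lemma vdet_q: "z \<in> S \<Longrightarrow> vdet (q z) \<noteq> 0"
  using nondeg[of z] by (simp add: q_def[abs_def])

text \<open>The subtracted product is the normal contribution, so this is an inner product of
  tangential parts \<open>?v\<close>. Their components along the frame are Christoffel symbols, and
  the Gram matrix of the frame is constant in time.\<close>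

lemma time_indep_tangential:
  "time_indep (\<lambda>z. pd (e i) (pd (e k) P) z \<bullet> pd (e j) (pd (e l) P) z -
    (N z \<bullet> pd (e i) (pd (e k) P) z) * (N z \<bullet> pd (e j) (pd (e l) P) z))"
proof -
  let ?X = "\<lambda>i k z. pd (e i) (pd (e k) P) z"
  let ?v = "\<lambda>i k z. ?X i k z - (N z \<bullet> ?X i k z) *\<^sub>R N z"
  have v: "?v i k (s, u) \<bullet> q (s, u) m = ?v i k (t, u) \<bullet> q (t, u) m"
    if "s \<in> {0<..<1}" "t \<in> {0<..<1}" "u \<in> U" for s t u i k m
  proof (cases m)
    case None
    then show ?thesis
      using that N_N[of "(s, u)"] N_N[of "(t, u)"] by (simp add: inner_diff_left inner_commute[of "pd _ _ _" "N _"])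
  next
    case (Some l)
    then show ?thesis
      using that N_normal[of "(s, u)" "axis l 1"] N_normal[of "(t, u)" "axis l 1"]
        time_indep_D[OF time_indep_christoffel that, of i k l]
      by (simp add: inner_diff_left)
  qed
  have "time_indep (\<lambda>z. ?v i k z \<bullet> ?v j l z)"
    unfolding time_indep_def
  proof (intro ballI)
    fix s t :: real and u assume st: "s \<in> {0<..<1}" "t \<in> {0<..<1}" and u: "u \<in> U"
    show "?v i k (s, u) \<bullet> ?v j l (s, u) = ?v i k (t, u) \<bullet> ?v j l (t, u)"
    proof (rule inner_determined_by_gram)
      show "q (s, u) i \<bullet> q (s, u) j = q (t, u) i \<bullet> q (t, u) j" for i j
        using time_indep_gram[of i j] st u unfolding time_indep_def by blast
      show "vdet (q (s, u)) \<noteq> 0" "vdet (q (t, u)) \<noteq> 0"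
        using vdet_q st u by auto
    qed (rule v[OF st u])+
  qed
  then show ?thesis
  proof (rule time_indep_cong)
    fix z assume "z \<in> S"
    then show "?v i k z \<bullet> ?v j l z = ?X i k z \<bullet> ?X j l z - (N z \<bullet> ?X i k z) * (N z \<bullet> ?X j l z)"
      using N_N[of z] by (simp add: inner_diff_left inner_diff_right inner_commute)
  qed
qed

lemma time_indep_gauss:
  "time_indep (\<lambda>z. (w z i \<bullet> q z k) * (w z j \<bullet> q z l) - (w z i \<bullet> q z l) * (w z j \<bullet> q z k))"
proof (cases "i = None \<or> j = None \<or> k = None \<or> l = None")
  case True
  have *: "0 = (w z i \<bullet> q z k) * (w z j \<bullet> q z l) - (w z i \<bullet> q z l) * (w z j \<bullet> q z k)" if "z \<in> S" for z
  proof -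
    have "w z a \<bullet> q z b = 0" if "a = None \<or> b = None" for a b
      using that pd_N_normal[OF \<open>z \<in> S\<close>] by (cases a; cases b) auto
    then show ?thesis using True by (auto simp del: q_simps)
  qed
  show ?thesis
    by (rule time_indep_cong[OF _ *]) (simp_all add: time_indep_def)
next
  case False
  then obtain i' j' k' l' where ijkl: "i = Some i'" "j = Some j'" "k = Some k'" "l = Some l'"
    by auto
  let ?X = "\<lambda>i k z. pd (e i) (pd (e k) P) z"
  have "time_indep (\<lambda>z. (?X i' k' z \<bullet> ?X j' l' z - ?X j' k' z \<bullet> ?X i' l' z)
      - (?X i' k' z \<bullet> ?X j' l' z - (N z \<bullet> ?X i' k' z) * (N z \<bullet> ?X j' l' z))
      + (?X j' k' z \<bullet> ?X i' l' z - (N z \<bullet> ?X j' k' z) * (N z \<bullet> ?X i' l' z)))"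
    by (intro time_indep_add time_indep_diff time_indep_riemann time_indep_tangential)
  then show ?thesis
    by (rule time_indep_cong) (simp add: ijkl w_q[simplified])
qed

lemma gauss_derivative:
  assumes z: "z \<in> S"
  defines "h' \<equiv> \<lambda>i j. pd \<tau> (\<lambda>z. w z i) z \<bullet> q z j + w z i \<bullet> pd \<tau> (\<lambda>z. q z j) z"
  shows "(w z i \<bullet> q z k) * h' j l + h' i k * (w z j \<bullet> q z l) =
    (w z i \<bullet> q z l) * h' j k + h' i l * (w z j \<bullet> q z k)"
proof -
  let ?H = "\<lambda>i k z. w z i \<bullet> q z k"
  have dH: "?H i k differentiable at z" for i k
    by (intro diff_inner diff_w diff_q z)
  have H: "pd \<tau> (?H i k) z = h' i k" for i k
    unfolding h'_def by (rule pd_inner[OF diff_w[OF z] diff_q[OF z]])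
  have dHH: "(\<lambda>z. ?H i k z * ?H j l z) differentiable at z" for i j k l
    by (intro differentiable_mult dH)
  have HH: "pd \<tau> (\<lambda>z. ?H i k z * ?H j l z) z = h' i k * ?H j l z + ?H i k z * h' j l" for i j k l
    using pd_inner[OF dH[of i k] dH[of j l], of \<tau>] by (simp add: H)
  have "pd \<tau> (\<lambda>z. ?H i k z * ?H j l z - ?H i l z * ?H j k z) z = 0"
    by (intro time_indep_imp_pd_zero time_indep_gauss differentiable_diff dHH z)
  then show ?thesis
    by (simp add: pd_diff[OF dHH dHH] HH)
qed

text \<open>By Cramer's rule, the \<open>i\<close>-th tangential component of the velocity of the
  normal times the volume of the frame: a vector density, whose divergence is a plain sum of partial
  derivatives.\<close>

definition Y where "Y i z = vdet ((q z)(Some i := pd \<tau> N z))"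

text \<open>The derivative given by multilinearity, kept explicit because its continuity is needed
  under the integral sign.\<close>

definition Y' where
  "Y' i z v = (\<Sum>k\<in>UNIV. vdet ((q z)(Some i := pd \<tau> N z, k := (if k = Some i then pd v (pd \<tau> N) z else pd v (\<lambda>z. q z k) z))))"

lemma Y_has_derivative:
  assumes z: "z \<in> S"
  shows "(Y i has_derivative Y' i z) (at z)"
proof -
  have "((\<lambda>z. ((q z)(Some i := pd \<tau> N z)) k) has_derivative
      (\<lambda>v. if k = Some i then pd v (pd \<tau> N) z else pd v (\<lambda>z. q z k) z)) (at z)" for k
    using smooth_on_has_derivative[OF open_S smooth_q z, of k]
      smooth_on_has_derivative[OF open_S smooth_on_pd[OF open_S smooth_N] z, of \<tau>]
    by (cases "k = Some i") auto
  then show ?thesis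
    unfolding Y_def[abs_def] Y'_def[abs_def] by (rule has_derivative_vdet)
qed

lemma continuous_on_Y: "continuous_on S (Y i)"
  using has_derivative_continuous[OF Y_has_derivative] by (intro continuous_at_imp_continuous_on) blast

lemma continuous_on_Y': "continuous_on S (\<lambda>z. Y' i z v)"
  unfolding Y'_def
proof (intro continuous_on_sum continuous_on_vdet)
  fix k j
  show "continuous_on S (\<lambda>z. ((q z)(Some i := pd \<tau> N z,
      k := if k = Some i then pd v (pd \<tau> N) z else pd v (\<lambda>z. q z k) z)) j)"
    by (cases "j = k"; cases "j = Some i"; cases "k = Some i")
      (auto intro!: continuous_on_pd open_S smooth_on_pd smooth_N smooth_q smooth_on_imp_continuous_on)
qed

text \<open>The other terms cancel. Where tangent \<open>j\<close> is differentiated, a second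
  derivative in row \<open>j\<close> stands beside \<open>pd \<tau> N\<close> in row
  \<open>i\<close>; second derivatives are symmetric and rows antisymmetric, so (i, j) cancels (j,
  i). Where the normal is differentiated, all rows are orthogonal to \<open>N\<close>.\<close>

lemma divergence_Y:
  assumes z: "z \<in> S"
  shows "(\<Sum>i\<in>UNIV. Y' i z (e i)) = (\<Sum>i\<in>UNIV. vdet ((q z)(Some i := pd (e i) (pd \<tau> N) z)))"
proof -
  define T where "T i j = (if i = j then 0 else vdet ((q z)(Some i := pd \<tau> N z, Some j := pd (e i) (pd (e j) P) z)))" for i j
  have Y': "Y' i z (e i) = vdet ((q z)(Some i := pd (e i) (pd \<tau> N) z)) + (\<Sum>j\<in>UNIV. T i j)" for i
  proof -
    let ?f = "\<lambda>k. vdet ((q z)(Some i := pd \<tau> N z,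
        k := (if k = Some i then pd (e i) (pd \<tau> N) z else pd (e i) (\<lambda>z. q z k) z)))"
    have "?f None = 0"
    proof (rule vdet_eq_0I)
      show "N z \<noteq> 0" using norm_N[OF z] by auto
      fix k
      show "((q z)(Some i := pd \<tau> N z, None := (if None = Some i then pd (e i) (pd \<tau> N) z
          else pd (e i) (\<lambda>z. q z None) z))) k \<bullet> N z = 0"
        using pd_N_normal[OF z] N_normal[OF z] by (cases k) (auto simp: inner_commute)
    qed
    moreover have "(\<Sum>j\<in>UNIV. ?f (Some j)) = ?f (Some i) + (\<Sum>j\<in>UNIV - {i}. ?f (Some j))"
      by (rule sum.remove) auto
    moreover have "(\<Sum>j\<in>UNIV - {i}. ?f (Some j)) = (\<Sum>j\<in>UNIV - {i}. T i j)"
      by (rule sum.cong) (auto simp: T_def)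
    moreover have "(\<Sum>j\<in>UNIV. T i j) = T i i + (\<Sum>j\<in>UNIV - {i}. T i j)"
      by (rule sum.remove) auto
    ultimately show ?thesis
      by (simp add: Y'_def sum_UNIV_option T_def)
  qed
  have "T i j = - T j i" for i j
  proof (cases "i = j")
    case False
    then have "T j i = vdet ((q z)(Some i := pd (e i) (pd (e j) P) z, Some j := pd \<tau> N z))"
      by (simp add: T_def fun_upd_twist X_commute[OF z, of j i])
    also have "\<dots> = - T i j"
      using False vdet_swap[of "Some i" "Some j" "q z" "pd (e i) (pd (e j) P) z" "pd \<tau> N z"]
      by (simp add: T_def)
    finally show ?thesis by simp
  qed (simp add: T_def)
  then have "(\<Sum>i\<in>UNIV. \<Sum>j\<in>UNIV. 1 * T i j) = 0"
    by (intro sum_symmetric_antisymmetric refl)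
  then show ?thesis
    by (simp add: Y' sum.distrib)
qed

lemma parallel_density_derivative:
  assumes tu: "(t, u) \<in> S"
  shows "((\<lambda>t. vdet (\<lambda>k. q (t, u) k + \<epsilon> *\<^sub>R w (t, u) k)) has_real_derivative
    \<epsilon> * (\<Sum>i\<in>UNIV. Y' i (t, u) (e i))) (at t)"
proof -
  let ?w' = "\<lambda>i. pd \<tau> (\<lambda>z. w z i) (t, u)"
  have "((\<lambda>t. vdet (\<lambda>k. q (t, u) k + \<epsilon> *\<^sub>R w (t, u) k)) has_real_derivative
      \<epsilon> * (\<Sum>i\<in>UNIV. vdet ((q (t, u))(i := ?w' i)))) (at t)"
    by (rule isometric_variation_vdet[OF has_vector_derivative_time[OF diff_q[OF tu]]
        has_vector_derivative_time[OF diff_w[OF tu]] vdet_q[OF tu] q_skew[OF tu] w_q_sym[OF tu] refl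
        gauss_derivative[OF tu]])
  \<comment> \<open>Time and space derivatives of \<open>N\<close> commute, and the row
    \<open>None\<close> of \<open>?w'\<close> is zero.\<close>
  also have "(\<Sum>i\<in>UNIV. vdet ((q (t, u))(i := ?w' i))) = (\<Sum>i\<in>UNIV. Y' i (t, u) (e i))"
    unfolding divergence_Y[OF tu] sum_UNIV_option
    by (simp add: pd_const vdet_zero pd_commute[OF open_S smooth_N tu])
  finally show ?thesis .
qed

text \<open>A unit vector moves orthogonally to itself, so its velocity is tangential;
  \<open>W\<close> is this velocity in coordinates.\<close>

lemma normal_velocity:
  assumes z: "z \<in> S"
  obtains W where "pd \<tau> N z = pd (0, W) P z" "\<And>i. Y i z = W $ i * vdet (q z)"
proof -
  obtain x where x: "pd \<tau> N z = (\<Sum>i\<in>UNIV. x i *\<^sub>R q z i)"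
    using vdet_expansion[OF vdet_q[OF z]] by blast
  have "N z \<bullet> pd \<tau> N z = 0"
    using pd_N_normal[OF z, of \<tau>] by (simp add: inner_commute)
  moreover have "N z \<bullet> pd \<tau> N z = x None"
    using N_N[OF z] N_normal[OF z]
    by (simp add: x sum_UNIV_option inner_add_right inner_sum_right)
  ultimately have "x None = 0" by simp
  let ?W = "\<chi> i. x (Some i)"
  have lin: "linear (\<lambda>v. pd (0, v) P z)"
  proof -
    have "linear (\<lambda>v. pd v P z)"
      using smooth_on_has_derivative[OF open_S smooth_P z] by (rule has_derivative_linear)
    then have "linear ((\<lambda>v. pd v P z) \<circ> (\<lambda>v. (0, v)))"
      by (rule linear_compose[rotated]) (auto intro!: linearI)
    then show ?thesis by (simp add: o_def)
  qed
  have "pd (0, ?W) P z = (\<Sum>k\<in>UNIV. ?W $ k *\<^sub>R pd (e k) P z)"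
  proof -
    have "?W = (\<Sum>k\<in>UNIV. ?W $ k *\<^sub>R axis k 1)"
      using basis_expansion[of ?W] by (simp add: scalar_mult_eq_scaleR)
    then have "pd (0, ?W) P z = pd (0, \<Sum>k\<in>UNIV. ?W $ k *\<^sub>R axis k 1) P z"
      by (rule arg_cong[where f = "\<lambda>v. pd (0, v) P z"])
    then show ?thesis
      by (simp only: linear_sum[OF lin] linear_scale[OF lin])
  qed
  also have "\<dots> = pd \<tau> N z"
    by (simp add: x sum_UNIV_option \<open>x None = 0\<close>)
  finally have "pd \<tau> N z = pd (0, ?W) P z" ..
  moreover have "Y i z = ?W $ i * vdet (q z)" for i
    unfolding Y_def x by (simp add: vdet_cramer)
  ultimately show ?thesis by (rule that)
qed

end

section \<open>Integration on a compact manifold\<close>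

lemma max_0_square_has_derivative:
  "((\<lambda>s::real. (max 0 s)\<^sup>2) has_real_derivative 2 * max 0 s) (at s)"
proof -
  consider "s > 0" | "s < 0" | "s = 0" by linarith
  then show ?thesis
  proof cases
    case 1
    have "((\<lambda>s. s\<^sup>2) has_real_derivative 2 * max 0 s) (at s)"
      using 1 by (auto intro!: derivative_eq_intros)
    then show ?thesis
      by (rule has_field_derivative_transform_within_open[of _ _ _ "{0<..}"]) (use 1 in auto)
  next
    case 2
    have "((\<lambda>s. 0) has_real_derivative 2 * max 0 s) (at s)"
      using 2 by auto
    then show ?thesis
      by (rule has_field_derivative_transform_within_open[of _ _ _ "{..<0}"]) (use 2 in auto)
  next
    case 3
    have "((\<lambda>h. (max 0 h)\<^sup>2 / h) \<longlongrightarrow> 0) (at (0::real))"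
    proof (rule Lim_null_comparison)
      show "\<forall>\<^sub>F h in at (0::real). norm ((max 0 h)\<^sup>2 / h) \<le> \<bar>h\<bar>"
        by (intro always_eventually) (auto simp: max_def power2_eq_square)
      show "((\<lambda>h. \<bar>h\<bar>) \<longlongrightarrow> 0) (at (0::real))"
        using tendsto_rabs[OF tendsto_ident_at, of "0::real" UNIV] by simp
    qed
    then show ?thesis
      using 3 by (simp add: has_field_derivative_iff)
  qed
qed

text \<open>One continuous derivative is enough: the partition functions are differentiated only
  once, in the integration by parts.\<close>

definition C1_on :: "'b::real_normed_vector set \<Rightarrow> ('b \<Rightarrow> real) \<Rightarrow> bool" where
  "C1_on S f \<longleftrightarrow> (\<forall>u\<in>S. (f has_derivative (\<lambda>v. pd v f u)) (at u)) \<and> (\<forall>v. continuous_on S (pd v f))"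

lemma C1_onI:
  assumes "\<And>u. u \<in> S \<Longrightarrow> (f has_derivative f' u) (at u)" "\<And>v. continuous_on S (\<lambda>u. f' u v)"
  shows "C1_on S f"
proof -
  have pd: "pd v f u = f' u v" if "u \<in> S" for u v
    using assms(1)[OF that] by (rule has_derivative_pd)
  have "continuous_on S (pd v f)" for v
    by (rule continuous_on_eq[OF assms(2)[of v]]) (simp add: pd)
  then show ?thesis
    using assms(1) by (simp add: C1_on_def pd)
qed

lemma C1_on_continuous: "C1_on S f \<Longrightarrow> continuous_on S f"
  unfolding C1_on_def by (intro continuous_at_imp_continuous_on ballI has_derivative_continuous) blast

lemma C1_on_sum:
  assumes "\<And>i. i \<in> I \<Longrightarrow> C1_on S (f i)"
  shows "C1_on S (\<lambda>u. \<Sum>i\<in>I. f i u)"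
  by (rule C1_onI[where f' = "\<lambda>u v. \<Sum>i\<in>I. pd v (f i) u"])
    (use assms in \<open>auto simp: C1_on_def intro!: has_derivative_sum continuous_on_sum\<close>)

lemma C1_on_divide:
  assumes f: "C1_on S f" and g: "C1_on S g" and nz: "\<And>u. u \<in> S \<Longrightarrow> g u \<noteq> 0"
  shows "C1_on S (\<lambda>u. f u / g u)"
proof (rule C1_onI)
  show "((\<lambda>u. f u / g u) has_derivative
      (\<lambda>v. - f u * (inverse (g u) * pd v g u * inverse (g u)) + pd v f u / g u)) (at u)" if "u \<in> S" for u
    using f g nz[OF that] that unfolding C1_on_def by (intro has_derivative_divide) blast+
  show "continuous_on S (\<lambda>u. - f u * (inverse (g u) * pd v g u * inverse (g u)) + pd v f u / g u)" for v
    using f g nz C1_on_continuous[OF f] C1_on_continuous[OF g] unfolding C1_on_def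
    by (intro continuous_intros) blast+
qed

lemma pd_eq_0_open:
  assumes "open S" "z \<in> S" "\<And>x. x \<in> S \<Longrightarrow> f x = 0"
  shows "pd v f z = 0"
  using pd_cong[OF assms(1,2), of f "\<lambda>_. 0" v] assms(3) by (simp add: pd_const)

lemma C1_on_cong:
  assumes "open S" "C1_on S f" "\<And>u. u \<in> S \<Longrightarrow> f u = g u"
  shows "C1_on S g"
proof (rule C1_onI)
  show "(g has_derivative (\<lambda>v. pd v f u)) (at u)" if "u \<in> S" for u
    by (rule has_derivative_transform_within_open[OF _ assms(1) that assms(3)])
      (use assms(2) that in \<open>simp add: C1_on_def\<close>)
  show "continuous_on S (\<lambda>u. pd v f u)" for v
    using assms(2) by (simp add: C1_on_def)
qed

lemma C1_on_Un: "open S \<Longrightarrow> open T \<Longrightarrow> C1_on S f \<Longrightarrow> C1_on T f \<Longrightarrow> C1_on (S \<union> T) f"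
  unfolding C1_on_def by (auto intro: continuous_on_open_Un)

lemma C1_on_zero: "C1_on S (\<lambda>_. 0)"
  by (rule C1_onI[where f' = "\<lambda>_ _. 0"]) auto

lemma
  fixes f :: "'b::euclidean_space \<Rightarrow> real"
  assumes "\<And>x. x \<in> S - T \<Longrightarrow> f x = 0" "\<And>x. x \<in> T - S \<Longrightarrow> f x = 0"
  shows absolutely_integrable_eq_on_support: "f absolutely_integrable_on S \<longleftrightarrow> f absolutely_integrable_on T"
    and integral_eq_on_support: "integral S f = integral T f"
proof -
  have e: "{x \<in> S - T. f x \<noteq> 0} = {}" "{x \<in> T - S. f x \<noteq> 0} = {}"
    using assms by blast+
  show "f absolutely_integrable_on S \<longleftrightarrow> f absolutely_integrable_on T"
    by (rule absolutely_integrable_spike_set_eq) (simp_all only: e negligible_empty)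
  show "integral S f = integral T f"
    by (rule integral_spike_set) (simp_all only: e negligible_empty)
qed

locale compact_atlas =
  fixes M :: "'a::t2_space set" and A :: "('a, 'm::finite) chart set"
  assumes compact_M: "compact M" and atlas: "oriented_smooth_atlas M A"
begin

definition overlap where "overlap c d = coord c ` (dom_of c \<inter> dom_of d)"
definition transition where "transition c d = coord d \<circ> param c"

lemma dom_openin: "c \<in> A \<Longrightarrow> openin (top_of_set M) (dom_of c)"
  and open_codom: "c \<in> A \<Longrightarrow> open (codom_of c)"
  and homeo: "c \<in> A \<Longrightarrow> homeomorphism (dom_of c) (codom_of c) (coord c) (param c)"
  and union_dom: "(\<Union>c\<in>A. dom_of c) = M"
  using atlas by (auto simp: oriented_smooth_atlas_def)

lemma param_coord: "c \<in> A \<Longrightarrow> x \<in> dom_of c \<Longrightarrow> param c (coord c x) = x"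
  and coord_param: "c \<in> A \<Longrightarrow> u \<in> codom_of c \<Longrightarrow> coord c (param c u) = u"
  and param_in: "c \<in> A \<Longrightarrow> u \<in> codom_of c \<Longrightarrow> param c u \<in> dom_of c"
  and coord_in: "c \<in> A \<Longrightarrow> x \<in> dom_of c \<Longrightarrow> coord c x \<in> codom_of c"
  and continuous_param: "c \<in> A \<Longrightarrow> continuous_on (codom_of c) (param c)"
  using homeo[of c] unfolding homeomorphism_def by blast+

lemma dom_subset: "c \<in> A \<Longrightarrow> dom_of c \<subseteq> M"
  using union_dom by blast

lemma param_in_M: "c \<in> A \<Longrightarrow> u \<in> codom_of c \<Longrightarrow> param c u \<in> M"
  using param_in dom_subset by blast

lemma inj_coord: "c \<in> A \<Longrightarrow> inj_on (coord c) (dom_of c)"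
  using param_coord by (metis inj_onI)

lemma open_coord_image:
  assumes c: "c \<in> A" and X: "openin (top_of_set M) X"
  shows "open (coord c ` (dom_of c \<inter> X))"
proof -
  have "openin (top_of_set (dom_of c)) (dom_of c \<inter> X)"
    using X dom_subset[OF c] by (auto simp: openin_open)
  then have "openin (top_of_set (codom_of c)) (coord c ` (dom_of c \<inter> X))"
    by (rule homeomorphism_imp_open_map[OF homeo[OF c]])
  then show ?thesis
    using open_codom[OF c] openin_open_eq by blast
qed

lemma open_overlap: "c \<in> A \<Longrightarrow> d \<in> A \<Longrightarrow> open (overlap c d)"
  unfolding overlap_def by (intro open_coord_image dom_openin)

lemma overlap_iff: "c \<in> A \<Longrightarrow> u \<in> overlap c d \<longleftrightarrow> u \<in> codom_of c \<and> param c u \<in> dom_of d"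
  unfolding overlap_def using param_coord[of c] coord_param[of c u] param_in[of c u] coord_in[of c]
  by (auto intro: rev_image_eqI)

lemma param_transition: "c \<in> A \<Longrightarrow> d \<in> A \<Longrightarrow> u \<in> overlap c d \<Longrightarrow> param d (transition c d u) = param c u"
  by (simp add: overlap_iff transition_def param_coord)

lemma transition_in: "c \<in> A \<Longrightarrow> d \<in> A \<Longrightarrow> u \<in> overlap c d \<Longrightarrow> transition c d u \<in> codom_of d"
  by (simp add: overlap_iff transition_def coord_in)

lemma smooth_transition: "c \<in> A \<Longrightarrow> d \<in> A \<Longrightarrow> smooth_on (overlap c d) (transition c d)"
  using atlas unfolding oriented_smooth_atlas_def overlap_def transition_def by blast

lemma transition_derivative:
  "c \<in> A \<Longrightarrow> d \<in> A \<Longrightarrow> u \<in> overlap c d \<Longrightarrow> (transition c d has_derivative (\<lambda>v. pd v (transition c d) u)) (at u)"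
  by (rule smooth_on_has_derivative[OF open_overlap smooth_transition])

lemma det_transition_pos:
  assumes "c \<in> A" "d \<in> A" "u \<in> overlap c d"
  shows "det (matrix (\<lambda>v. pd v (transition c d) u)) > 0"
proof -
  have "(\<lambda>v. pd v (transition c d) u) = frechet_derivative (coord d \<circ> param c) (at u)"
    by (simp add: pd_def[abs_def] transition_def)
  then show ?thesis
    using atlas assms unfolding oriented_smooth_atlas_def overlap_def by force
qed

lemma transition_derivative_chain:
  fixes f :: "'a \<Rightarrow> 'v::real_normed_vector"
  assumes c: "c \<in> A" and d: "d \<in> A" and u: "u \<in> overlap c d"
    and f: "((f \<circ> param d) has_derivative f') (at (transition c d u))"
  shows "((f \<circ> param c) has_derivative (\<lambda>v. f' (pd v (transition c d) u))) (at u)"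
proof -
  have "((f \<circ> param d) \<circ> transition c d has_derivative f' \<circ> (\<lambda>v. pd v (transition c d) u)) (at u)"
    by (rule diff_chain_at[OF transition_derivative[OF c d u] f])
  then show ?thesis
    unfolding o_def
    by (rule has_derivative_transform_within_open[OF _ open_overlap[OF c d] u]) (simp add: param_transition c d)
qed

definition C1_manifold where
  "C1_manifold f \<longleftrightarrow> (\<forall>c\<in>A. C1_on (codom_of c) (f \<circ> param c))"

text \<open>The image of \<open>K\<close> is compact, hence closed in a Hausdorff space. On the
  resulting open sets a function extended by zero from the chart \<open>c\<close> is trivially
  differentiable in the other charts.\<close>

lemma open_outside:
  assumes c: "c \<in> A" and d: "d \<in> A" and K: "compact K" "K \<subseteq> codom_of c"
  shows "open {u \<in> codom_of d. param d u \<notin> param c ` K}"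
proof -
  have "compact (param c ` K)"
    using K continuous_on_subset[OF continuous_param[OF c]] by (intro compact_continuous_image) auto
  then have "open (codom_of d \<inter> param d -` (- param c ` K))"
    by (intro continuous_open_preimage continuous_param d open_codom open_Compl compact_imp_closed)
  moreover have "codom_of d \<inter> param d -` (- param c ` K) = {u \<in> codom_of d. param d u \<notin> param c ` K}"
    by auto
  ultimately show ?thesis by simp
qed

lemma bump_exists:
  assumes x: "x \<in> M"
  obtains c a b K \<beta> where "c \<in> A" "cbox a b \<subseteq> codom_of c" "compact K" "K \<subseteq> box a b"
    "C1_manifold \<beta>" "\<forall>y. \<beta> y \<ge> 0" "\<beta> x > 0" "openin (top_of_set M) {y \<in> M. \<beta> y > 0}"
    "\<forall>y. \<beta> y \<noteq> 0 \<longrightarrow> y \<in> param c ` K"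
proof -
  obtain c where c: "c \<in> A" "x \<in> dom_of c" using x union_dom by blast
  define p where "p = coord c x"
  have "p \<in> codom_of c" using c by (simp add: p_def coord_in)
  then obtain a b where ab: "cbox a b \<subseteq> codom_of c" "p \<in> box a b"
    using open_contains_cbox[OF open_codom[OF c(1)]] by metis
  obtain r where r: "r > 0" "cball p r \<subseteq> box a b"
    using ab(2) open_box open_contains_cball by metis
  define K where "K = cball p r"
  have K: "compact K" "K \<subseteq> box a b" "K \<subseteq> codom_of c"
    using r(2) subset_trans[OF r(2) subset_trans[OF box_subset_cbox ab(1)]] by (simp_all add: K_def)
  define g where "g u = r\<^sup>2 - (u - p) \<bullet> (u - p)" for u
  \<comment> \<open>Squaring makes the positive part continuously differentiable across the sphere
    of radius \<open>r\<close>.\<close>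
  define bf where "bf u = (max 0 (g u))\<^sup>2" for u
  define b' where "b' u v = 2 * max 0 (g u) * - (2 * ((u - p) \<bullet> v))" for u v
  have g_pos: "g u > 0 \<longleftrightarrow> u \<in> ball p r" for u
  proof -
    have "g u > 0 \<longleftrightarrow> (norm (u - p))\<^sup>2 < r\<^sup>2"
      by (simp add: g_def power2_norm_eq_inner)
    also have "\<dots> \<longleftrightarrow> norm (u - p) < r"
      using r by (meson norm_ge_zero power_less_imp_less_base power_strict_mono less_imp_le pos2)
    finally show ?thesis by (simp add: dist_norm norm_minus_commute)
  qed
  have db: "(bf has_derivative b' u) (at u)" for u
  proof -
    have "(g has_derivative (\<lambda>v. - (2 * ((u - p) \<bullet> v)))) (at u)"
      unfolding g_def[abs_def] by (auto intro!: derivative_eq_intros simp: inner_commute)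
    then have "((\<lambda>s. (max 0 s)\<^sup>2) \<circ> g has_derivative (\<lambda>x. 2 * max 0 (g u) * x) \<circ> (\<lambda>v. - (2 * ((u - p) \<bullet> v)))) (at u)"
      by (rule diff_chain_at)
        (use max_0_square_has_derivative[of "g u"] in \<open>simp add: has_field_derivative_def\<close>)
    then show ?thesis
      by (simp add: bf_def[abs_def] b'_def[abs_def] o_def)
  qed
  define \<beta> where "\<beta> y = (if y \<in> dom_of c then bf (coord c y) else 0)" for y
  have \<beta>_pos: "\<beta> y > 0 \<longleftrightarrow> y \<in> dom_of c \<and> coord c y \<in> ball p r" for y
    unfolding g_pos[symmetric] by (auto simp: \<beta>_def bf_def max_def)
  have \<beta>_nonneg: "\<beta> y \<ge> 0" for y
    by (simp add: \<beta>_def bf_def)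
  have \<beta>_K: "y \<in> param c ` K" if "\<beta> y \<noteq> 0" for y
  proof -
    have "\<beta> y > 0" using that \<beta>_nonneg[of y] by simp
    then have "y \<in> dom_of c" "coord c y \<in> K"
      using \<beta>_pos by (auto simp: K_def)
    then show ?thesis
      using param_coord[OF c(1)] by (metis imageI)
  qed
  \<comment> \<open>Two open sets cover the image of \<open>d\<close>: the overlap with
    \<open>c\<close>, where \<open>\<beta>\<close> is \<open>bf\<close> after the transition map,
    and the complement of the support, where it is zero.\<close>
  have "C1_on (codom_of d) (\<beta> \<circ> param d)" if d: "d \<in> A" for d
  proof -
    let ?V = "{u \<in> codom_of d. param d u \<notin> param c ` K}"
    have V: "open ?V" by (rule open_outside[OF c(1) d K(1,3)])
    have "C1_on (overlap d c) (\<beta> \<circ> param d)"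
    proof (rule C1_on_cong[OF open_overlap[OF d c(1)]])
      show "C1_on (overlap d c) (bf \<circ> transition d c)"
      proof (rule C1_onI)
        show "(bf \<circ> transition d c has_derivative (\<lambda>v. b' (transition d c u) (pd v (transition d c) u))) (at u)"
          if "u \<in> overlap d c" for u
          using diff_chain_at[OF transition_derivative[OF d c(1) that] db] by (simp add: o_def)
        show "continuous_on (overlap d c) (\<lambda>u. b' (transition d c u) (pd v (transition d c) u))" for v
          unfolding b'_def g_def
          by (intro continuous_intros continuous_on_pd[OF open_overlap smooth_transition]
              smooth_on_imp_continuous_on[OF smooth_transition] d c(1))
      qed
      show "(bf \<circ> transition d c) u = (\<beta> \<circ> param d) u" if "u \<in> overlap d c" for u
        using that d by (simp add: overlap_iff \<beta>_def transition_def)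
    qed
    moreover have "C1_on ?V (\<beta> \<circ> param d)"
      by (rule C1_on_cong[OF V C1_on_zero]) (use \<beta>_K in force)
    moreover have "codom_of d = overlap d c \<union> ?V"
      using d c(1) K(3) param_in[OF c(1)] by (auto simp: overlap_iff)
    ultimately show ?thesis
      using C1_on_Un[OF open_overlap[OF d c(1)] V, of "\<beta> \<circ> param d"] by simp
  qed
  then have "C1_manifold \<beta>" by (simp add: C1_manifold_def)
  moreover have "\<beta> x > 0"
    using c r by (simp add: \<beta>_pos p_def)
  moreover have "openin (top_of_set M) {y \<in> M. \<beta> y > 0}"
  proof -
    have "continuous_on (dom_of c) (coord c)"
      using homeo[OF c(1)] by (simp add: homeomorphism_def)
    then have "openin (top_of_set (dom_of c)) (dom_of c \<inter> coord c -` ball p r)"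
      by (rule continuous_openin_preimage_gen) simp
    moreover have "dom_of c \<inter> coord c -` ball p r = {y \<in> M. \<beta> y > 0}"
      using dom_subset[OF c(1)] by (auto simp: \<beta>_pos)
    ultimately show ?thesis
      using openin_trans dom_openin[OF c(1)] by metis
  qed
  ultimately show ?thesis
    using that[OF c(1) ab(1) K(1,2)] \<beta>_nonneg \<beta>_K by blast
qed

end

text \<open>The support lies in the open box and the closed box in the chart image, so integration
  by parts over a box has no boundary term. In the construction below the indices are the points at
  which bumps are centred.\<close>

locale atlas_partition = compact_atlas M A
  for M :: "'a::t2_space set" and A :: "('a, 'm::finite) chart set" +
  fixes I :: "'a set" and ch :: "'a \<Rightarrow> ('a, 'm) chart" and lo hi :: "'a \<Rightarrow> real ^ 'm"
    and K :: "'a \<Rightarrow> (real ^ 'm) set" and \<psi> :: "'a \<Rightarrow> 'a \<Rightarrow> real"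
  assumes finite_I: "finite I"
    and ch: "\<And>x. x \<in> I \<Longrightarrow> ch x \<in> A" and box_codom: "\<And>x. x \<in> I \<Longrightarrow> cbox (lo x) (hi x) \<subseteq> codom_of (ch x)"
    and compact_K: "\<And>x. x \<in> I \<Longrightarrow> compact (K x)" and K_box: "\<And>x. x \<in> I \<Longrightarrow> K x \<subseteq> box (lo x) (hi x)"
    and C1_\<psi>: "\<And>x. x \<in> I \<Longrightarrow> C1_manifold (\<psi> x)" and \<psi>_nonneg: "\<And>x y. x \<in> I \<Longrightarrow> \<psi> x y \<ge> 0"
    and \<psi>_support: "\<And>x y. x \<in> I \<Longrightarrow> \<psi> x y \<noteq> 0 \<Longrightarrow> y \<in> param (ch x) ` K x"
    and \<psi>_sum: "\<And>y. y \<in> M \<Longrightarrow> (\<Sum>x\<in>I. \<psi> x y) = 1"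

context compact_atlas
begin

lemma partition_of_unity: "\<exists>I ch lo hi K \<psi>. atlas_partition M A I ch lo hi K \<psi>"
proof -
  \<comment> \<open>All data of a bump form one tuple, so that a single choice function selects them
    for every point.\<close>
  define good where "good x = (\<lambda>(c, a, b, K, \<beta>). c \<in> A \<and> cbox a b \<subseteq> codom_of c \<and> compact K \<and> K \<subseteq> box a b \<and>
      C1_manifold \<beta> \<and> (\<forall>y. \<beta> y \<ge> 0) \<and> \<beta> x > 0 \<and> openin (top_of_set M) {y \<in> M. \<beta> y > 0} \<and>
      (\<forall>y. \<beta> y \<noteq> 0 \<longrightarrow> y \<in> param c ` K))" for x :: 'a
  have "\<forall>x\<in>M. \<exists>T. good x T"
  proof
    fix x assume "x \<in> M"
    then obtain c a b K \<beta> where "c \<in> A" "cbox a b \<subseteq> codom_of c" "compact K" "K \<subseteq> box a b"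
        "C1_manifold \<beta>" "\<forall>y. \<beta> y \<ge> 0" "\<beta> x > 0" "openin (top_of_set M) {y \<in> M. \<beta> y > 0}"
        "\<forall>y. \<beta> y \<noteq> 0 \<longrightarrow> y \<in> param c ` K"
      by (rule bump_exists)
    then have "good x (c, a, b, K, \<beta>)" by (simp add: good_def)
    then show "\<exists>T. good x T" ..
  qed
  then obtain F where F: "\<forall>x\<in>M. good x (F x)"
    unfolding bchoice_iff ..
  define ch where "ch x = fst (F x)" for x
  define lo where "lo x = fst (snd (F x))" for x
  define hi where "hi x = fst (snd (snd (F x)))" for x
  define K where "K x = fst (snd (snd (snd (F x))))" for x
  define \<beta> where "\<beta> x = snd (snd (snd (snd (F x))))" for x
  have *: "\<forall>x\<in>M. ch x \<in> A \<and> cbox (lo x) (hi x) \<subseteq> codom_of (ch x) \<and>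
      compact (K x) \<and> K x \<subseteq> box (lo x) (hi x) \<and>
      C1_manifold (\<beta> x) \<and> (\<forall>y. \<beta> x y \<ge> 0) \<and> \<beta> x x > 0 \<and> openin (top_of_set M) {y \<in> M. \<beta> x y > 0} \<and>
      (\<forall>y. \<beta> x y \<noteq> 0 \<longrightarrow> y \<in> param (ch x) ` K x)"
    using F unfolding good_def split_beta ch_def lo_def hi_def K_def \<beta>_def by blast
  let ?C = "(\<lambda>x. {y \<in> M. \<beta> x y > 0}) ` M"
  have "\<forall>X\<in>?C. openin (top_of_set M) X" "M \<subseteq> \<Union>?C"
    using * by auto
  then obtain D where "D \<subseteq> ?C" "finite D" "M \<subseteq> \<Union>D"
    using compact_M unfolding compact_eq_openin_cover by meson
  then obtain I where I: "I \<subseteq> M" "finite I" "M \<subseteq> (\<Union>x\<in>I. {y \<in> M. \<beta> x y > 0})"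
    using finite_subset_image[OF \<open>finite D\<close> \<open>D \<subseteq> ?C\<close>] by auto
  define B where "B y = (\<Sum>x\<in>I. \<beta> x y)" for y
  have B: "B y > 0" if y: "y \<in> M" for y
  proof -
    obtain x where "x \<in> I" "\<beta> x y > 0" using I(3) y by blast
    then show ?thesis
      unfolding B_def using I * by (intro sum_pos2[of I x]) auto
  qed
  have C1B: "C1_on (codom_of c) (B \<circ> param c)" if "c \<in> A" for c
    using C1_on_sum[of I "codom_of c" "\<lambda>x. \<beta> x \<circ> param c"] I(1) * that
    by (auto simp: C1_manifold_def B_def[abs_def] o_def subset_iff)
  show ?thesis
  proof (rule exI[of _ I], rule exI[of _ ch], rule exI[of _ lo], rule exI[of _ hi], rule exI[of _ K],
      rule exI[of _ "\<lambda>x y. \<beta> x y / B y"], unfold_locales)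
    show "C1_manifold (\<lambda>y. \<beta> x y / B y)" if "x \<in> I" for x
      unfolding C1_manifold_def
    proof
      fix c assume c: "c \<in> A"
      have "C1_on (codom_of c) (\<lambda>u. (\<beta> x \<circ> param c) u / (B \<circ> param c) u)"
      proof (rule C1_on_divide[OF _ C1B[OF c]])
        show "C1_on (codom_of c) (\<beta> x \<circ> param c)"
          using * I(1) that c unfolding C1_manifold_def by blast
        show "(B \<circ> param c) u \<noteq> 0" if "u \<in> codom_of c" for u
          using B[OF param_in_M[OF c that]] by simp
      qed
      then show "C1_on (codom_of c) ((\<lambda>y. \<beta> x y / B y) \<circ> param c)"
        by (simp add: o_def)
    qed
    show "\<beta> x y / B y \<ge> 0" if "x \<in> I" for x y
      using * I(1) that unfolding B_def by (intro divide_nonneg_nonneg sum_nonneg) auto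
    show "(\<Sum>x\<in>I. \<beta> x y / B y) = 1" if "y \<in> M" for y
      using B[OF that] by (simp add: sum_divide_distrib[symmetric] B_def)
  qed (use * I in auto)
qed

text \<open>Densities: the local expressions of measures on the manifold.\<close>

definition density where
  "density \<eta> \<longleftrightarrow> (\<forall>c\<in>A. \<forall>d\<in>A. \<forall>u\<in>overlap c d.
    \<eta> c u = det (matrix (\<lambda>v. pd v (transition c d) u)) * \<eta> d (transition c d u))"

definition piece where
  "piece cs i = coord (cs ! i) ` (dom_of (cs ! i) - (\<Union>j<i. dom_of (cs ! j)))"

lemma borel_coord_difference:
  assumes c: "c \<in> A" and X: "openin (top_of_set M) X" and Y: "openin (top_of_set M) Y"
  shows "coord c ` (dom_of c \<inter> (X - Y)) \<in> sets borel"
proof -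
  have "coord c ` (dom_of c \<inter> (X - Y)) = coord c ` (dom_of c \<inter> X) - coord c ` (dom_of c \<inter> Y)"
    using inj_coord[OF c] unfolding inj_on_def by fast
  then show ?thesis
    using open_coord_image[OF c X] open_coord_image[OF c Y] by (simp add: borel_open sets.Diff)
qed

lemma openin_doms: "set cs \<subseteq> A \<Longrightarrow> i \<le> length cs \<Longrightarrow> openin (top_of_set M) (\<Union>j<i. dom_of (cs ! j))"
  by (intro openin_Union) (auto intro!: dom_openin)

lemma piece_borel:
  assumes "set cs \<subseteq> A" "i < length cs"
  shows "piece cs i \<in> sets borel"
proof -
  have c: "cs ! i \<in> A" using assms nth_mem by blast
  have "piece cs i = coord (cs ! i) ` (dom_of (cs ! i) \<inter> (dom_of (cs ! i) - (\<Union>j<i. dom_of (cs ! j))))"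
    unfolding piece_def by (rule arg_cong[where f = "(`) _"]) blast
  then show ?thesis
    using borel_coord_difference[OF c dom_openin[OF c] openin_doms[of cs i]] assms by simp
qed

lemma piece_subset: "piece cs i \<subseteq> codom_of (cs ! i)"
  by (auto simp: piece_def codom_of_def)

text \<open>Transition maps carry the pieces into the chart \<open>c\<close>, where their images
  partition \<open>codom_of c\<close>. Transition determinants are positive, so the law of a density
  is exactly the change of variables formula. Thus the cut pieces in the definition of area are
  traded for one box.\<close>

lemma density_integral:
  assumes cs: "chart_cover M A cs" and \<eta>: "density \<eta>" and c: "c \<in> A"
    and box: "cbox a b \<subseteq> codom_of c" and K: "K \<subseteq> cbox a b"
    and supp: "\<And>d u. d \<in> A \<Longrightarrow> u \<in> codom_of d \<Longrightarrow> param d u \<notin> param c ` K \<Longrightarrow> \<eta> d u = 0"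
    and cont: "continuous_on (cbox a b) (\<eta> c)"
  shows "\<And>i. i < length cs \<Longrightarrow> \<eta> (cs ! i) absolutely_integrable_on piece cs i"
    and "(\<Sum>i<length cs. integral (piece cs i) (\<eta> (cs ! i))) = integral (cbox a b) (\<eta> c)"
proof -
  have csA: "cs ! i \<in> A" if "i < length cs" for i
    using cs that by (auto simp: chart_cover_def)
  have sub: "set cs \<subseteq> A" using cs by (simp add: chart_cover_def)
  define E where "E i = dom_of (cs ! i) - (\<Union>j<i. dom_of (cs ! j))" for i
  \<comment> \<open>\<open>R i\<close> and \<open>T i\<close> are the same points, those of piece
    \<open>i\<close> in the domain of \<open>c\<close>, seen in the charts \<open>c\<close> and
    \<open>cs ! i\<close>.\<close>
  define R where "R i = coord c ` (dom_of c \<inter> E i)" for i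
  define T where "T i = coord (cs ! i) ` (dom_of (cs ! i) \<inter> (E i \<inter> dom_of c))" for i
  have R: "R i \<in> sets borel" if "i < length cs" for i
    unfolding R_def E_def
    by (rule borel_coord_difference[OF c dom_openin openin_doms]) (use csA sub that in auto)
  have T: "T i \<in> sets borel" if "i < length cs" for i
  proof -
    have "E i \<inter> dom_of c = (dom_of (cs ! i) \<inter> dom_of c) - (\<Union>j<i. dom_of (cs ! j))"
      by (auto simp: E_def)
    then show ?thesis
      unfolding T_def using that csA sub c
      by (auto intro!: borel_coord_difference openin_Int dom_openin openin_doms)
  qed
  have TR: "transition (cs ! i) c ` T i = R i" if "i < length cs" for i
    unfolding T_def R_def transition_def E_def image_comp[symmetric]
    using param_coord[OF csA[OF that]] by (auto simp: image_iff)
  have T_ov: "T i \<subseteq> overlap (cs ! i) c" for i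
    by (auto simp: T_def overlap_def)
  have T_piece: "T i \<subseteq> piece cs i" for i
    by (auto simp: T_def piece_def E_def)
  have inj: "inj_on (transition (cs ! i) c) (T i)" if "i < length cs" for i
  proof (rule inj_onI)
    fix u v assume uv: "u \<in> T i" "v \<in> T i" "transition (cs ! i) c u = transition (cs ! i) c v"
    then have "param (cs ! i) u = param (cs ! i) v"
      using param_transition[OF csA[OF that] c] T_ov by (metis subsetD)
    then show "u = v"
      using coord_param[OF csA[OF that]] uv piece_subset T_piece by (metis subsetD)
  qed
  have zero: "\<eta> (cs ! i) u = 0" if i: "i < length cs" and u: "u \<in> piece cs i - T i" for i u
  proof (rule supp[OF csA[OF i]])
    obtain y where y: "u = coord (cs ! i) y" "y \<in> E i" "y \<in> dom_of (cs ! i)"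
      using u by (auto simp: piece_def E_def)
    then have "y \<notin> dom_of c" using u by (auto simp: T_def)
    moreover have "param c ` K \<subseteq> dom_of c"
      using K box param_in[OF c] by blast
    moreover have "param (cs ! i) u = y"
      using y param_coord csA i by blast
    ultimately show "param (cs ! i) u \<notin> param c ` K" by blast
  qed (use u piece_subset in blast)
  have zero': "\<eta> c u = 0" if u: "u \<in> codom_of c - cbox a b" for u
  proof (rule supp[OF c])
    show "param c u \<notin> param c ` K"
    proof
      assume "param c u \<in> param c ` K"
      then obtain k where "k \<in> K" "param c u = param c k" by blast
      then have "u = k"
        using u K box coord_param[OF c, of u] coord_param[OF c, of k] by auto
      then show False using u K \<open>k \<in> K\<close> by blast
    qed
  qed (use u in blast)
  have int_c: "\<eta> c absolutely_integrable_on codom_of c"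
  proof -
    have "\<eta> c absolutely_integrable_on cbox a b"
      by (rule absolutely_integrable_continuous[OF cont])
    then show ?thesis
      by (rule absolutely_integrable_eq_on_support[THEN iffD1, rotated 2]) (use zero' box in blast)+
  qed
  have R_sub: "R i \<subseteq> codom_of c" for i
    by (auto simp: R_def codom_of_def)
  have int_R: "\<eta> c absolutely_integrable_on R i" if "i < length cs" for i
    by (rule set_integrable_subset[OF int_c _ R_sub]) (use R[OF that] in auto)
  have piece_int: "\<eta> (cs ! i) absolutely_integrable_on piece cs i \<and>
      integral (piece cs i) (\<eta> (cs ! i)) = integral (R i) (\<eta> c)" if i: "i < length cs" for i
  proof -
    let ?g = "transition (cs ! i) c"
    have "(\<lambda>u. \<bar>det (matrix (\<lambda>v. pd v ?g u))\<bar> * \<eta> c (?g u)) absolutely_integrable_on T i \<and>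
        integral (T i) (\<lambda>u. \<bar>det (matrix (\<lambda>v. pd v ?g u))\<bar> * \<eta> c (?g u)) = integral (R i) (\<eta> c)"
    proof (subst has_absolute_integral_change_of_variables_finite)
      show "(?g has_derivative (\<lambda>v. pd v ?g u)) (at u within T i)" if "u \<in> T i" for u
        using transition_derivative[OF csA[OF i] c] T_ov that has_derivative_at_withinI by blast
    qed (use T[OF i] inj[OF i] int_R[OF i] in \<open>simp_all add: TR[OF i]\<close>)
    moreover have eq: "\<bar>det (matrix (\<lambda>v. pd v ?g u))\<bar> * \<eta> c (?g u) = \<eta> (cs ! i) u" if "u \<in> T i" for u
    proof -
      have u: "u \<in> overlap (cs ! i) c" using that T_ov by blast
      then have "\<eta> (cs ! i) u = det (matrix (\<lambda>v. pd v ?g u)) * \<eta> c (?g u)"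
        using \<eta> csA[OF i] c unfolding density_def by blast
      then show ?thesis
        using det_transition_pos[OF csA[OF i] c u] by simp
    qed
    ultimately have "\<eta> (cs ! i) absolutely_integrable_on T i \<and> integral (T i) (\<eta> (cs ! i)) = integral (R i) (\<eta> c)"
      using set_integrable_cong[OF refl refl, of "T i" "\<lambda>u. \<bar>det (matrix (\<lambda>v. pd v ?g u))\<bar> * \<eta> c (?g u)" "\<eta> (cs ! i)" lebesgue]
        integral_cong[of "T i" "\<lambda>u. \<bar>det (matrix (\<lambda>v. pd v ?g u))\<bar> * \<eta> c (?g u)" "\<eta> (cs ! i)"] eq
      by simp
    moreover have "\<eta> (cs ! i) u = 0" if "u \<in> T i - piece cs i" for u
      using that T_piece by blast
    ultimately show ?thesis
      using absolutely_integrable_eq_on_support[of "T i" "piece cs i" "\<eta> (cs ! i)"]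
        integral_eq_on_support[of "T i" "piece cs i" "\<eta> (cs ! i)"] zero[OF i] by metis
  qed
  then show "\<eta> (cs ! i) absolutely_integrable_on piece cs i" if "i < length cs" for i
    using that by blast
  have "(\<Sum>i<length cs. integral (piece cs i) (\<eta> (cs ! i))) = (\<Sum>i<length cs. integral (R i) (\<eta> c))"
    using piece_int by simp
  also have "\<dots> = (\<Sum>i<length cs. integral UNIV (\<lambda>x. if x \<in> R i then \<eta> c x else 0))"
    by (simp add: integral_restrict_UNIV)
  also have "\<dots> = integral UNIV (\<lambda>x. \<Sum>i<length cs. if x \<in> R i then \<eta> c x else 0)"
    using int_R by (intro integral_sum[symmetric])
      (auto simp: integrable_restrict_UNIV dest: absolutely_integrable_on_def[THEN iffD1])
  also have "(\<lambda>x. \<Sum>i<length cs. if x \<in> R i then \<eta> c x else 0) = (\<lambda>x. if x \<in> codom_of c then \<eta> c x else 0)"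
  proof
    fix x
    show "(\<Sum>i<length cs. if x \<in> R i then \<eta> c x else 0) = (if x \<in> codom_of c then \<eta> c x else 0)"
    proof (cases "x \<in> codom_of c")
      case False
      then have "x \<notin> R i" for i using R_sub by blast
      then show ?thesis using False by simp
    next
      case True
      let ?y = "param c x"
      have y: "?y \<in> dom_of c" "?y \<in> M" using True c param_in param_in_M by auto
      have xR: "x \<in> R i \<longleftrightarrow> ?y \<in> E i" for i
        unfolding R_def using y True coord_param[OF c True] param_coord[OF c] by (auto intro: rev_image_eqI)
      have "\<exists>i. i < length cs \<and> ?y \<in> dom_of (cs ! i)"
      proof -
        obtain d where "d \<in> set cs" "?y \<in> dom_of d"
          using cs y(2) unfolding chart_cover_def by blast
        then show ?thesis by (metis in_set_conv_nth)
      qed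
      \<comment> \<open>The first chart of the list containing the point; its piece is the only one
        that contains it.\<close>
      then obtain k where k: "k < length cs" "?y \<in> dom_of (cs ! k)" "\<And>j. j < k \<Longrightarrow> \<not> (j < length cs \<and> ?y \<in> dom_of (cs ! j))"
        using exists_least_iff[of "\<lambda>i. i < length cs \<and> ?y \<in> dom_of (cs ! i)"] by auto
      have "?y \<in> E i \<longleftrightarrow> i = k" if "i < length cs" for i
        using k that unfolding E_def by (metis (no_types, lifting) DiffI DiffD1 DiffD2 UN_iff lessThan_iff less_trans linorder_neqE_nat)
      then have "(\<Sum>i<length cs. if x \<in> R i then \<eta> c x else 0) = (\<Sum>i<length cs. if i = k then \<eta> c x else 0)"
        by (intro sum.cong) (auto simp: xR)
      then show ?thesis using k True by simp
    qed
  qed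
  also have "integral UNIV \<dots> = integral (codom_of c) (\<eta> c)"
    by (rule integral_restrict_UNIV)
  also have "\<dots> = integral (cbox a b) (\<eta> c)"
    by (rule integral_eq_on_support) (use zero' box in blast)+
  finally show "(\<Sum>i<length cs. integral (piece cs i) (\<eta> (cs ! i))) = integral (cbox a b) (\<eta> c)" .
qed

end

section \<open>Linear algebra of frames with a normal\<close>

lemma linear_axis_expansion:
  fixes f :: "real ^ 'm::finite \<Rightarrow> 'v::real_vector"
  assumes "linear f"
  shows "f v = (\<Sum>k\<in>UNIV. v $ k *\<^sub>R f (axis k 1))"
proof -
  have "v = (\<Sum>k\<in>UNIV. v $ k *\<^sub>R axis k 1)"
    using basis_expansion[of v] by (simp add: scalar_mult_eq_scaleR)
  then have "f v = f (\<Sum>k\<in>UNIV. v $ k *\<^sub>R axis k 1)"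
    by (rule arg_cong)
  then show ?thesis
    by (simp only: linear_sum[OF assms] linear_scale[OF assms])
qed

text \<open>The change of frame is a block matrix, \<open>T\<close> on the tangents and 1 on the
  normal; the transpose arises because the vectors are rows.\<close>

lemma vdet_change_basis:
  fixes T :: "real ^ 'm ^ 'm" and p p' :: "'m::finite option \<Rightarrow> real ^ 'm option"
  assumes "p None = p' None" "\<And>k. p (Some k) = (\<Sum>l\<in>UNIV. T $ l $ k *\<^sub>R p' (Some l))"
  shows "vdet p = det T * vdet p'"
proof -
  have "p i $ j = (extend_matrix Some (transpose T) ** (\<chi> i. p' i)) $ i $ j" for i j
    using assms by (cases i) (simp_all add: matrix_matrix_mult_def sum_UNIV_option transpose_def)
  then have "(\<chi> i. p i) = extend_matrix Some (transpose T) ** (\<chi> i. p' i)"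
    by (simp add: vec_eq_iff)
  then show ?thesis
    by (simp add: vdet_def det_mul det_extend_matrix)
qed

text \<open>The Gram matrix of the whole frame is that of the tangents bordered by 1, and its
  determinant is the square of \<open>vdet p\<close>.\<close>

lemma det_gram_normal:
  fixes p :: "'m::finite option \<Rightarrow> real ^ 'm option"
  assumes "p None \<bullet> p None = 1" "\<And>k. p None \<bullet> p (Some k) = 0"
  shows "det (\<chi> i j. p (Some i) \<bullet> p (Some j)) = (vdet p)\<^sup>2"
proof -
  let ?B = "\<chi> i j. p (Some i) \<bullet> p (Some j)"
  have p: "p (Some k) \<bullet> p None = 0" for k
    using assms(2)[of k] by (metis inner_commute)
  have "(\<chi> i j. p i \<bullet> p j) $ i $ j = extend_matrix Some ?B $ i $ j" for i j
    by (cases i; cases j) (simp_all add: assms p)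
  then have "(\<chi> i. \<chi> j. p i \<bullet> p j) = extend_matrix Some ?B"
    unfolding vec_eq_iff by blast
  then have "vdet (\<lambda>i. \<chi> j. p i \<bullet> p j) = det ?B"
    by (simp add: vdet_def det_extend_matrix)
  then show ?thesis
    by (simp add: vdet_gram[symmetric] power2_eq_square)
qed

lemma nonzero_sign_constant:
  fixes f :: "'b::topological_space \<Rightarrow> real"
  assumes "connected S" "continuous_on S f" "\<And>x. x \<in> S \<Longrightarrow> f x \<noteq> 0"
  obtains \<sigma> where "\<forall>x\<in>S. sgn (f x) = \<sigma>"
proof -
  have "sgn (f x) = sgn (f y)" if "x \<in> S" "y \<in> S" "f x \<le> f y" for x y
  proof (rule ccontr)
    assume ne: "sgn (f x) \<noteq> sgn (f y)"
    have "f x < 0 \<and> 0 < f y"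
      using ne assms(3)[OF that(1)] assms(3)[OF that(2)] that(3) by (auto simp: sgn_if split: if_splits)
    then have "0 \<in> {f x..f y}" by simp
    then have "0 \<in> f ` S"
      using connected_contains_Icc[OF connected_continuous_image[OF assms(2,1)]] that by blast
    then show False using assms(3) by auto
  qed
  then have "sgn (f x) = sgn (f y)" if "x \<in> S" "y \<in> S" for x y
    using that by (metis linear)
  then show ?thesis
    using that by blast
qed

section \<open>Time-dependent maps in charts\<close>

context compact_atlas
begin

lemma family_slice:
  assumes f: "smooth_family A f" and c: "c \<in> A" and t: "t \<in> {0..1}"
  shows "smooth_on (codom_of c) (f t \<circ> param c)"
proof -
  have "smooth_on ({0..1} \<times> codom_of c) (\<lambda>(t, u). f t (param c u))"
    using f c by (simp add: smooth_family_def)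
  then show ?thesis
    using Ck_on_slice[of _ "{0..1}" "codom_of c" "\<lambda>(t, u). f t (param c u)" t] t
    by (simp add: smooth_on_def o_def)
qed

lemma family_has_derivative:
  assumes "smooth_family A f" "c \<in> A" "t \<in> {0..1}" "u \<in> codom_of c"
  shows "((f t \<circ> param c) has_derivative differential c (f t) u) (at u)"
  using smooth_on_has_derivative[OF open_codom family_slice] assms
  unfolding differential_def pd_def by blast

lemma family_continuous:
  assumes "smooth_family A f" "c \<in> A"
  shows "continuous_on ({0..1} \<times> codom_of c) (\<lambda>(t, u). f t (param c u))"
  using assms smooth_on_imp_continuous_on unfolding smooth_family_def by blast

lemma family_slice_derivative:
  assumes c: "c \<in> A" and t: "t \<in> T" and u: "u \<in> codom_of c"
    and F: "((\<lambda>(t, u). f t (param c u)) has_derivative F') (at (t, u) within T \<times> codom_of c)"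
  shows "differential c (f t) u v = F' (0, v)"
proof -
  have "((\<lambda>u. (t, u)) has_derivative (\<lambda>v. (0, v))) (at u within codom_of c)"
    by (auto intro!: derivative_eq_intros)
  moreover have "((\<lambda>(t, u). f t (param c u)) has_derivative F') (at (t, u) within (\<lambda>u. (t, u)) ` codom_of c)"
    by (rule has_derivative_subset[OF F]) (use t in auto)
  ultimately have "((\<lambda>(t, u). f t (param c u)) \<circ> (\<lambda>u. (t, u)) has_derivative F' \<circ> (\<lambda>v. (0, v))) (at u within codom_of c)"
    by (rule diff_chain_within)
  then have "((f t \<circ> param c) has_derivative (\<lambda>v. F' (0, v))) (at u)"
    unfolding at_within_open[OF u open_codom[OF c]] o_def prod.case .
  then show ?thesis
    unfolding differential_def pd_def[symmetric] by (rule has_derivative_pd)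
qed

text \<open>Smoothness on the closed time interval uses derivatives within the product. In the
  directions \<open>(0, v)\<close> they are the differentials of the slices, which are therefore
  jointly continuous up to the end points.\<close>

lemma family_continuous_differential:
  assumes f: "smooth_family A f" and c: "c \<in> A"
  shows "continuous_on ({0..1} \<times> codom_of c) (\<lambda>(t, u). differential c (f t) u v)"
proof -
  have "Ck_on (Suc 0) ({0..1} \<times> codom_of c) (\<lambda>(t, u). f t (param c u))"
    using f c unfolding smooth_family_def smooth_on_def by blast
  then obtain F' where F: "\<forall>x\<in>{0..1} \<times> codom_of c. ((\<lambda>(t, u). f t (param c u)) has_derivative F' x) (at x within {0..1} \<times> codom_of c)"
      "\<forall>v. continuous_on ({0..1} \<times> codom_of c) (\<lambda>x. F' x v)"
    unfolding Ck_on.simps by blast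
  show ?thesis
  proof (rule continuous_on_eq[OF F(2)[rule_format, of "(0, v)"]])
    fix x :: "real \<times> (real ^ 'm)" assume x: "x \<in> {0..1} \<times> codom_of c"
    obtain t u where tu: "x = (t, u)" by fastforce
    have "differential c (f t) u v = F' x (0, v)"
      by (rule family_slice_derivative[OF c, of t "{0..1}"]) (use x F(1) tu in auto)
    then show "F' x (0, v) = (case x of (t, u) \<Rightarrow> differential c (f t) u v)"
      by (simp add: tu)
  qed
qed

lemma family_pd:
  assumes f: "smooth_family A f" and c: "c \<in> A" and t: "t \<in> {0<..<1}" and u: "u \<in> codom_of c"
  shows "pd (0, v) (\<lambda>(t, u). f t (param c u)) (t, u) = differential c (f t) u v"
proof -
  have op: "open ({0<..<1::real} \<times> codom_of c)"
    by (intro open_Times open_codom c open_greaterThanLessThan)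
  have "smooth_on ({0<..<1} \<times> codom_of c) (\<lambda>(t, u). f t (param c u))"
    by (rule smooth_on_subset[of "{0..1} \<times> codom_of c"]) (use f c in \<open>auto simp: smooth_family_def\<close>)
  from smooth_on_has_derivative[OF op this, of "(t, u)"]
  have "((\<lambda>(t, u). f t (param c u)) has_derivative (\<lambda>v. pd v (\<lambda>(t, u). f t (param c u)) (t, u))) (at (t, u))"
    using t u by blast
  from family_slice_derivative[OF c t u has_derivative_at_withinI[OF this], of v] show ?thesis ..
qed

lemma differential_transition:
  assumes f: "smooth_family A f" and cd: "c \<in> A" "d \<in> A" and t: "t \<in> {0..1}" and u: "u \<in> overlap c d"
  shows "differential c (f t) u v = differential d (f t) (transition c d u) (pd v (transition c d) u)"
  using transition_derivative_chain[OF cd u family_has_derivative[OF f cd(2) t transition_in[OF cd u]]]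
  unfolding differential_def pd_def[symmetric] by (rule has_derivative_pd)

end

section \<open>Area as a sum of integrals over boxes\<close>

context atlas_partition
begin

lemma K_cbox: "x \<in> I \<Longrightarrow> K x \<subseteq> cbox (lo x) (hi x)"
  using K_box box_subset_cbox by blast

lemma C1_\<psi>_param: "x \<in> I \<Longrightarrow> c \<in> A \<Longrightarrow> C1_on (codom_of c) (\<lambda>u. \<psi> x (param c u))"
  using C1_\<psi> unfolding C1_manifold_def o_def by blast

text \<open>The partition functions are inserted under the integral over each piece; summed over the
  pieces, each summand then becomes one box integral. Nonnegativity permits the passage between
  extended nonnegative and real integrals.\<close>

lemma area_partition:
  fixes f :: "'a \<Rightarrow> 'v::real_inner"
  assumes \<rho>: "density \<rho>" "\<And>c. c \<in> A \<Longrightarrow> continuous_on (codom_of c) (\<rho> c)"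
    and nonneg: "\<And>c u. \<rho> c u \<ge> 0"
    and f: "\<And>c u. c \<in> A \<Longrightarrow> u \<in> codom_of c \<Longrightarrow> area_density c f u = \<rho> c u"
  shows "area M A f = ennreal (\<Sum>x\<in>I. integral (cbox (lo x) (hi x)) (\<lambda>u. \<psi> x (param (ch x) u) * \<rho> (ch x) u))"
proof -
  define cs where "cs = (SOME cs. chart_cover M A cs)"
  have cs: "chart_cover M A cs"
    unfolding cs_def by (rule someI_ex[OF chart_cover_exists[OF compact_M atlas]])
  have sub: "set cs \<subseteq> A" using cs by (simp add: chart_cover_def)
  have csA: "cs ! i \<in> A" if "i < length cs" for i
    using sub that nth_mem by blast
  define \<eta> where "\<eta> x c u = \<psi> x (param c u) * \<rho> c u" for x c u
  have cont: "continuous_on (codom_of c) (\<eta> x c)" if "x \<in> I" "c \<in> A" for x c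
    unfolding \<eta>_def using that by (intro continuous_on_mult C1_on_continuous C1_\<psi>_param \<rho>)
  have dens: "density (\<eta> x)" for x
    unfolding density_def
  proof (intro ballI)
    fix c d u assume cd: "c \<in> A" "d \<in> A" and u: "u \<in> overlap c d"
    have "\<rho> c u = det (matrix (\<lambda>v. pd v (transition c d) u)) * \<rho> d (transition c d u)"
      using \<rho>(1) cd u unfolding density_def by blast
    then show "\<eta> x c u = det (matrix (\<lambda>v. pd v (transition c d) u)) * \<eta> x d (transition c d u)"
      by (simp add: \<eta>_def param_transition[OF cd u])
  qed
  have supp: "\<eta> x d u = 0" if "x \<in> I" "param d u \<notin> param (ch x) ` K x" for x d u
    using \<psi>_support[OF that(1), of "param d u"] that(2) by (auto simp: \<eta>_def)
  have \<eta>_nonneg: "\<eta> x c u \<ge> 0" if "x \<in> I" for x c u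
    using \<psi>_nonneg[OF that] nonneg by (simp add: \<eta>_def)
  have int: "\<eta> x (cs ! i) absolutely_integrable_on piece cs i"
      "(\<Sum>i<length cs. integral (piece cs i) (\<eta> x (cs ! i))) = integral (cbox (lo x) (hi x)) (\<eta> x (ch x))"
    if "x \<in> I" "i < length cs" for x i
    using density_integral[OF cs dens ch box_codom K_cbox supp continuous_on_subset[OF cont box_codom]] that ch
    by blast+
  have "area M A f = (\<Sum>i<length cs. \<integral>\<^sup>+u \<in> piece cs i. ennreal (area_density (cs ! i) f u) \<partial>lborel)"
    unfolding area_def Let_def cs_def[symmetric] piece_def ..
  also have "\<dots> = (\<Sum>i<length cs. \<Sum>x\<in>I. \<integral>\<^sup>+u \<in> piece cs i. ennreal (\<eta> x (cs ! i) u) \<partial>lborel)"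
  proof (rule sum.cong[OF refl])
    fix i assume "i \<in> {..<length cs}"
    then have i: "i < length cs" by simp
    have "(\<integral>\<^sup>+u \<in> piece cs i. ennreal (area_density (cs ! i) f u) \<partial>lborel) =
        (\<integral>\<^sup>+u. (\<Sum>x\<in>I. ennreal (\<eta> x (cs ! i) u) * indicator (piece cs i) u) \<partial>lborel)"
    proof (rule nn_integral_cong)
      fix u
      show "ennreal (area_density (cs ! i) f u) * indicator (piece cs i) u =
          (\<Sum>x\<in>I. ennreal (\<eta> x (cs ! i) u) * indicator (piece cs i) u)"
      proof (cases "u \<in> piece cs i")
        case True
        then have u: "u \<in> codom_of (cs ! i)" using piece_subset by blast
        have "(\<Sum>x\<in>I. \<eta> x (cs ! i) u) = \<rho> (cs ! i) u"
          using \<psi>_sum[OF param_in_M[OF csA[OF i] u]] by (simp add: \<eta>_def sum_distrib_right[symmetric])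
        then show ?thesis
          using True \<eta>_nonneg by (simp add: f[OF csA[OF i] u] sum_ennreal)
      qed simp
    qed
    also have "\<dots> = (\<Sum>x\<in>I. \<integral>\<^sup>+u. ennreal (\<eta> x (cs ! i) u) * indicator (piece cs i) u \<partial>lborel)"
    proof (rule nn_integral_sum)
      fix x assume x: "x \<in> I"
      have "(\<lambda>u. indicator (piece cs i) u *\<^sub>R \<eta> x (cs ! i) u) \<in> borel_measurable borel"
        by (intro borel_measurable_continuous_on_indicator piece_borel sub i
            continuous_on_subset[OF cont[OF x csA[OF i]]] piece_subset)
      then have "(\<lambda>u. ennreal (indicator (piece cs i) u *\<^sub>R \<eta> x (cs ! i) u)) \<in> borel_measurable lborel"
        by simp
      also have "(\<lambda>u. ennreal (indicator (piece cs i) u *\<^sub>R \<eta> x (cs ! i) u)) =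
          (\<lambda>u. ennreal (\<eta> x (cs ! i) u) * indicator (piece cs i) u)"
        by (auto simp: indicator_def)
      finally show "(\<lambda>u. ennreal (\<eta> x (cs ! i) u) * indicator (piece cs i) u) \<in> borel_measurable lborel" .
    qed
    finally show "(\<integral>\<^sup>+u \<in> piece cs i. ennreal (area_density (cs ! i) f u) \<partial>lborel) =
        (\<Sum>x\<in>I. \<integral>\<^sup>+u \<in> piece cs i. ennreal (\<eta> x (cs ! i) u) \<partial>lborel)" .
  qed
  also have "\<dots> = (\<Sum>i<length cs. \<Sum>x\<in>I. ennreal (integral (piece cs i) (\<eta> x (cs ! i))))"
  proof (intro sum.cong refl)
    fix i x assume "i \<in> {..<length cs}" "x \<in> I"
    then have "(\<eta> x (cs ! i) has_integral integral (piece cs i) (\<eta> x (cs ! i))) (piece cs i)"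
      using int(1) by (simp add: set_lebesgue_integral_eq_integral(1) integrable_integral)
    then show "(\<integral>\<^sup>+u \<in> piece cs i. ennreal (\<eta> x (cs ! i) u) \<partial>lborel) = ennreal (integral (piece cs i) (\<eta> x (cs ! i)))"
      by (rule nn_integral_has_integral_lebesgue'[rotated]) (use \<eta>_nonneg \<open>x \<in> I\<close> in blast)
  qed
  also have "\<dots> = ennreal (\<Sum>i<length cs. \<Sum>x\<in>I. integral (piece cs i) (\<eta> x (cs ! i)))"
  proof -
    have "integral (piece cs i) (\<eta> x (cs ! i)) \<ge> 0" if "x \<in> I" "i < length cs" for i x
      using int(1)[OF that] \<eta>_nonneg[OF that(1)]
      by (intro integral_nonneg) (auto dest: set_lebesgue_integral_eq_integral(1))
    then show ?thesis
      by (subst sum_ennreal[symmetric]) (auto intro!: sum_nonneg sum.cong sum_ennreal)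
  qed
  also have "(\<Sum>i<length cs. \<Sum>x\<in>I. integral (piece cs i) (\<eta> x (cs ! i))) =
      (\<Sum>x\<in>I. integral (cbox (lo x) (hi x)) (\<eta> x (ch x)))"
  \<comment> \<open>The sum formula in \<open>int\<close> is available only together with an index
    \<open>i\<close>, so the empty cover is treated apart: then \<open>M\<close>, and with it every
    box, is empty.\<close>
  proof (cases "length cs = 0")
    case True
    then have "M = {}" using cs by (simp add: chart_cover_def)
    have "integral (cbox (lo x) (hi x)) (\<eta> x (ch x)) = 0" if "x \<in> I" for x
    proof -
      have "codom_of (ch x) = {}"
        using \<open>M = {}\<close> dom_subset[OF ch[OF that]] by (auto simp: codom_of_def)
      then show ?thesis using box_codom[OF that] by simp
    qed
    then show ?thesis using True by simp
  next
    case False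
    then show ?thesis
      by (subst sum.swap) (intro sum.cong refl, use int(2) in blast)
  qed
  finally show ?thesis by (simp add: \<eta>_def[abs_def])
qed

text \<open>In the application, \<open>\<eta> x\<close> is the derivative of \<open>\<psi> x\<close> along a vector field not depending on
  \<open>x\<close>, times a density; the sum vanishes because the \<open>\<psi> x\<close> add up to a constant.\<close>

lemma density_sum_zero:
  assumes \<eta>: "\<And>x. x \<in> I \<Longrightarrow> density (\<eta> x)"
    and cont: "\<And>x. x \<in> I \<Longrightarrow> continuous_on (cbox (lo x) (hi x)) (\<eta> x (ch x))"
    and supp: "\<And>x d u. x \<in> I \<Longrightarrow> d \<in> A \<Longrightarrow> u \<in> codom_of d \<Longrightarrow> param d u \<notin> param (ch x) ` K x \<Longrightarrow> \<eta> x d u = 0"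
    and zero: "\<And>c u. c \<in> A \<Longrightarrow> u \<in> codom_of c \<Longrightarrow> (\<Sum>x\<in>I. \<eta> x c u) = 0"
  shows "(\<Sum>x\<in>I. integral (cbox (lo x) (hi x)) (\<eta> x (ch x))) = 0"
proof -
  obtain cs where cs: "chart_cover M A cs"
    using chart_cover_exists[OF compact_M atlas] by blast
  have csA: "cs ! i \<in> A" if "i < length cs" for i
    using cs that nth_mem by (auto simp: chart_cover_def)
  note int = density_integral[OF cs \<eta> ch box_codom K_cbox supp cont]
  have "(\<Sum>x\<in>I. integral (cbox (lo x) (hi x)) (\<eta> x (ch x))) =
      (\<Sum>x\<in>I. \<Sum>i<length cs. integral (piece cs i) (\<eta> x (cs ! i)))"
    by (intro sum.cong refl int(2)[symmetric])
  also have "\<dots> = (\<Sum>i<length cs. \<Sum>x\<in>I. integral (piece cs i) (\<eta> x (cs ! i)))"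
    by (rule sum.swap)
  \<comment> \<open>The boxes depend on \<open>x\<close> but the pieces do not, so now the sum over
    \<open>x\<close> can go under the integral.\<close>
  also have "\<dots> = (\<Sum>i<length cs. integral (piece cs i) (\<lambda>u. \<Sum>x\<in>I. \<eta> x (cs ! i) u))"
  proof (intro sum.cong refl integral_sum[symmetric] finite_I)
    fix i x assume "i \<in> {..<length cs}" "x \<in> I"
    then show "\<eta> x (cs ! i) integrable_on piece cs i"
      using int(1) by (blast intro: set_lebesgue_integral_eq_integral(1))
  qed
  also have "\<dots> = (\<Sum>i<length cs. integral (piece cs i) (\<lambda>u. 0))"
    by (intro sum.cong refl integral_cong zero csA) (use piece_subset in blast)+
  finally show ?thesis by simp
qed

end

section \<open>Parallel hypersurfaces of a bending\<close>

locale bent_hypersurface = compact_atlas M A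
  for M :: "'a::t2_space set" and A :: "('a, 'm::finite) chart set" +
  fixes \<phi> n :: "real \<Rightarrow> 'a \<Rightarrow> real ^ 'm option"
  assumes bend: "bending A \<phi>" and normal: "oriented_unit_normal A \<phi> n"
begin

lemma fam_\<phi>: "smooth_family A \<phi>" and fam_n: "smooth_family A n"
  using bend normal by (simp_all add: bending_def oriented_unit_normal_def)

definition P where "P c = (\<lambda>(t, u). \<phi> t (param c u))"
definition N where "N c = (\<lambda>(t, u). n t (param c u))"

text \<open>Expressed through \<open>differential\<close>, so that it is meaningful at the times 0
  and 1 as well; at interior times it is the frame \<open>q\<close> of the chart.\<close>

definition frame where
  "frame c t u i = (case i of None \<Rightarrow> n t (param c u) | Some k \<Rightarrow> differential c (\<phi> t) u (axis k 1))"

definition normal_frame where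
  "normal_frame c t u i = (case i of None \<Rightarrow> 0 | Some k \<Rightarrow> differential c (n t) u (axis k 1))"

text \<open>The signed area density of the parallel hypersurface, polynomial in the frame vectors
  and thus differentiable where its absolute value need not be.\<close>

definition D where "D \<epsilon> c t u = vdet (\<lambda>i. frame c t u i + \<epsilon> *\<^sub>R normal_frame c t u i)"

lemma frame_simps [simp]:
  "frame c t u None = n t (param c u)" "frame c t u (Some k) = differential c (\<phi> t) u (axis k 1)"
  "normal_frame c t u None = 0" "normal_frame c t u (Some k) = differential c (n t) u (axis k 1)"
  by (simp_all add: frame_def normal_frame_def)

lemma
  assumes "c \<in> A" "t \<in> {0..1}" "u \<in> codom_of c"
  shows norm_n: "norm (n t (param c u)) = 1"
    and n_normal: "n t (param c u) \<bullet> differential c (\<phi> t) u v = 0"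
    and vdet_frame_pos: "vdet (frame c t u) > 0"
proof -
  have "norm (n t (param c u)) = 1 \<and> (\<forall>v. n t (param c u) \<bullet> differential c (\<phi> t) u v = 0) \<and>
      det (\<chi> i j. (case j of None \<Rightarrow> n t (param c u) $ i
                          | Some k \<Rightarrow> differential c (\<phi> t) u (axis k 1) $ i)) > 0"
    using normal assms unfolding oriented_unit_normal_def by blast
  \<comment> \<open>The orientation condition has the frame vectors as columns, \<open>vdet\<close>
    as rows.\<close>
  moreover have "(\<chi> i j. (case j of None \<Rightarrow> n t (param c u) $ i
      | Some k \<Rightarrow> differential c (\<phi> t) u (axis k 1) $ i)) = transpose (\<chi> i. frame c t u i)"
    by (simp add: vec_eq_iff transpose_def frame_def split: option.splits)
  ultimately show "norm (n t (param c u)) = 1" "n t (param c u) \<bullet> differential c (\<phi> t) u v = 0"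
      "vdet (frame c t u) > 0"
    by (simp_all add: vdet_def)
qed

lemma dn_normal:
  assumes c: "c \<in> A" and t: "t \<in> {0..1}" and u: "u \<in> codom_of c"
  shows "differential c (n t) u v \<bullet> n t (param c u) = 0"
proof -
  have "((\<lambda>u. (n t \<circ> param c) u \<bullet> (n t \<circ> param c) u) has_derivative
      (\<lambda>v. (n t \<circ> param c) u \<bullet> differential c (n t) u v + differential c (n t) u v \<bullet> (n t \<circ> param c) u)) (at u)"
    by (intro has_derivative_inner family_has_derivative fam_n c t u)
  moreover have "((\<lambda>u. (n t \<circ> param c) u \<bullet> (n t \<circ> param c) u) has_derivative (\<lambda>v. 0)) (at u)"
  proof (rule has_derivative_transform_within_open[OF has_derivative_const open_codom[OF c] u])
    show "1 = (n t \<circ> param c) u \<bullet> (n t \<circ> param c) u" if "u \<in> codom_of c" for u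
      using norm_n[OF c t that] by (simp add: power2_norm_eq_inner[symmetric])
  qed
  ultimately have "(\<lambda>v. (n t \<circ> param c) u \<bullet> differential c (n t) u v +
      differential c (n t) u v \<bullet> (n t \<circ> param c) u) = (\<lambda>v. 0)"
    by (rule has_derivative_unique)
  from fun_cong[OF this, of v] show ?thesis
    by (simp add: inner_commute)
qed

lemma parallel_has_derivative:
  assumes "c \<in> A" "t \<in> {0..1}" "u \<in> codom_of c"
  shows "((parallel_hypersurface \<phi> n \<epsilon> t \<circ> param c) has_derivative
    (\<lambda>v. differential c (\<phi> t) u v + \<epsilon> *\<^sub>R differential c (n t) u v)) (at u)"
proof -
  have "((\<lambda>u. (\<phi> t \<circ> param c) u + \<epsilon> *\<^sub>R (n t \<circ> param c) u) has_derivative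
      (\<lambda>v. differential c (\<phi> t) u v + \<epsilon> *\<^sub>R differential c (n t) u v)) (at u)"
    by (intro has_derivative_add has_derivative_scaleR_right family_has_derivative fam_\<phi> fam_n assms)
  then show ?thesis
    by (simp add: parallel_hypersurface_def[abs_def] o_def)
qed

lemma differential_parallel:
  assumes "c \<in> A" "t \<in> {0..1}" "u \<in> codom_of c"
  shows "differential c (parallel_hypersurface \<phi> n \<epsilon> t) u v =
    differential c (\<phi> t) u v + \<epsilon> *\<^sub>R differential c (n t) u v"
  using has_derivative_pd[OF parallel_has_derivative[OF assms]]
  by (simp add: differential_def pd_def)

lemma smooth_parallel:
  assumes "c \<in> A" "t \<in> {0..1}"
  shows "smooth_on (codom_of c) (parallel_hypersurface \<phi> n \<epsilon> t \<circ> param c)"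
  using family_slice[OF fam_\<phi> assms] family_slice[OF fam_n assms]
  unfolding smooth_on_def parallel_hypersurface_def[abs_def] o_def
  by (intro allI Ck_on_add Ck_on_scaleR) blast+

lemma parallel_frame:
  assumes "c \<in> A" "t \<in> {0..1}" "u \<in> codom_of c"
  shows "frame c t u (Some k) + \<epsilon> *\<^sub>R normal_frame c t u (Some k) =
    differential c (parallel_hypersurface \<phi> n \<epsilon> t) u (axis k 1)"
  by (simp add: differential_parallel[OF assms])

lemma n_normal_parallel:
  assumes "c \<in> A" "t \<in> {0..1}" "u \<in> codom_of c"
  shows "n t (param c u) \<bullet> differential c (parallel_hypersurface \<phi> n \<epsilon> t) u v = 0"
  using n_normal[OF assms] dn_normal[OF assms]
  by (simp add: differential_parallel[OF assms] inner_add_right inner_commute)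

text \<open>Derivatives of a unit normal are orthogonal to it, so \<open>n\<close> is also the unit
  normal of the parallel hypersurface and the Gram determinant of its tangents is the square of
  \<open>D\<close>.\<close>

lemma area_density_parallel:
  assumes "c \<in> A" "t \<in> {0..1}" "u \<in> codom_of c"
  shows "area_density c (parallel_hypersurface \<phi> n \<epsilon> t) u = \<bar>D \<epsilon> c t u\<bar>"
proof -
  let ?p = "\<lambda>i. frame c t u i + \<epsilon> *\<^sub>R normal_frame c t u i"
  have "det (\<chi> i j. ?p (Some i) \<bullet> ?p (Some j)) = (vdet ?p)\<^sup>2"
  proof (rule det_gram_normal)
    show "?p None \<bullet> ?p None = 1"
      using norm_n[OF assms] by (simp add: power2_norm_eq_inner[symmetric])
    show "?p None \<bullet> ?p (Some k) = 0" for k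
      unfolding parallel_frame[OF assms] by (simp add: n_normal_parallel[OF assms])
  qed
  then show ?thesis
    unfolding area_density_def induced_metric_def parallel_frame[OF assms] by (simp add: D_def)
qed

lemma linear_differential_parallel:
  assumes "c \<in> A" "t \<in> {0..1}" "u \<in> codom_of c"
  shows "linear (differential c (parallel_hypersurface \<phi> n \<epsilon> t) u)"
  using has_derivative_linear[OF parallel_has_derivative[OF assms]]
  by (simp add: differential_parallel[OF assms, abs_def])

text \<open>The tangent rows are orthogonal to \<open>n\<close>, so a linear relation between all
  rows has no normal part: the rows are dependent exactly when the tangents are.\<close>

lemma inj_differential_iff:
  assumes "c \<in> A" "t \<in> {0..1}" "u \<in> codom_of c"
  shows "inj (differential c (parallel_hypersurface \<phi> n \<epsilon> t) u) \<longleftrightarrow> D \<epsilon> c t u \<noteq> 0"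
proof
  let ?d = "differential c (parallel_hypersurface \<phi> n \<epsilon> t) u"
  let ?p = "\<lambda>i. frame c t u i + \<epsilon> *\<^sub>R normal_frame c t u i"
  note lin = linear_differential_parallel[OF assms]
  have d: "?d v = (\<Sum>k\<in>UNIV. v $ k *\<^sub>R ?p (Some k))" for v
    unfolding parallel_frame[OF assms] by (rule linear_axis_expansion[OF lin])
  have nn: "n t (param c u) \<bullet> n t (param c u) = 1"
    using norm_n[OF assms] by (simp add: power2_norm_eq_inner[symmetric])
  show "D \<epsilon> c t u \<noteq> 0" if inj: "inj ?d"
  proof
    assume "D \<epsilon> c t u = 0"
    then obtain x where x: "x \<noteq> 0" "(\<Sum>i\<in>UNIV. x $ i *\<^sub>R ?p i) = 0"
      unfolding D_def by (rule vdet_0_dependent)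
    define v where "v = (\<chi> k. x $ Some k)"
    have sum0: "x $ None *\<^sub>R n t (param c u) + ?d v = 0"
      using x(2) unfolding sum_UNIV_option d by (simp add: v_def)
    then have "n t (param c u) \<bullet> (x $ None *\<^sub>R n t (param c u) + ?d v) = 0"
      by simp
    then have x0: "x $ None = 0"
      using n_normal_parallel[OF assms, of \<epsilon> v] nn by (simp add: inner_add_right)
    then have "?d v = ?d 0"
      using sum0 linear_0[OF lin] by simp
    then have "v = 0" using inj by (simp add: inj_eq)
    then have "x $ i = 0" for i
      using x0 by (cases i) (simp_all add: v_def vec_eq_iff)
    then show False using x(1) by (simp add: vec_eq_iff)
  qed
  show "inj ?d" if D: "D \<epsilon> c t u \<noteq> 0"
    unfolding linear_injective_0[OF lin]
  proof (intro allI impI)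
    fix v assume v: "?d v = 0"
    show "v = 0"
    proof (rule ccontr)
      assume "v \<noteq> 0"
      then obtain k where k: "v $ k \<noteq> 0" by (auto simp: vec_eq_iff)
      have "v $ k * vdet ?p = vdet (?p(Some k := (\<Sum>i\<in>UNIV. (case i of None \<Rightarrow> 0 | Some k \<Rightarrow> v $ k) *\<^sub>R ?p i)))"
        by (subst vdet_cramer) simp
      also have "(\<Sum>i\<in>UNIV. (case i of None \<Rightarrow> 0 | Some k \<Rightarrow> v $ k) *\<^sub>R ?p i) = ?d v"
        unfolding d by (simp add: sum_UNIV_option)
      finally have "v $ k * vdet ?p = 0"
        unfolding v vdet_zero .
      then show False using k D by (simp add: D_def)
    qed
  qed
qed

lemma D_zero: "D 0 c t u = vdet (frame c t u)"
  by (simp add: D_def)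

text \<open>Position and normal are functions on \<open>M\<close>; only the coordinate tangents
  change, by the Jacobian of the transition. At \<open>\<epsilon> = 0\<close> this is the law for
  the frame volume.\<close>

lemma D_trans:
  assumes cd: "c \<in> A" "d \<in> A" and u: "u \<in> overlap c d" and t: "t \<in> {0..1}"
  shows "D \<epsilon> c t u = det (matrix (\<lambda>v. pd v (transition c d) u)) * D \<epsilon> d t (transition c d u)"
  unfolding D_def
proof (rule vdet_change_basis)
  let ?D = "\<lambda>v. pd v (transition c d) u" and ?d = "differential d (parallel_hypersurface \<phi> n \<epsilon> t) (transition c d u)"
  have u': "u \<in> codom_of c" using u cd by (simp add: overlap_iff)
  note tu = transition_in[OF cd u]
  fix k
  have "differential c (parallel_hypersurface \<phi> n \<epsilon> t) u (axis k 1) = ?d (?D (axis k 1))"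
    using differential_transition[OF fam_\<phi> cd t u] differential_transition[OF fam_n cd t u]
    by (simp add: differential_parallel[OF cd(1) t u'] differential_parallel[OF cd(2) t tu])
  also have "\<dots> = (\<Sum>l\<in>UNIV. ?D (axis k 1) $ l *\<^sub>R ?d (axis l 1))"
    by (rule linear_axis_expansion[OF linear_differential_parallel[OF cd(2) t tu]])
  finally show "frame c t u (Some k) + \<epsilon> *\<^sub>R normal_frame c t u (Some k) =
      (\<Sum>l\<in>UNIV. matrix ?D $ l $ k *\<^sub>R
        (frame d t (transition c d u) (Some l) + \<epsilon> *\<^sub>R normal_frame d t (transition c d u) (Some l)))"
    unfolding parallel_frame[OF cd(1) t u'] parallel_frame[OF cd(2) t tu] by (simp add: matrix_def)
qed (simp add: param_transition[OF cd u])

text \<open>Continuity includes \<open>\<epsilon>\<close>, so that positivity at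
  \<open>\<epsilon> = 0\<close> can be propagated uniformly to small
  \<open>\<epsilon>\<close>.\<close>

lemma continuous_on_D:
  assumes c: "c \<in> A"
  shows "continuous_on (UNIV \<times> ({0..1} \<times> codom_of c)) (\<lambda>(\<epsilon>, t, u). D \<epsilon> c t u)"
proof -
  let ?S = "UNIV \<times> ({0..1} \<times> codom_of c) :: (real \<times> real \<times> (real ^ 'm)) set"
  have lift: "continuous_on ?S (\<lambda>z. f (snd z))" if "continuous_on ({0..1} \<times> codom_of c) f"
    for f :: "real \<times> (real ^ 'm) \<Rightarrow> real ^ 'm option"
    by (rule continuous_on_compose2[OF that continuous_on_snd[OF continuous_on_id]]) auto
  have f: "continuous_on ({0..1} \<times> codom_of c) (\<lambda>p. frame c (fst p) (snd p) i)" for i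
    using family_continuous[OF fam_n c] family_continuous_differential[OF fam_\<phi> c]
    by (cases i) (simp_all add: split_beta)
  have w: "continuous_on ({0..1} \<times> codom_of c) (\<lambda>p. normal_frame c (fst p) (snd p) i)" for i
    using family_continuous_differential[OF fam_n c]
    by (cases i) (simp_all add: split_beta)
  show ?thesis
    unfolding D_def split_beta
    by (intro continuous_on_vdet continuous_intros lift[OF f] lift[OF w])
qed

lemma continuous_on_D_time:
  assumes c: "c \<in> A"
  shows "continuous_on ({0..1} \<times> codom_of c) (\<lambda>(t, u). D \<epsilon> c t u)"
proof -
  have "continuous_on ({0..1} \<times> codom_of c) (\<lambda>p. (\<lambda>(\<epsilon>, t, u). D \<epsilon> c t u) (\<epsilon>, p))"
    by (rule continuous_on_compose2[OF continuous_on_D[OF c]]) (auto intro!: continuous_intros)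
  then show ?thesis by (simp add: split_beta)
qed

lemma local_bending_chart:
  assumes c: "c \<in> A"
  shows "local_bending (codom_of c) (P c) (N c)"
proof
  have pdP: "pd (0, v) (P c) (t, u) = differential c (\<phi> t) u v" if "t \<in> {0<..<1}" "u \<in> codom_of c" for t u v
    unfolding P_def by (rule family_pd[OF fam_\<phi> c that])
  show "open (codom_of c)" by (rule open_codom[OF c])
  show "smooth_on ({0<..<1} \<times> codom_of c) (P c)" "smooth_on ({0<..<1} \<times> codom_of c) (N c)"
    using fam_\<phi> fam_n c unfolding smooth_family_def P_def N_def
    by (rule_tac smooth_on_subset[of "{0..1} \<times> codom_of c"]; force)+
  fix z v assume "z \<in> {0<..<1::real} \<times> codom_of c"
  then obtain t u where z: "z = (t, u)" "t \<in> {0<..<1}" "t \<in> {0..1}" "u \<in> codom_of c"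
    by fastforce
  show "norm (N c z) = 1"
    using norm_n[OF c z(3,4)] by (simp add: z N_def)
  show "N c z \<bullet> pd (0, v) (P c) z = 0"
    using n_normal[OF c z(3,4)] by (simp add: z(1) N_def pdP[OF z(2,4)])
  have "(\<lambda>i. case i of None \<Rightarrow> N c z | Some k \<Rightarrow> pd (0, axis k 1) (P c) z) = frame c t u"
    by (simp add: fun_eq_iff z(1) N_def pdP[OF z(2,4)] frame_def split: option.split)
  then show "vdet (\<lambda>i. case i of None \<Rightarrow> N c z | Some k \<Rightarrow> pd (0, axis k 1) (P c) z) \<noteq> 0"
    using vdet_frame_pos[OF c z(3,4)] by simp
next
  fix s t :: real and u v w
  assume st: "s \<in> {0<..<1}" "t \<in> {0<..<1}" and u: "u \<in> codom_of c"
  have "induced_metric c (\<phi> s) u = induced_metric c (\<phi> t) u"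
    using bend c u st unfolding bending_def by (metis atLeastAtMost_iff greaterThanLessThan_iff less_imp_le)
  then show "pd (0, v) (P c) (s, u) \<bullet> pd (0, w) (P c) (s, u) = pd (0, v) (P c) (t, u) \<bullet> pd (0, w) (P c) (t, u)"
    unfolding P_def family_pd[OF fam_\<phi> c st(1) u] family_pd[OF fam_\<phi> c st(2) u] induced_metric_def
    by meson
qed

section \<open>The normal velocity on the manifold\<close>

definition Y where "Y c t u i = local_bending.Y (P c) (N c) i (t, u)"
definition Y' where "Y' c t u i v = local_bending.Y' (P c) (N c) i (t, u) v"

lemma
  assumes c: "c \<in> A" and t: "t \<in> {0<..<1}" and u: "u \<in> codom_of c"
  shows frame_eq: "local_bending.q (P c) (N c) (t, u) = frame c t u"
    and normal_frame_eq: "local_bending.w (N c) (t, u) = normal_frame c t u"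
proof -
  interpret L: local_bending "codom_of c" "P c" "N c" by (rule local_bending_chart[OF c])
  have "N c (t, u) = n t (param c u)"
      "pd (0, v) (P c) (t, u) = differential c (\<phi> t) u v" "pd (0, v) (N c) (t, u) = differential c (n t) u v" for v
    using family_pd[OF fam_\<phi> c t u] family_pd[OF fam_n c t u] unfolding P_def N_def by simp_all
  note [simp] = this
  show "L.q (t, u) = frame c t u"
  proof
    show "L.q (t, u) i = frame c t u i" for i by (cases i) simp_all
  qed
  show "L.w (t, u) = normal_frame c t u"
  proof
    show "L.w (t, u) i = normal_frame c t u i" for i by (cases i) simp_all
  qed
qed

lemma D_time_derivative:
  assumes c: "c \<in> A" and t: "t \<in> {0<..<1}" and u: "u \<in> codom_of c"
  shows "((\<lambda>t. D \<epsilon> c t u) has_real_derivative \<epsilon> * (\<Sum>i\<in>UNIV. Y' c t u i (0, axis i 1))) (at t)"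
proof -
  interpret L: local_bending "codom_of c" "P c" "N c" by (rule local_bending_chart[OF c])
  have "((\<lambda>t. vdet (\<lambda>k. L.q (t, u) k + \<epsilon> *\<^sub>R L.w (t, u) k)) has_real_derivative
      \<epsilon> * (\<Sum>i\<in>UNIV. Y' c t u i (0, axis i 1))) (at t)"
    unfolding Y'_def by (rule L.parallel_density_derivative) (use t u in auto)
  then show ?thesis
    by (rule has_field_derivative_transform_within_open[of _ _ _ "{0<..<1}"])
      (use t in \<open>simp_all add: D_def frame_eq[OF c _ u] normal_frame_eq[OF c _ u]\<close>)
qed

lemma Y_has_derivative:
  assumes c: "c \<in> A" and t: "t \<in> {0<..<1}" and u: "u \<in> codom_of c"
  shows "((\<lambda>u. Y c t u i) has_derivative (\<lambda>v. Y' c t u i (0, v))) (at u)"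
proof -
  interpret L: local_bending "codom_of c" "P c" "N c" by (rule local_bending_chart[OF c])
  have "((\<lambda>u. (t, u)) has_derivative (\<lambda>v. (0, v))) (at u)"
    by (auto intro!: derivative_eq_intros)
  moreover have "(L.Y i has_derivative L.Y' i (t, u)) (at (t, u))"
    by (rule L.Y_has_derivative) (use t u in auto)
  ultimately have "(L.Y i \<circ> (\<lambda>u. (t, u)) has_derivative L.Y' i (t, u) \<circ> (\<lambda>v. (0, v))) (at u)"
    by (rule diff_chain_at)
  then show ?thesis
    by (simp add: o_def Y_def[abs_def] Y'_def[abs_def])
qed

lemma continuous_on_Y: "c \<in> A \<Longrightarrow> continuous_on ({0<..<1} \<times> codom_of c) (\<lambda>(t, u). Y c t u i)"
  and continuous_on_Y': "c \<in> A \<Longrightarrow> continuous_on ({0<..<1} \<times> codom_of c) (\<lambda>(t, u). Y' c t u i v)"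
  using local_bending.continuous_on_Y[OF local_bending_chart, of c i]
    local_bending.continuous_on_Y'[OF local_bending_chart, of c i v]
  by (simp_all add: Y_def Y'_def)

text \<open>The time derivative of the normal does not refer to a chart and the differential of an
  immersion is injective, so the coordinates of the normal velocity transform as a vector. Paired
  with a covector, whose law is the hypothesis on \<open>f\<close> and \<open>f'\<close>, and
  multiplied by the frame volume, they give a density.\<close>

lemma Y_trans:
  assumes cd: "c \<in> A" "d \<in> A" and u: "u \<in> overlap c d" and t: "t \<in> {0<..<1}"
    and f: "\<And>v. f v = f' (pd v (transition c d) u)" and lin: "linear f" "linear f'"
  shows "(\<Sum>i\<in>UNIV. f (axis i 1) * Y c t u i) = det (matrix (\<lambda>v. pd v (transition c d) u)) *
    (\<Sum>i\<in>UNIV. f' (axis i 1) * Y d t (transition c d u) i)"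
proof -
  interpret L: local_bending "codom_of c" "P c" "N c" by (rule local_bending_chart[OF cd(1)])
  interpret L': local_bending "codom_of d" "P d" "N d" by (rule local_bending_chart[OF cd(2)])
  let ?u = "transition c d u"
  have u': "u \<in> codom_of c" "?u \<in> codom_of d" using u cd by (simp_all add: overlap_iff transition_in[OF cd u])
  have t': "t \<in> {0..1}" using t by simp
  have zc: "(t, u) \<in> {0<..<1} \<times> codom_of c" and zd: "(t, ?u) \<in> {0<..<1} \<times> codom_of d"
    using t u' by auto
  obtain W where W: "pd (1, 0) (N c) (t, u) = pd (0, W) (P c) (t, u)" "\<And>i. Y c t u i = W $ i * vdet (frame c t u)"
    using L.normal_velocity[OF zc] unfolding Y_def frame_eq[OF cd(1) t u'(1)] by metis
  obtain W' where W': "pd (1, 0) (N d) (t, ?u) = pd (0, W') (P d) (t, ?u)" "\<And>i. Y d t ?u i = W' $ i * vdet (frame d t ?u)"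
    using L'.normal_velocity[OF zd] unfolding Y_def frame_eq[OF cd(2) t u'(2)] by metis
  have "((\<lambda>t. N c (t, u)) has_vector_derivative pd (1, 0) (N c) (t, u)) (at t)"
    by (rule L.has_vector_derivative_time[OF L.smooth_imp_diff[OF L.smooth_N zc]])
  moreover have "((\<lambda>t. N d (t, ?u)) has_vector_derivative pd (1, 0) (N d) (t, ?u)) (at t)"
    by (rule L'.has_vector_derivative_time[OF L'.smooth_imp_diff[OF L'.smooth_N zd]])
  moreover have "(\<lambda>t. N c (t, u)) = (\<lambda>t. N d (t, ?u))"
    by (simp add: N_def param_transition[OF cd u])
  ultimately have "pd (1, 0) (N c) (t, u) = pd (1, 0) (N d) (t, ?u)"
    using vector_derivative_unique_at by metis
  then have "differential c (\<phi> t) u W = differential d (\<phi> t) ?u W'"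
    using W(1) W'(1) unfolding P_def family_pd[OF fam_\<phi> cd(1) t u'(1)] family_pd[OF fam_\<phi> cd(2) t u'(2)] by simp
  then have "differential d (\<phi> t) ?u (pd W (transition c d) u) = differential d (\<phi> t) ?u W'"
    by (simp add: differential_transition[OF fam_\<phi> cd t' u])
  moreover have "inj (differential d (\<phi> t) ?u)"
    using bend cd(2) t' u'(2) unfolding bending_def immersion_def by blast
  ultimately have W'_eq: "W' = pd W (transition c d) u"
    by (simp add: inj_eq)
  have "(\<Sum>i\<in>UNIV. f (axis i 1) * Y c t u i) = f W * vdet (frame c t u)"
    using linear_axis_expansion[OF lin(1), of W] by (simp add: W(2) sum_distrib_left mult_ac)
  also have "\<dots> = f' W' * (det (matrix (\<lambda>v. pd v (transition c d) u)) * vdet (frame d t ?u))"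
    using D_trans[OF cd u t', of 0] by (simp add: D_zero f W'_eq)
  also have "f' W' * vdet (frame d t ?u) = (\<Sum>i\<in>UNIV. f' (axis i 1) * Y d t ?u i)"
    using linear_axis_expansion[OF lin(2), of W'] by (simp add: W'(2) sum_distrib_left mult_ac)
  then have "f' W' * (det (matrix (\<lambda>v. pd v (transition c d) u)) * vdet (frame d t ?u)) =
      det (matrix (\<lambda>v. pd v (transition c d) u)) * (\<Sum>i\<in>UNIV. f' (axis i 1) * Y d t ?u i)"
    by (simp add: mult_ac)
  finally show ?thesis .
qed

end

section \<open>Time derivative of the area\<close>

locale bent_hypersurface_partition =
  bent_hypersurface M A \<phi> n + atlas_partition M A I ch lo hi K \<psi>
  for M :: "'a::t2_space set" and A :: "('a, 'm::finite) chart set"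
    and \<phi> n :: "real \<Rightarrow> 'a \<Rightarrow> real ^ 'm option" and I ch lo hi K \<psi>
begin

abbreviation "B x \<equiv> cbox (lo x) (hi x)"

definition local_area where
  "local_area \<epsilon> x t = integral (B x) (\<lambda>u. \<psi> x (param (ch x) u) * \<bar>D \<epsilon> (ch x) t u\<bar>)"

lemma area_eq:
  assumes t: "t \<in> {0..1}"
  shows "area M A (parallel_hypersurface \<phi> n \<epsilon> t) = ennreal (\<Sum>x\<in>I. local_area \<epsilon> x t)"
  unfolding local_area_def
proof (rule area_partition)
  show "density (\<lambda>c u. \<bar>D \<epsilon> c t u\<bar>)"
    unfolding density_def
  proof (intro ballI)
    fix c d u assume cd: "c \<in> A" "d \<in> A" and u: "u \<in> overlap c d"
    show "\<bar>D \<epsilon> c t u\<bar> = det (matrix (\<lambda>v. pd v (transition c d) u)) * \<bar>D \<epsilon> d t (transition c d u)\<bar>"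
      using det_transition_pos[OF cd u] by (simp add: D_trans[OF cd u t] abs_mult)
  qed
  show "continuous_on (codom_of c) (\<lambda>u. \<bar>D \<epsilon> c t u\<bar>)" if "c \<in> A" for c
  proof -
    have "continuous_on (codom_of c) (\<lambda>u. (\<lambda>(t, u). D \<epsilon> c t u) (t, u))"
      by (rule continuous_on_compose2[OF continuous_on_D_time[OF that]]) (use t in \<open>auto intro!: continuous_intros\<close>)
    then show ?thesis by (intro continuous_intros) simp
  qed
qed (use t in \<open>auto simp: area_density_parallel\<close>)

lemma continuous_on_local_area:
  assumes x: "x \<in> I"
  shows "continuous_on {0..1} (local_area \<epsilon> x)"
  unfolding local_area_def[abs_def]
proof (rule integral_continuous_on_param)
  have "continuous_on ({0..1} \<times> B x) (\<lambda>p. \<psi> x (param (ch x) (snd p)))"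
    by (rule continuous_on_compose2[OF C1_on_continuous[OF C1_\<psi>_param[OF x ch[OF x]]]])
      (use box_codom[OF x] in \<open>auto intro!: continuous_intros\<close>)
  moreover have "continuous_on ({0..1} \<times> B x) (\<lambda>(t, u). D \<epsilon> (ch x) t u)"
    by (rule continuous_on_subset[OF continuous_on_D_time[OF ch[OF x]]]) (use box_codom[OF x] in auto)
  ultimately show "continuous_on ({0..1} \<times> B x) (\<lambda>(t, u). \<psi> x (param (ch x) u) * \<bar>D \<epsilon> (ch x) t u\<bar>)"
    unfolding split_beta by (intro continuous_intros)
qed

text \<open>What integration by parts leaves: the derivative of a partition function along the
  normal velocity, times the frame volume. The sign stems from the absolute value in the area; it
  agrees in all charts because transitions preserve orientation.\<close>

definition \<eta> where
  "\<eta> \<epsilon> t x c u = sgn (D \<epsilon> c t u) * (\<Sum>i\<in>UNIV. pd (axis i 1) (\<lambda>u. \<psi> x (param c u)) u * Y c t u i)"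

text \<open>The product of the time interval and a box is convex, hence connected.\<close>

lemma sign_constant:
  assumes x: "x \<in> I" and nz: "\<And>c t u. c \<in> A \<Longrightarrow> t \<in> {0..1} \<Longrightarrow> u \<in> codom_of c \<Longrightarrow> D \<epsilon> c t u \<noteq> 0"
  obtains \<sigma> where "\<forall>t\<in>{0..1}. \<forall>u\<in>B x. sgn (D \<epsilon> (ch x) t u) = \<sigma>"
proof -
  have "connected ({0..1::real} \<times> B x)"
    by (intro convex_connected convex_Times convex_box convex_real_interval)
  moreover have "continuous_on ({0..1} \<times> B x) (\<lambda>(t, u). D \<epsilon> (ch x) t u)"
    by (rule continuous_on_subset[OF continuous_on_D_time[OF ch[OF x]]]) (use box_codom[OF x] in auto)
  moreover have "(\<lambda>(t, u). D \<epsilon> (ch x) t u) z \<noteq> 0" if "z \<in> {0..1} \<times> B x" for z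
    using that nz[OF ch[OF x]] box_codom[OF x] by auto
  ultimately obtain \<sigma> where "\<forall>z\<in>{0..1} \<times> B x. sgn ((\<lambda>(t, u). D \<epsilon> (ch x) t u) z) = \<sigma>"
    by (rule nonzero_sign_constant)
  then have "\<forall>t\<in>{0..1}. \<forall>u\<in>B x. sgn (D \<epsilon> (ch x) t u) = \<sigma>"
    by auto
  then show ?thesis by (rule that)
qed

text \<open>With the sign fixed on the box for all times, the absolute value is a constant multiple
  of \<open>D\<close>, so \<open>D_time_derivative\<close> applies under the integral; the
  divergence is then moved onto the partition function.\<close>

lemma local_area_derivative:
  assumes x: "x \<in> I" and nz: "\<And>c t u. c \<in> A \<Longrightarrow> t \<in> {0..1} \<Longrightarrow> u \<in> codom_of c \<Longrightarrow> D \<epsilon> c t u \<noteq> 0"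
    and t: "t \<in> {0<..<1}"
  shows "(local_area \<epsilon> x has_real_derivative - \<epsilon> * integral (B x) (\<eta> \<epsilon> t x (ch x))) (at t)"
    and "continuous_on (B x) (\<eta> \<epsilon> t x (ch x))"
proof -
  let ?c = "ch x" and ?\<psi> = "\<lambda>u. \<psi> x (param (ch x) u)"
  note c = ch[OF x] and box = box_codom[OF x]
  have in_codom: "u \<in> codom_of ?c" if "u \<in> B x" for u using box that by blast
  obtain \<sigma> where "\<forall>t\<in>{0..1}. \<forall>u\<in>B x. sgn (D \<epsilon> ?c t u) = \<sigma>"
    by (rule sign_constant[OF x nz])
  then have \<sigma>: "sgn (D \<epsilon> ?c t u) = \<sigma>" if "t \<in> {0..1}" "u \<in> B x" for t u
    using that by blast
  have abs: "\<bar>D \<epsilon> ?c t u\<bar> = \<sigma> * D \<epsilon> ?c t u" if "t \<in> {0..1}" "u \<in> B x" for t u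
    using \<sigma>[OF that] by (metis abs_sgn mult.commute)
  have C1: "C1_on (codom_of ?c) ?\<psi>" by (rule C1_\<psi>_param[OF x c])
  have cont_\<psi>: "continuous_on (B x) ?\<psi>"
    by (rule continuous_on_subset[OF C1_on_continuous[OF C1] box])
  have cont_pd: "continuous_on (B x) (pd v ?\<psi>)" for v
    using C1 continuous_on_subset[OF _ box] unfolding C1_on_def by blast
  have slice: "continuous_on (B x) (\<lambda>u. f t u)" if "continuous_on ({0<..<1} \<times> codom_of ?c) (\<lambda>(t, u). f t u)"
    for f :: "real \<Rightarrow> real ^ 'm \<Rightarrow> real"
  proof -
    have "continuous_on (B x) (\<lambda>u. (\<lambda>(t, u). f t u) (t, u))"
      by (rule continuous_on_compose2[OF that]) (use t box in \<open>auto intro!: continuous_intros\<close>)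
    then show ?thesis by simp
  qed
  have cont_Y: "continuous_on (B x) (\<lambda>u. Y ?c t u i)" for i
    by (rule slice[OF continuous_on_Y[OF c]])
  have cont_Y': "continuous_on (B x) (\<lambda>u. Y' ?c t u i v)" for i v
    by (rule slice[OF continuous_on_Y'[OF c]])
  let ?Z = "\<lambda>u. \<Sum>i\<in>UNIV. pd (axis i 1) ?\<psi> u * Y ?c t u i"
  have cont_Z: "continuous_on (B x) ?Z"
    by (intro continuous_on_sum continuous_on_mult cont_pd cont_Y)
  have \<eta>Z: "\<eta> \<epsilon> t x ?c u = \<sigma> * ?Z u" if "u \<in> B x" for u
    using \<sigma>[OF _ that, of t] t by (simp add: \<eta>_def)
  show "continuous_on (B x) (\<eta> \<epsilon> t x ?c)"
    by (rule continuous_on_eq[of _ "\<lambda>u. \<sigma> * ?Z u"]) (auto intro!: continuous_intros cont_Z simp: \<eta>Z)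
  let ?V = "\<lambda>t u. \<Sum>i\<in>UNIV. Y' ?c t u i (0, axis i 1)"
  have cont_V: "continuous_on ({0<..<1} \<times> codom_of ?c) (\<lambda>(t, u). ?V t u)"
    using continuous_on_Y'[OF c] unfolding split_beta by (intro continuous_on_sum) simp
  \<comment> \<open>One integration by parts per coordinate direction; \<open>\<psi> x\<close> times
    \<open>Y\<close> vanishes off \<open>K x\<close>.\<close>
  have parts: "integral (B x) (\<lambda>u. ?\<psi> u * ?V t u) = - integral (B x) ?Z"
  proof -
    have "integral (B x) (\<lambda>u. ?\<psi> u * Y' ?c t u i (0, axis i 1) + pd (axis i 1) ?\<psi> u * Y ?c t u i) = 0" for i
    proof (rule integral_derivative_compact_support[where F = "\<lambda>u. ?\<psi> u * Y ?c t u i" and U = "codom_of ?c" and K = "K x"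
          and F' = "\<lambda>u v. ?\<psi> u * Y' ?c t u i (0, v) + pd v ?\<psi> u * Y ?c t u i"])
      show "((\<lambda>u. ?\<psi> u * Y ?c t u i) has_derivative
          (\<lambda>v. ?\<psi> u * Y' ?c t u i (0, v) + pd v ?\<psi> u * Y ?c t u i)) (at u)" if u: "u \<in> codom_of ?c" for u
        using C1 u by (intro has_derivative_mult Y_has_derivative[OF c t u]) (simp add: C1_on_def)
      have slice': "continuous_on (codom_of ?c) (\<lambda>u. f t u)" if "continuous_on ({0<..<1} \<times> codom_of ?c) (\<lambda>(t, u). f t u)"
        for f :: "real \<Rightarrow> real ^ 'm \<Rightarrow> real"
      proof -
        have "continuous_on (codom_of ?c) (\<lambda>u. (\<lambda>(t, u). f t u) (t, u))"
          by (rule continuous_on_compose2[OF that]) (use t in \<open>auto intro!: continuous_intros\<close>)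
        then show ?thesis by simp
      qed
      show "continuous_on (codom_of ?c) (\<lambda>u. ?\<psi> u * Y' ?c t u i (0, axis i 1) + pd (axis i 1) ?\<psi> u * Y ?c t u i)"
        using C1 by (intro continuous_on_add continuous_on_mult C1_on_continuous[OF C1] slice'[of "\<lambda>t u. Y ?c t u i"]
            slice'[of "\<lambda>t u. Y' ?c t u i (0, axis i 1)"] continuous_on_Y continuous_on_Y' c) (simp add: C1_on_def)
      show "?\<psi> u * Y ?c t u i = 0" if u: "u \<in> codom_of ?c - K x" for u
      proof -
        have "param ?c u \<notin> param ?c ` K x"
        proof
          assume "param ?c u \<in> param ?c ` K x"
          then obtain k where k: "k \<in> K x" "param ?c u = param ?c k" by blast
          then have "k \<in> codom_of ?c" using K_cbox[OF x] box by blast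
          then have "u = k"
            using k(2) coord_param[OF c, of u] coord_param[OF c, of k] u by simp
          then show False using u k by blast
        qed
        then show ?thesis using \<psi>_support[OF x] by auto
      qed
    qed (use open_codom[OF c] box compact_imp_closed[OF compact_K[OF x]] K_box[OF x] in auto)
    then have "(\<Sum>i\<in>UNIV. integral (B x) (\<lambda>u. ?\<psi> u * Y' ?c t u i (0, axis i 1) + pd (axis i 1) ?\<psi> u * Y ?c t u i)) = 0"
      by simp
    also have "(\<Sum>i\<in>UNIV. integral (B x) (\<lambda>u. ?\<psi> u * Y' ?c t u i (0, axis i 1) + pd (axis i 1) ?\<psi> u * Y ?c t u i)) =
        integral (B x) (\<lambda>u. \<Sum>i\<in>UNIV. ?\<psi> u * Y' ?c t u i (0, axis i 1) + pd (axis i 1) ?\<psi> u * Y ?c t u i)"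
      by (rule integral_sum[symmetric])
        (auto intro!: integrable_continuous continuous_on_add continuous_on_mult cont_\<psi> cont_pd cont_Y cont_Y')
    also have "(\<lambda>u. \<Sum>i\<in>UNIV. ?\<psi> u * Y' ?c t u i (0, axis i 1) + pd (axis i 1) ?\<psi> u * Y ?c t u i) =
        (\<lambda>u. ?\<psi> u * ?V t u + ?Z u)"
      by (simp add: sum.distrib sum_distrib_left)
    also have "integral (B x) \<dots> = integral (B x) (\<lambda>u. ?\<psi> u * ?V t u) + integral (B x) ?Z"
      by (rule integral_add)
        (intro integrable_continuous continuous_on_mult continuous_on_sum cont_\<psi> cont_Z cont_Y')+
    finally show ?thesis by simp
  qed
  have "((\<lambda>t. integral (B x) (\<lambda>u. ?\<psi> u * (\<sigma> * D \<epsilon> ?c t u))) has_real_derivative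
      integral (B x) (\<lambda>u. ?\<psi> u * (\<sigma> * (\<epsilon> * ?V t u)))) (at t within {0<..<1})"
  proof (rule leibniz_rule_field_derivative)
    show "((\<lambda>t. ?\<psi> u * (\<sigma> * D \<epsilon> ?c t u)) has_real_derivative ?\<psi> u * (\<sigma> * (\<epsilon> * ?V t u))) (at t within {0<..<1})"
      if "t \<in> {0<..<1}" "u \<in> B x" for t u
      by (rule has_field_derivative_at_within) (intro DERIV_cmult D_time_derivative c that in_codom)
    show "(\<lambda>u. ?\<psi> u * (\<sigma> * D \<epsilon> ?c t u)) integrable_on B x" if s: "t \<in> {0<..<1}" for t
    proof -
      have "continuous_on (B x) (\<lambda>u. (\<lambda>(t, u). D \<epsilon> ?c t u) (t, u))"
        by (rule continuous_on_compose2[OF continuous_on_D_time[OF c]]) (use s box in \<open>auto intro!: continuous_intros\<close>)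
      then show ?thesis
        by (intro integrable_continuous continuous_on_mult cont_\<psi> continuous_on_const) simp
    qed
    have "continuous_on ({0<..<1} \<times> B x) (\<lambda>p::real \<times> (real ^ 'm). ?\<psi> (snd p))"
      by (rule continuous_on_compose2[OF cont_\<psi>]) (auto intro!: continuous_intros)
    moreover have "continuous_on ({0<..<1} \<times> B x) (\<lambda>(t, u). ?V t u)"
      by (rule continuous_on_subset[OF cont_V]) (use box in auto)
    ultimately show "continuous_on ({0<..<1} \<times> B x) (\<lambda>(t, u). ?\<psi> u * (\<sigma> * (\<epsilon> * ?V t u)))"
      unfolding split_beta by (intro continuous_on_mult continuous_on_const)
  qed (use t in auto)
  then have D: "((\<lambda>t. integral (B x) (\<lambda>u. ?\<psi> u * (\<sigma> * D \<epsilon> ?c t u))) has_real_derivative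
      integral (B x) (\<lambda>u. ?\<psi> u * (\<sigma> * (\<epsilon> * ?V t u)))) (at t)"
    using t by (simp add: at_within_open[OF t])
  have "(local_area \<epsilon> x has_real_derivative integral (B x) (\<lambda>u. ?\<psi> u * (\<sigma> * (\<epsilon> * ?V t u)))) (at t)"
  proof (rule has_field_derivative_transform_within_open[OF D, of "{0<..<1}"])
    show "integral (B x) (\<lambda>u. ?\<psi> u * (\<sigma> * D \<epsilon> ?c t u)) = local_area \<epsilon> x t" if "t \<in> {0<..<1}" for t
      unfolding local_area_def by (rule integral_cong) (use that abs in simp)
  qed (use t in auto)
  also have "integral (B x) (\<lambda>u. ?\<psi> u * (\<sigma> * (\<epsilon> * ?V t u))) = integral (B x) (\<lambda>u. (\<sigma> * \<epsilon>) * (?\<psi> u * ?V t u))"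
    by (intro integral_cong) (simp add: mult_ac)
  also have "\<dots> = - \<epsilon> * (\<sigma> * integral (B x) ?Z)"
    by (simp add: parts)
  also have "\<sigma> * integral (B x) ?Z = integral (B x) (\<eta> \<epsilon> t x ?c)"
    by (subst integral_mult_right[symmetric]) (intro integral_cong, simp add: \<eta>Z)
  finally show "(local_area \<epsilon> x has_real_derivative - \<epsilon> * integral (B x) (\<eta> \<epsilon> t x (ch x))) (at t)" .
qed

lemma sum_integral_\<eta>:
  assumes nz: "\<And>c t u. c \<in> A \<Longrightarrow> t \<in> {0..1} \<Longrightarrow> u \<in> codom_of c \<Longrightarrow> D \<epsilon> c t u \<noteq> 0"
    and t: "t \<in> {0<..<1}"
  shows "(\<Sum>x\<in>I. integral (B x) (\<eta> \<epsilon> t x (ch x))) = 0"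
proof (rule density_sum_zero)
  have pd_lin: "linear (\<lambda>v. pd v (\<lambda>u. \<psi> x (param c u)) u)" if "x \<in> I" "c \<in> A" "u \<in> codom_of c" for x c u
    using C1_\<psi>_param[OF that(1,2)] that(3) unfolding C1_on_def by (blast intro: has_derivative_linear)
  fix x assume x: "x \<in> I"
  show "continuous_on (B x) (\<eta> \<epsilon> t x (ch x))"
    by (rule local_area_derivative(2)[OF x nz t])
  show "density (\<eta> \<epsilon> t x)"
    unfolding density_def
  proof (intro ballI)
    fix c d u assume cd: "c \<in> A" "d \<in> A" and u: "u \<in> overlap c d"
    have u': "u \<in> codom_of c" "transition c d u \<in> codom_of d"
      using u cd by (simp_all add: overlap_iff transition_in[OF cd u])
    have "((\<psi> x \<circ> param d) has_derivative (\<lambda>v. pd v (\<lambda>u. \<psi> x (param d u)) (transition c d u))) (at (transition c d u))"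
      using C1_\<psi>_param[OF x cd(2)] u'(2) by (simp add: C1_on_def o_def)
    from has_derivative_pd[OF transition_derivative_chain[OF cd u this]]
    have chain: "pd v (\<lambda>u. \<psi> x (param c u)) u = pd (pd v (transition c d) u) (\<lambda>u. \<psi> x (param d u)) (transition c d u)" for v
      by (simp add: o_def)
    have "sgn (D \<epsilon> c t u) = sgn (D \<epsilon> d t (transition c d u))"
      using det_transition_pos[OF cd u] t by (simp add: D_trans[OF cd u] sgn_mult)
    then show "\<eta> \<epsilon> t x c u = det (matrix (\<lambda>v. pd v (transition c d) u)) * \<eta> \<epsilon> t x d (transition c d u)"
      unfolding \<eta>_def
      using Y_trans[OF cd u t chain pd_lin[OF x cd(1) u'(1)] pd_lin[OF x cd(2) u'(2)]] by simp
  qed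
  fix d u assume d: "d \<in> A" and u: "u \<in> codom_of d" and out: "param d u \<notin> param (ch x) ` K x"
  let ?V = "{u \<in> codom_of d. param d u \<notin> param (ch x) ` K x}"
  \<comment> \<open>Off the support the partition function vanishes on an open set, so its
    derivatives vanish there too.\<close>
  have "open ?V"
    by (rule open_outside[OF ch[OF x] d compact_K[OF x]]) (use K_cbox[OF x] box_codom[OF x] in blast)
  then have "pd v (\<lambda>u. \<psi> x (param d u)) u = 0" for v
    by (rule pd_eq_0_open) (use u out \<psi>_support[OF x] in auto)
  then show "\<eta> \<epsilon> t x d u = 0" by (simp add: \<eta>_def)
next
  fix c u assume c: "c \<in> A" and u: "u \<in> codom_of c"
  have pd_sum: "(\<Sum>x\<in>I. pd v (\<lambda>u. \<psi> x (param c u)) u) = 0" for v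
  proof -
    have "((\<lambda>u. \<Sum>x\<in>I. \<psi> x (param c u)) has_derivative (\<lambda>v. \<Sum>x\<in>I. pd v (\<lambda>u. \<psi> x (param c u)) u)) (at u)"
      using C1_\<psi>_param[OF _ c] u by (intro has_derivative_sum) (simp add: C1_on_def)
    moreover have "((\<lambda>u. \<Sum>x\<in>I. \<psi> x (param c u)) has_derivative (\<lambda>v. 0)) (at u)"
      by (rule has_derivative_transform_within_open[OF has_derivative_const open_codom[OF c] u])
        (rule \<psi>_sum[OF param_in_M[OF c], symmetric])
    ultimately show ?thesis
      using has_derivative_unique by metis
  qed
  have "(\<Sum>x\<in>I. \<eta> \<epsilon> t x c u) =
      sgn (D \<epsilon> c t u) * (\<Sum>i\<in>UNIV. (\<Sum>x\<in>I. pd (axis i 1) (\<lambda>u. \<psi> x (param c u)) u) * Y c t u i)"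
    unfolding \<eta>_def sum_distrib_right by (subst sum.swap) (simp add: sum_distrib_left)
  then show "(\<Sum>x\<in>I. \<eta> \<epsilon> t x c u) = 0"
    by (simp add: pd_sum)
qed

lemma area_constant:
  assumes nz: "\<And>c t u. c \<in> A \<Longrightarrow> t \<in> {0..1} \<Longrightarrow> u \<in> codom_of c \<Longrightarrow> D \<epsilon> c t u \<noteq> 0"
    and s: "s \<in> {0..1}" and t: "t \<in> {0..1}"
  shows "area M A (parallel_hypersurface \<phi> n \<epsilon> s) = area M A (parallel_hypersurface \<phi> n \<epsilon> t)"
proof -
  define F where "F t = (\<Sum>x\<in>I. local_area \<epsilon> x t)" for t
  have cont: "continuous_on {0..1} F"
    unfolding F_def[abs_def] by (intro continuous_on_sum continuous_on_local_area)
  have deriv: "(F has_real_derivative 0) (at t)" if t: "t \<in> {0<..<1}" for t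
  proof -
    have "(F has_real_derivative (\<Sum>x\<in>I. - \<epsilon> * integral (B x) (\<eta> \<epsilon> t x (ch x)))) (at t)"
      unfolding F_def[abs_def] by (intro DERIV_sum local_area_derivative(1) nz t)
    also have "(\<Sum>x\<in>I. - \<epsilon> * integral (B x) (\<eta> \<epsilon> t x (ch x))) = 0"
      using sum_integral_\<eta>[of \<epsilon> t, OF nz t] by (simp only: sum_distrib_left[symmetric] mult_zero_right)
    finally show ?thesis .
  qed
  have "F r = F 0" if r: "r \<in> {0..1}" for r
  proof (cases "r = 0")
    case False
    show ?thesis
      by (rule DERIV_isconst_end) (use False r in \<open>auto intro!: continuous_on_subset[OF cont] deriv\<close>)
  qed simp
  from this[OF s] this[OF t] show ?thesis
    unfolding area_eq[OF s] area_eq[OF t] F_def by simp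
qed

text \<open>At \<open>\<epsilon> = 0\<close> the determinant is the frame volume, with a positive
  minimum over each compact box and all times. Uniform continuity keeps it nonzero for small
  \<open>\<epsilon>\<close>, and there are finitely many boxes.\<close>

lemma parallel_immersions:
  "\<forall>\<^sub>F \<epsilon> in at_right 0. \<forall>t\<in>{0..1}. immersion A (parallel_hypersurface \<phi> n \<epsilon> t)"
proof -
  have "\<exists>\<delta>>0. \<forall>\<epsilon>\<in>{0<..<\<delta>}. \<forall>t\<in>{0..1}. \<forall>u\<in>B x. D \<epsilon> (ch x) t u \<noteq> 0" if x: "x \<in> I" for x
  proof (cases "B x = {}")
    case False
    let ?S = "{0..1::real} \<times> ({0..1::real} \<times> B x)" and ?g = "\<lambda>(\<epsilon>, t, u). D \<epsilon> (ch x) t u"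
    have cg: "continuous_on ?S ?g"
      by (rule continuous_on_subset[OF continuous_on_D[OF ch[OF x]]]) (use box_codom[OF x] in auto)
    have cS: "compact ?S" by (intro compact_Times compact_Icc compact_cbox)
    have c0: "continuous_on ({0..1} \<times> B x) (\<lambda>(t, u). D 0 (ch x) t u)"
      by (rule continuous_on_subset[OF continuous_on_D_time[OF ch[OF x]]]) (use box_codom[OF x] in auto)
    have "compact ({0..1::real} \<times> B x)" "{0..1::real} \<times> B x \<noteq> {}"
      using False by (auto intro!: compact_Times)
    from continuous_attains_inf[OF this c0] obtain z
      where z: "z \<in> {0..1} \<times> B x" "\<forall>y\<in>{0..1} \<times> B x. (\<lambda>(t, u). D 0 (ch x) t u) z \<le> (\<lambda>(t, u). D 0 (ch x) t u) y"
      by blast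
    define m where "m = (\<lambda>(t, u). D 0 (ch x) t u) z"
    have m: "m > 0"
      using z(1) vdet_frame_pos[OF ch[OF x]] box_codom[OF x] by (auto simp: m_def D_zero split_beta)
    have m_le: "m \<le> D 0 (ch x) t u" if "t \<in> {0..1}" "u \<in> B x" for t u
      using z(2) that by (auto simp: m_def)
    obtain d where d: "d > 0" "\<And>p p'. p \<in> ?S \<Longrightarrow> p' \<in> ?S \<Longrightarrow> dist p' p < d \<Longrightarrow> dist (?g p') (?g p) < m"
      using compact_uniformly_continuous[OF cg cS] m unfolding uniformly_continuous_on_def by metis
    \<comment> \<open>The cap 1 keeps \<open>\<epsilon>\<close> in the compact interval on which
      uniform continuity was obtained.\<close>
    have "D \<epsilon> (ch x) t u \<noteq> 0" if "\<epsilon> \<in> {0<..<min d 1}" "t \<in> {0..1}" "u \<in> B x" for \<epsilon> t u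
    proof -
      have "dist (\<epsilon>, t, u) (0, t, u) < d"
        using that by (simp add: dist_Pair_Pair)
      then have "dist (?g (\<epsilon>, t, u)) (?g (0, t, u)) < m"
        by (intro d(2)) (use that in auto)
      then show ?thesis
        using m_le[OF that(2,3)] by (auto simp: dist_real_def)
    qed
    then show ?thesis
      using d(1) by (intro exI[of _ "min d 1"]) auto
  qed (auto intro!: exI[of _ 1])
  then obtain \<delta> where \<delta>: "\<And>x. x \<in> I \<Longrightarrow> \<delta> x > 0"
      "\<And>x \<epsilon> t u. x \<in> I \<Longrightarrow> \<epsilon> \<in> {0<..<\<delta> x} \<Longrightarrow> t \<in> {0..1} \<Longrightarrow> u \<in> B x \<Longrightarrow> D \<epsilon> (ch x) t u \<noteq> 0"
    by metis
  have "\<forall>x\<in>I. \<forall>\<^sub>F \<epsilon> in at_right 0. \<epsilon> \<in> {0<..<\<delta> x}"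
    using \<delta>(1) by (auto simp: eventually_at_right_less eventually_at_right_field)
  then have "\<forall>\<^sub>F \<epsilon> in at_right 0. \<forall>x\<in>I. \<epsilon> \<in> {0<..<\<delta> x}"
    by (simp add: eventually_ball_finite_distrib finite_I)
  then show ?thesis
  proof (rule eventually_mono, intro ballI)
    fix \<epsilon> t :: real assume \<epsilon>: "\<forall>x\<in>I. \<epsilon> \<in> {0<..<\<delta> x}" and t: "t \<in> {0..1}"
    show "immersion A (parallel_hypersurface \<phi> n \<epsilon> t)"
      unfolding immersion_def
    proof (intro ballI conjI)
      fix d assume d: "d \<in> A"
      show "smooth_on (codom_of d) (parallel_hypersurface \<phi> n \<epsilon> t \<circ> param d)"
        by (rule smooth_parallel[OF d t])
      fix u assume u: "u \<in> codom_of d"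
      \<comment> \<open>So far \<open>D\<close> is controlled only on the boxes. A partition
        function that is nonzero at the given point places it in some \<open>K x\<close>, and
        \<open>D_trans\<close> carries the result to the chart \<open>d\<close>.\<close>
      have "\<exists>x\<in>I. \<psi> x (param d u) \<noteq> 0"
      proof (rule ccontr)
        assume "\<not> ?thesis"
        then have "(\<Sum>x\<in>I. \<psi> x (param d u)) = 0" by simp
        then show False using \<psi>_sum[OF param_in_M[OF d u]] by simp
      qed
      then obtain x k where x: "x \<in> I" and k: "k \<in> K x" "param d u = param (ch x) k"
        using \<psi>_support by blast
      have k': "k \<in> B x" "k \<in> codom_of (ch x)"
        using k(1) K_cbox[OF x] box_codom[OF x] by auto
      have overlap: "u \<in> overlap d (ch x)"
        using u d k(2) param_in[OF ch[OF x] k'(2)] by (simp add: overlap_iff)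
      have "transition d (ch x) u = k"
        using k(2) coord_param[OF ch[OF x] k'(2)] by (simp add: transition_def)
      then have "D \<epsilon> d t u \<noteq> 0"
        using D_trans[OF d ch[OF x] overlap t, of \<epsilon>] det_transition_pos[OF d ch[OF x] overlap] \<delta>(2)[OF x _ t k'(1)] \<epsilon> x by simp
      then show "inj (differential d (parallel_hypersurface \<phi> n \<epsilon> t) u)"
        by (simp add: inj_differential_iff[OF d t u])
    qed
  qed
qed

end

text \<open>The first conjunct shows that the premise of the second is met by all sufficiently small
  \<open>\<epsilon>\<close>, so the constancy is not vacuous.\<close>

theorem theorem7:
  fixes M :: "'a::t2_space set"
    and A :: "('a, 'm::finite) chart set"
    and \<phi> n :: "real \<Rightarrow> 'a \<Rightarrow> real ^ 'm option"
  assumes "CARD('m) + 1 \<ge> 3"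
    and "compact M"
    and "oriented_smooth_atlas M A"
    and "bending A \<phi>"
    and "oriented_unit_normal A \<phi> n"
  shows "(\<forall>\<^sub>F \<epsilon> in at_right 0. \<forall>t\<in>{0..1}. immersion A (parallel_hypersurface \<phi> n \<epsilon> t)) \<and>
    (\<forall>\<epsilon>>0. (\<forall>t\<in>{0..1}. immersion A (parallel_hypersurface \<phi> n \<epsilon> t)) \<longrightarrow>
       (\<forall>s\<in>{0..1}. \<forall>t\<in>{0..1}.
          area M A (parallel_hypersurface \<phi> n \<epsilon> s) = area M A (parallel_hypersurface \<phi> n \<epsilon> t)))"
proof -
  interpret bent_hypersurface M A \<phi> n
    by unfold_locales (use assms in auto)
  obtain I ch lo hi K \<psi> where "atlas_partition M A I ch lo hi K \<psi>"
    using partition_of_unity by blast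
  then interpret atlas_partition M A I ch lo hi K \<psi> .
  interpret bent_hypersurface_partition M A \<phi> n I ch lo hi K \<psi> ..
  have "area M A (parallel_hypersurface \<phi> n \<epsilon> s) = area M A (parallel_hypersurface \<phi> n \<epsilon> t)"
    if imm: "\<forall>t\<in>{0..1}. immersion A (parallel_hypersurface \<phi> n \<epsilon> t)" and st: "s \<in> {0..1}" "t \<in> {0..1}" for \<epsilon> s t
  proof (rule area_constant[OF _ st])
    show "D \<epsilon> c t u \<noteq> 0" if "c \<in> A" "t \<in> {0..1}" "u \<in> codom_of c" for c t u
      using imm inj_differential_iff[OF that] that unfolding immersion_def by blast
  qed
  then show ?thesis
    using parallel_immersions by blast
qed

end
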